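(* For $1\leq i\leq n$, let $G_i$ be a non-elementary group with a finite, symmetric generating set $S_i$. Let $\mathcal{X}_i$ be the Cayley graph of $G_i$ with respect to $S_i$, and suppose that the action of $G_i$ on $\mathcal{X}_i$ by left multiplication has a strongly contracting element. Suppose $n\ge 2$ and let $G=G_1\times\cdots\times G_n$. Let $$S^1=\bigcup_{1\le i\le n}\{(s_1,\dots,s_n)\mid s_j=1\text{ for }j\ne i\text{ and }s_i\in S_i\},\qquad S^\infty=\{(s_1,\dots,s_n)\mid s_i\in S_i\cup\{1\}\text{ for all }i\}.$$ Then $S^1$ and $S^\infty$ are finite generating sets of $G$ such that the action of $G$ by left multiplication on the Cayley graph of $G$ with respect to $S^1$ is not growth tight, while the action of $G$ by left multiplication on the Cayley graph of $G$ with respect to $S^\infty$ is growth tight.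
   Context: A group is elementary if it is finite or has an infinite cyclic subgroup of finite index; non-elementary means not elementary. Strongly contracting elements. Let $(X,d)$ be a proper geodesic metric space. For a subset $A\subset X$ and $C>0$, a map $\pi_A\colon X\to A$ is a $C$-strongly contracting projection if (i) $d(a,\pi_A(a))\le C$ for every $a\in A$, and (ii) for all $x,y\in X$ with $d(\pi_A(x),\pi_A(y))>C$, every geodesic segment $P$ with endpoints $x$ and $y$ satisfies $d(\pi_A(x),P)\le C$ and $d(\pi_A(y),P)\le C$. Let $G$ be a finitely generated group acting properly discontinuously, cocompactly and by isometries on $X$, with base point $o\in X$. An element $h\in G$ is $C$-strongly contracting if $i\mapsto h^i.o$ ($i\in\mathbb{Z}$) is a quasi-geodesic and for every geodesic segment $P$ with endpoints on $\langle h\rangle.o$ there is a $C$-strongly contracting projection $\pi_P\colon X\to P$. It is strongly contracting if it is $C$-strongly contracting for some $C>0$. Growth. For a set $A$ with a pseudo-metric $d$ and base point $a_0\in A$, the growth exponent is $\delta_{A,d}=\limsup_{r\to\infty}\frac1r\log\#\{a\in A\mid d(a_0,a)\le r\}$ (independent of the base point). If $G$ acts properly discontinuously and cocompactly by isometries on a proper based geodesic metric space $(X,d,o)$ and $N$ is a normal subgroup of $G$, then $G/N$ carries the left invariant pseudo-metric $\bar d(gN,g'N)=\min_{n,n'\in N}d(gn.o,g'n'.o)$. Write $\delta_{G/N}=\delta_{G/N,\bar d}$ and $\delta_G=\delta_{G/\{1\}}$. The action is growth tight if $\delta_G>\delta_{G/N}$ for every infinite normal subgroup $N$ of $G$. Cayley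 graphs carry the path metric with edges of length 1, with base point the identity. *)

theory Defs
  imports Complex_Main "HOL-Library.Extended_Real" "HOL-Library.Liminf_Limsup"
    "HOL-Library.FuncSet" "HOL-Algebra.Coset" "HOL-Algebra.Generated_Groups"
    "HOL-Algebra.Product_Groups"
begin

section \<open>Groups and generating sets\<close>

definition elementary_group :: "('a, 'b) monoid_scheme \<Rightarrow> bool" where
  "elementary_group G \<longleftrightarrow>
     finite (carrier G) \<or>
     (\<exists>h\<in>carrier G. infinite (generate G {h}) \<and> finite (rcosets\<^bsub>G\<^esub> (generate G {h})))"

definition finite_generating_set :: "('a, 'b) monoid_scheme \<Rightarrow> 'a set \<Rightarrow> bool" where
  "finite_generating_set G S \<longleftrightarrow> finite S \<and> S \<subseteq> carrier G \<and> generate G S = carrier G"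

definition symmetric_subset :: "('a, 'b) monoid_scheme \<Rightarrow> 'a set \<Rightarrow> bool" where
  "symmetric_subset G S \<longleftrightarrow> (\<forall>s\<in>S. inv\<^bsub>G\<^esub> s \<in> S)"


section \<open>Geodesics and strong contraction\<close>

text \<open>A metric space is given, as in the locale \<open>Metric_space\<close> of HOL-Analysis, by its underlying
  set \<open>M\<close> and its distance function \<open>d\<close>; an action of \<open>G\<close> on it is a function \<open>act\<close> taking a group
  element to a self-map of \<open>M\<close>. The standing assumptions under which the following notions are
  used (\<open>M\<close> proper and geodesic, the action isometric, properly discontinuous and cocompact)
  are not part of the definitions.\<close>

definition geodesic_segment ::
    "'p set \<Rightarrow> ('p \<Rightarrow> 'p \<Rightarrow> real) \<Rightarrow> 'p \<Rightarrow> 'p \<Rightarrow> 'p set \<Rightarrow> bool" where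
  "geodesic_segment M d x y P \<longleftrightarrow>
     (\<exists>L \<gamma>. 0 \<le> L \<and> \<gamma> \<in> {0..L} \<rightarrow> M \<and> \<gamma> 0 = x \<and> \<gamma> L = y \<and>
            (\<forall>s\<in>{0..L}. \<forall>t\<in>{0..L}. d (\<gamma> s) (\<gamma> t) = \<bar>s - t\<bar>) \<and>
            P = \<gamma> ` {0..L})"

definition dist_to_set :: "('p \<Rightarrow> 'p \<Rightarrow> real) \<Rightarrow> 'p \<Rightarrow> 'p set \<Rightarrow> real" where
  "dist_to_set d x P = (INF y\<in>P. d x y)"

definition strongly_contracting_projection ::
    "'p set \<Rightarrow> ('p \<Rightarrow> 'p \<Rightarrow> real) \<Rightarrow> real \<Rightarrow> 'p set \<Rightarrow> ('p \<Rightarrow> 'p) \<Rightarrow> bool" where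
  "strongly_contracting_projection M d C A \<pi> \<longleftrightarrow>
     \<pi> \<in> M \<rightarrow> A \<and>
     (\<forall>a\<in>A. d a (\<pi> a) \<le> C) \<and>
     (\<forall>x\<in>M. \<forall>y\<in>M. d (\<pi> x) (\<pi> y) > C \<longrightarrow>
        (\<forall>P. geodesic_segment M d x y P \<longrightarrow>
           dist_to_set d (\<pi> x) P \<le> C \<and> dist_to_set d (\<pi> y) P \<le> C))"

definition quasi_geodesic_line :: "('p \<Rightarrow> 'p \<Rightarrow> real) \<Rightarrow> (int \<Rightarrow> 'p) \<Rightarrow> bool" where
  "quasi_geodesic_line d f \<longleftrightarrow>
     (\<exists>K\<ge>1. \<exists>\<epsilon>\<ge>0. \<forall>i j.
        \<bar>real_of_int (i - j)\<bar> / K - \<epsilon> \<le> d (f i) (f j) \<and>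
        d (f i) (f j) \<le> K * \<bar>real_of_int (i - j)\<bar> + \<epsilon>)"

definition strongly_contracting_with ::
    "('a, 'b) monoid_scheme \<Rightarrow> 'p set \<Rightarrow> ('p \<Rightarrow> 'p \<Rightarrow> real) \<Rightarrow> ('a \<Rightarrow> 'p \<Rightarrow> 'p) \<Rightarrow> 'p \<Rightarrow> real \<Rightarrow> 'a \<Rightarrow> bool" where
  "strongly_contracting_with G M d act x\<^sub>0 C h \<longleftrightarrow>
     quasi_geodesic_line d (\<lambda>i::int. act (h [^]\<^bsub>G\<^esub> i) x\<^sub>0) \<and>
     (\<forall>x \<in> (\<lambda>g. act g x\<^sub>0) ` generate G {h}. \<forall>y \<in> (\<lambda>g. act g x\<^sub>0) ` generate G {h}.
        \<forall>P. geodesic_segment M d x y P \<longrightarrow>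
          (\<exists>\<pi>. strongly_contracting_projection M d C P \<pi>))"

definition strongly_contracting ::
    "('a, 'b) monoid_scheme \<Rightarrow> 'p set \<Rightarrow> ('p \<Rightarrow> 'p \<Rightarrow> real) \<Rightarrow> ('a \<Rightarrow> 'p \<Rightarrow> 'p) \<Rightarrow> 'p \<Rightarrow> 'a \<Rightarrow> bool" where
  "strongly_contracting G M d act x\<^sub>0 h \<longleftrightarrow>
     h \<in> carrier G \<and> (\<exists>C>0. strongly_contracting_with G M d act x\<^sub>0 C h)"


section \<open>Growth\<close>

text \<open>\<open>card\<close> sends infinite sets to 0, so this is the growth exponent only when all balls are
  finite, as they are for orbits of properly discontinuous actions on proper spaces and
  for quotients of such orbits.\<close>

definition growth_exponent :: "'c set \<Rightarrow> ('c \<Rightarrow> 'c \<Rightarrow> real) \<Rightarrow> 'c \<Rightarrow> ereal" where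
  "growth_exponent A d a\<^sub>0 =
     Limsup at_top (\<lambda>r::real. ereal (1 / r * ln (real (card {a\<in>A. d a\<^sub>0 a \<le> r}))))"

text \<open>The infimum is the minimum over representatives: orbits of properly discontinuous actions on
  proper spaces are locally finite.\<close>

definition coset_dist ::
    "('p \<Rightarrow> 'p \<Rightarrow> real) \<Rightarrow> ('a \<Rightarrow> 'p \<Rightarrow> 'p) \<Rightarrow> 'p \<Rightarrow> 'a set \<Rightarrow> 'a set \<Rightarrow> real" where
  "coset_dist d act x\<^sub>0 A B = (INF (a, b)\<in>A \<times> B. d (act a x\<^sub>0) (act b x\<^sub>0))"

text \<open>The elements of \<open>G Mod N\<close> are the cosets themselves, and the base point is the coset \<open>N\<close>.\<close>

definition quotient_growth ::
    "('a, 'b) monoid_scheme \<Rightarrow> ('p \<Rightarrow> 'p \<Rightarrow> real) \<Rightarrow> ('a \<Rightarrow> 'p \<Rightarrow> 'p) \<Rightarrow> 'p \<Rightarrow> 'a set \<Rightarrow> ereal" where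
  "quotient_growth G d act x\<^sub>0 N =
     growth_exponent (carrier (G Mod N)) (coset_dist d act x\<^sub>0) N"

definition growth_tight ::
    "('a, 'b) monoid_scheme \<Rightarrow> ('p \<Rightarrow> 'p \<Rightarrow> real) \<Rightarrow> ('a \<Rightarrow> 'p \<Rightarrow> 'p) \<Rightarrow> 'p \<Rightarrow> bool" where
  "growth_tight G d act x\<^sub>0 \<longleftrightarrow>
     (\<forall>N. N \<lhd> G \<and> infinite N \<longrightarrow>
        quotient_growth G d act x\<^sub>0 {\<one>\<^bsub>G\<^esub>} > quotient_growth G d act x\<^sub>0 N)"


section \<open>Cayley graphs\<close>

text \<open>The Cayley graph is the geometric realization of the graph with vertex set \<open>carrier G\<close> in
  which \<open>g\<close> and \<open>g s\<close> are joined by an edge for \<open>s \<in> S\<close>. A cell is the vertex set of a vertex or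
  of an edge, and points are given by barycentric coordinates: a point is a function
  \<open>carrier G \<rightarrow> [0, 1]\<close> supported in a cell and of total mass 1. The edges \<open>(g, s)\<close> and
  \<open>(g s, inv s)\<close> are identified, and \<open>s = \<one>\<close> gives no edge.\<close>

definition cayley_cells :: "('a, 'b) monoid_scheme \<Rightarrow> 'a set \<Rightarrow> 'a set set" where
  "cayley_cells G S =
     {{g} | g. g \<in> carrier G} \<union> {{g, g \<otimes>\<^bsub>G\<^esub> s} | g s. g \<in> carrier G \<and> s \<in> S}"

definition cell_points :: "'a set \<Rightarrow> ('a \<Rightarrow> real) set" where
  "cell_points c = {p. (\<forall>x. 0 \<le> p x) \<and> (\<forall>x. x \<notin> c \<longrightarrow> p x = 0) \<and> (\<Sum>x\<in>c. p x) = 1}"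

definition cayley_points :: "('a, 'b) monoid_scheme \<Rightarrow> 'a set \<Rightarrow> ('a \<Rightarrow> real) set" where
  "cayley_points G S = (\<Union>c\<in>cayley_cells G S. cell_points c)"

definition cayley_vertex :: "'a \<Rightarrow> 'a \<Rightarrow> real" where
  "cayley_vertex g = (\<lambda>x. if x = g then 1 else 0)"

text \<open>\<open>cayley_path G S p q l\<close>: there is a piecewise linear path of length \<open>l\<close> from \<open>p\<close> to \<open>q\<close>. On an
  edge \<open>{u, v}\<close> the coordinate at \<open>u\<close> is an affine parametrization by \<open>[0, 1]\<close>, and the coordinates
  at \<open>u\<close> and \<open>v\<close> add up to 1, so the choice of \<open>u\<close> in the rule below is immaterial.\<close>

inductive cayley_path ::
    "('a, 'b) monoid_scheme \<Rightarrow> 'a set \<Rightarrow> ('a \<Rightarrow> real) \<Rightarrow> ('a \<Rightarrow> real) \<Rightarrow> real \<Rightarrow> bool"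
  for G S where
  refl: "p \<in> cayley_points G S \<Longrightarrow> cayley_path G S p p 0"
| step: "\<lbrakk>cayley_path G S p q l; c \<in> cayley_cells G S; q \<in> cell_points c; r \<in> cell_points c; u \<in> c\<rbrakk>
         \<Longrightarrow> cayley_path G S p r (l + \<bar>q u - r u\<bar>)"

definition cayley_dist ::
    "('a, 'b) monoid_scheme \<Rightarrow> 'a set \<Rightarrow> ('a \<Rightarrow> real) \<Rightarrow> ('a \<Rightarrow> real) \<Rightarrow> real" where
  "cayley_dist G S p q =
     (if p \<in> cayley_points G S \<and> q \<in> cayley_points G S then Inf {l. cayley_path G S p q l} else 0)"

text \<open>Left multiplication by \<open>g\<close> moves the coordinate at \<open>x\<close> to \<open>g x\<close>.\<close>

definition cayley_act ::
    "('a, 'b) monoid_scheme \<Rightarrow> 'a set \<Rightarrow> 'a \<Rightarrow> ('a \<Rightarrow> real) \<Rightarrow> ('a \<Rightarrow> real)" where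
  "cayley_act G S g =
     (\<lambda>p\<in>cayley_points G S. \<lambda>x. if x \<in> carrier G then p (inv\<^bsub>G\<^esub> g \<otimes>\<^bsub>G\<^esub> x) else 0)"

definition cayley_has_strongly_contracting_element ::
    "('a, 'b) monoid_scheme \<Rightarrow> 'a set \<Rightarrow> bool" where
  "cayley_has_strongly_contracting_element G S \<longleftrightarrow>
     (\<exists>h. strongly_contracting G (cayley_points G S) (cayley_dist G S) (cayley_act G S)
            (cayley_vertex \<one>\<^bsub>G\<^esub>) h)"

definition cayley_growth_tight :: "('a, 'b) monoid_scheme \<Rightarrow> 'a set \<Rightarrow> bool" where
  "cayley_growth_tight G S \<longleftrightarrow>
     growth_tight G (cayley_dist G S) (cayley_act G S) (cayley_vertex \<one>\<^bsub>G\<^esub>)"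


section \<open>Generating sets of a product\<close>

text \<open>Elements of \<open>product_group I G\<close> are functions that are \<open>undefined\<close> outside \<open>I\<close>.\<close>

definition product_gens_one :: "'i set \<Rightarrow> ('i \<Rightarrow> ('a, 'b) monoid_scheme) \<Rightarrow> ('i \<Rightarrow> 'a set) \<Rightarrow> ('i \<Rightarrow> 'a) set" where
  "product_gens_one I G S =
     (\<Union>i\<in>I. {s \<in> carrier (product_group I G). (\<forall>j\<in>I. j \<noteq> i \<longrightarrow> s j = \<one>\<^bsub>G j\<^esub>) \<and> s i \<in> S i})"

definition product_gens_infty :: "'i set \<Rightarrow> ('i \<Rightarrow> ('a, 'b) monoid_scheme) \<Rightarrow> ('i \<Rightarrow> 'a set) \<Rightarrow> ('i \<Rightarrow> 'a) set" where
  "product_gens_infty I G S =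
     {s \<in> carrier (product_group I G). \<forall>i\<in>I. s i \<in> S i \<union> {\<one>\<^bsub>G i\<^esub>}}"

end

theory Submission
  imports Defs
begin

text \<open>For \<open>S\<^sup>1\<close>, counting with exponential weights shows that the product grows only as fast as its
  fastest factor \<open>G\<^sub>i\<close>, and this growth survives in the quotient by the kernel of the projection to
  \<open>G\<^sub>i\<close>.

  For \<open>S\<^sup>\<infinity>\<close>, balls are products of balls, so growth rates add up. An infinite normal subgroup \<open>N\<close> has
  infinite projection to some \<open>G\<^sub>i\<close>; commutators of \<open>N\<close> with \<open>G\<^sub>i\<close> show that even \<open>N \<inter> G\<^sub>i\<close> is
  infinite, and it remains to see that each \<open>G\<^sub>i\<close> is growth tight.

  So let \<open>N\<close> be infinite and normal in a single group \<open>G\<close>, with strongly contracting element \<open>h\<close> and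
  axis \<open>L = \<langle>h\<rangle>\<close>. Since \<open>G\<close> is not elementary, \<open>N\<close> contains an \<open>m\<close> that does not commensurate \<open>L\<close>, so
  the translates \<open>m L\<close> and \<open>m\<^sup>-\<^sup>1 L\<close> have bounded projections to \<open>L\<close>. For large \<open>k\<close> put
  \<open>W = h\<^sup>k m h\<^sup>-\<^sup>k \<in> N\<close>. Every coset of \<open>N\<close> has an almost shortest representative, corrected by \<open>m\<close> on
  both sides, whose projection to \<open>L\<close> is close to \<open>\<one>\<close>. A product \<open>b\<^sub>1 W b\<^sub>2 W \<dots>\<close> of such representatives
  passes close to each of its blocks \<open>W\<close>; an almost shortest \<open>b\<close> cannot, because cutting out
  \<open>W \<in> N\<close> would shorten it within its coset. Hence the product determines \<open>b\<^sub>1\<close> up to boundedly many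
  choices. As the exponential sum over \<open>G/N\<close> diverges at the growth rate of \<open>G/N\<close>, these products
  already grow strictly faster than \<open>G/N\<close>.\<close>

section \<open>Word metrics\<close>

text \<open>Strong contraction speaks of points of the geometric realization and of one geodesic
  segment at a time, whereas the counting needs one inequality for nearest points on the orbit of
  \<langle>h\<rangle>. Hence two conversions, from points to vertices and from segments to the
  orbit, each with a larger constant.

  No free submonoid is exhibited: a product of blocks may be parsed in several ways. It is enough to
  bound the number of possible first factors by some \<beta> independent of the exponent s. As the
  series of G converges for s above the growth rate of G, comparing it with powers of the sum over
  the factors keeps this sum below \<beta>. If the rate of G were at most the rate \<gamma> of G/N,
  the bound would persist as s decreases to \<gamma>. Submultiplicativity excludes this: a ball of
  radius n in G/N has at least exp(\<gamma> n) elements, so the series of G/N diverges at \<gamma>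
  itself and not only below it. This needs \<gamma> > 0 (finite quotients have rate 0), so positive
  growth of G gets its own proof, by a parsing with two letters.\<close>

primrec wball :: "('a, 'b) monoid_scheme \<Rightarrow> 'a set \<Rightarrow> nat \<Rightarrow> 'a set" where
  "wball G S 0 = {\<one>\<^bsub>G\<^esub>}"
| "wball G S (Suc n) = wball G S n \<union> {g \<otimes>\<^bsub>G\<^esub> s | g s. g \<in> wball G S n \<and> s \<in> S}"

definition wlen :: "('a, 'b) monoid_scheme \<Rightarrow> 'a set \<Rightarrow> 'a \<Rightarrow> nat" where
  "wlen G S g = (LEAST n. g \<in> wball G S n)"

definition wdist :: "('a, 'b) monoid_scheme \<Rightarrow> 'a set \<Rightarrow> 'a \<Rightarrow> 'a \<Rightarrow> real" where
  "wdist G S x y = real (wlen G S (inv\<^bsub>G\<^esub> x \<otimes>\<^bsub>G\<^esub> y))"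

locale marked_group = group G for G (structure) +
  fixes S
  assumes finite_gens: "finite S"
    and gens_closed: "S \<subseteq> carrier G"
    and gens_inv: "s \<in> S \<Longrightarrow> inv s \<in> S"
    and gens_generate: "generate G S = carrier G"
begin

abbreviation ball where "ball \<equiv> wball G S"
abbreviation len where "len \<equiv> wlen G S"
abbreviation d where "d \<equiv> wdist G S"

lemma ball_closed: "g \<in> ball n \<Longrightarrow> g \<in> carrier G"
  using gens_closed by (induction n arbitrary: g) auto

lemma ball_mono: "m \<le> n \<Longrightarrow> ball m \<subseteq> ball n"
  by (rule lift_Suc_mono_le) auto

lemma finite_ball: "finite (ball n)"
proof (induction n)
  case (Suc n)
  have "{g \<otimes> s | g s. g \<in> ball n \<and> s \<in> S} = (\<lambda>(g, s). g \<otimes> s) ` (ball n \<times> S)"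
    by auto
  then show ?case
    using Suc finite_gens by simp
qed simp

lemma one_ball: "\<one> \<in> ball n"
  by (induction n) auto

lemma gen_ball: "s \<in> S \<Longrightarrow> s \<in> ball 1"
  using gens_closed by force

lemma ball_mult: "\<lbrakk>g \<in> ball m; x \<in> ball n\<rbrakk> \<Longrightarrow> g \<otimes> x \<in> ball (m + n)"
proof (induction n arbitrary: x)
  case 0
  then show ?case using ball_closed by auto
next
  case (Suc n)
  consider "x \<in> ball n" | y s where "x = y \<otimes> s" "y \<in> ball n" "s \<in> S"
    using Suc.prems(2) by auto
  then show ?case
  proof cases
    case 1
    then show ?thesis using Suc by auto
  next
    case 2
    then have "g \<otimes> x = (g \<otimes> y) \<otimes> s"
      using Suc.prems(1) ball_closed gens_closed by (simp add: m_assoc subsetD)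
    then show ?thesis using Suc 2 by auto
  qed
qed

lemma ball_inv: "g \<in> ball n \<Longrightarrow> inv g \<in> ball n"
proof (induction n arbitrary: g)
  case (Suc n)
  consider "g \<in> ball n" | y s where "g = y \<otimes> s" "y \<in> ball n" "s \<in> S"
    using Suc.prems by auto
  then show ?case
  proof cases
    case 2
    then have "inv g = inv s \<otimes> inv y"
      using ball_closed gens_closed inv_mult_group by (simp add: subsetD)
    moreover have "inv s \<otimes> inv y \<in> ball (1 + n)"
      using 2 Suc.IH gens_inv gen_ball by (intro ball_mult) auto
    ultimately show ?thesis by simp
  qed (use Suc.IH in auto)
qed auto

text \<open>Cutting a word after its first \<open>m\<close> letters. This converse of
  \<open>ball_mult\<close> is what makes growth in quotients submultiplicative.\<close>

lemma ball_split:
  "g \<in> ball (m + n) \<Longrightarrow> \<exists>x\<in>ball m. \<exists>y\<in>ball n. g = x \<otimes> y"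
proof (induction n arbitrary: g)
  case 0
  then show ?case using ball_closed by force
next
  case (Suc n)
  consider "g \<in> ball (m + n)" | x s where "g = x \<otimes> s" "x \<in> ball (m + n)" "s \<in> S"
    using Suc.prems by auto
  then show ?case
  proof cases
    case 1
    then show ?thesis using Suc.IH by fastforce
  next
    case 2
    then obtain y z where yz: "y \<in> ball m" "z \<in> ball n" "x = y \<otimes> z"
      using Suc.IH by blast
    then have "g = y \<otimes> (z \<otimes> s)"
      using 2 ball_closed gens_closed by (simp add: m_assoc subsetD)
    then show ?thesis using yz 2 by auto
  qed
qed

lemma ball_exhaust:
  assumes "g \<in> carrier G" obtains n where "g \<in> ball n"
proof -
  have "g \<in> generate G S" using assms gens_generate by simp
  then have "\<exists>n. g \<in> ball n"
  proof (induction rule: generate.induct)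
    case (incl h) then show ?case using gen_ball by blast
  next
    case (inv h) then show ?case using gen_ball gens_inv by blast
  next
    case (eng h1 h2) then show ?case using ball_mult by blast
  qed (use one_ball in blast)
  then show ?thesis using that by blast
qed

lemma len_le_iff: "g \<in> carrier G \<Longrightarrow> len g \<le> n \<longleftrightarrow> g \<in> ball n"
proof
  assume g: "g \<in> carrier G" and "len g \<le> n"
  then have "g \<in> ball (len g)"
    unfolding wlen_def using ball_exhaust LeastI_ex by metis
  then show "g \<in> ball n" using ball_mono \<open>len g \<le> n\<close> by blast
next
  assume "g \<in> ball n" then show "len g \<le> n"
    unfolding wlen_def by (rule Least_le)
qed

lemma len_one [simp]: "len \<one> = 0"
  using len_le_iff[of \<one> 0] one_ball[of 0] by simp

lemma len_eq_0_iff: "g \<in> carrier G \<Longrightarrow> len g = 0 \<longleftrightarrow> g = \<one>"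
  using len_le_iff[of g 0] by auto

lemma len_mult: "\<lbrakk>g \<in> carrier G; x \<in> carrier G\<rbrakk> \<Longrightarrow> len (g \<otimes> x) \<le> len g + len x"
  using len_le_iff ball_mult by (metis m_closed order_refl)

lemma len_inv: "g \<in> carrier G \<Longrightarrow> len (inv g) = len g"
  by (metis ball_inv inv_closed inv_inv len_le_iff le_antisym order_refl)

lemma len_gen: "s \<in> S \<Longrightarrow> len s \<le> 1"
  using len_le_iff gen_ball gens_closed by blast

lemma inv_mult_cancel [simp]:
  "\<lbrakk>g \<in> carrier G; x \<in> carrier G\<rbrakk> \<Longrightarrow> inv g \<otimes> (g \<otimes> x) = x"
  "\<lbrakk>g \<in> carrier G; x \<in> carrier G\<rbrakk> \<Longrightarrow> g \<otimes> (inv g \<otimes> x) = x"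
  by (simp_all add: m_assoc[symmetric])

lemma d_nonneg [simp]: "0 \<le> d x y"
  by (simp add: wdist_def)

lemma d_self [simp]: "x \<in> carrier G \<Longrightarrow> d x x = 0"
  by (simp add: wdist_def)

lemma d_eq_0_iff: "\<lbrakk>x \<in> carrier G; y \<in> carrier G\<rbrakk> \<Longrightarrow> d x y = 0 \<longleftrightarrow> x = y"
proof -
  assume x: "x \<in> carrier G" and y: "y \<in> carrier G"
  have "d x y = 0 \<longleftrightarrow> inv x \<otimes> y = \<one>"
    using x y by (simp add: wdist_def len_eq_0_iff)
  also have "\<dots> \<longleftrightarrow> x = y"
    using x y inv_mult_cancel(2) by fastforce
  finally show ?thesis .
qed

lemma d_commute: "\<lbrakk>x \<in> carrier G; y \<in> carrier G\<rbrakk> \<Longrightarrow> d x y = d y x"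
  unfolding wdist_def using len_inv[of "inv x \<otimes> y"] by (simp add: inv_mult_group)

lemma d_triangle:
  "\<lbrakk>x \<in> carrier G; y \<in> carrier G; z \<in> carrier G\<rbrakk> \<Longrightarrow> d x z \<le> d x y + d y z"
proof -
  assume *: "x \<in> carrier G" "y \<in> carrier G" "z \<in> carrier G"
  then have "inv x \<otimes> z = (inv x \<otimes> y) \<otimes> (inv y \<otimes> z)"
    by (simp add: m_assoc)
  then show ?thesis
    unfolding wdist_def using len_mult[of "inv x \<otimes> y" "inv y \<otimes> z"] * by simp
qed

lemma d_translate [simp]:
  "\<lbrakk>g \<in> carrier G; x \<in> carrier G; y \<in> carrier G\<rbrakk> \<Longrightarrow> d (g \<otimes> x) (g \<otimes> y) = d x y"
  by (simp add: wdist_def inv_mult_group m_assoc)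

lemma d_one: "x \<in> carrier G \<Longrightarrow> d \<one> x = real (len x)"
  by (simp add: wdist_def)

lemma d_mult_right: "\<lbrakk>x \<in> carrier G; g \<in> carrier G\<rbrakk> \<Longrightarrow> d x (x \<otimes> g) = real (len g)"
  by (simp add: wdist_def)

text \<open>The path is constant after time \<open>n\<close>, so that every \<open>w i\<close> with its successor spans a cell.\<close>
definition word_geodesic :: "'a \<Rightarrow> 'a \<Rightarrow> nat \<Rightarrow> (nat \<Rightarrow> 'a) \<Rightarrow> bool" where
  "word_geodesic x y n w \<longleftrightarrow> range w \<subseteq> carrier G \<and> w 0 = x \<and> (\<forall>i\<ge>n. w i = y) \<and>
     (\<forall>i. \<exists>s\<in>S \<union> {\<one>}. w (Suc i) = w i \<otimes> s) \<and>
     (\<forall>i\<le>n. \<forall>j\<le>n. d (w i) (w j) = \<bar>real i - real j\<bar>)"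

lemma word_path_exists:
  "\<lbrakk>x \<in> carrier G; g \<in> ball n\<rbrakk> \<Longrightarrow>
     \<exists>w. range w \<subseteq> carrier G \<and> w 0 = x \<and> (\<forall>i\<ge>n. w i = x \<otimes> g) \<and>
         (\<forall>i. \<exists>s\<in>S \<union> {\<one>}. w (Suc i) = w i \<otimes> s)"
proof (induction n arbitrary: g)
  case 0
  then show ?case by (intro exI[of _ "\<lambda>_. x"]) auto
next
  case (Suc n)
  \<comment> \<open>A shorter \<open>g\<close> is padded with the letter \<open>\<one>\<close>, so
    that every path has exactly \<open>Suc n\<close> steps.\<close>
  obtain y s where ys: "g = y \<otimes> s" "y \<in> ball n" "s \<in> S \<union> {\<one>}"
    using Suc.prems(2) by (cases "g \<in> ball n") (use ball_closed r_one in force, auto)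
  obtain w where w: "range w \<subseteq> carrier G" "w 0 = x" "\<forall>i\<ge>n. w i = x \<otimes> y"
    "\<forall>i. \<exists>s\<in>S \<union> {\<one>}. w (Suc i) = w i \<otimes> s"
    using Suc.IH Suc.prems(1) ys(2) by blast
  let ?v = "\<lambda>i. if i \<le> n then w i else x \<otimes> g"
  have g: "g \<in> carrier G" using Suc.prems(2) ball_closed by blast
  have step: "x \<otimes> g = w n \<otimes> s"
    using w(3) ys Suc.prems(1) ball_closed gens_closed by (auto simp: m_assoc)
  have "\<exists>s\<in>S \<union> {\<one>}. ?v (Suc i) = ?v i \<otimes> s" for i
  proof (cases "i < n")
    case True
    then show ?thesis using w(4) by simp
  next
    case False
    show ?thesis
    proof (cases "i = n")
      case True
      then show ?thesis using step ys(3) by auto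
    next
      case b: False
      then have "\<not> i \<le> n" using False by simp
      then show ?thesis using Suc.prems(1) g by (intro bexI[of _ \<one>]) auto
    qed
  qed
  then show ?case
    using w(1,2) Suc.prems(1) g by (intro exI[of _ ?v]) auto
qed

lemma word_geodesic_exists:
  assumes x: "x \<in> carrier G" and y: "y \<in> carrier G"
  obtains n w where "word_geodesic x y n w" "real n = d x y"
proof -
  define n where "n = len (inv x \<otimes> y)"
  have "inv x \<otimes> y \<in> ball n"
    using x y len_le_iff[of "inv x \<otimes> y" n] by (simp add: n_def)
  then obtain w where w: "range w \<subseteq> carrier G" "w 0 = x" "\<forall>i\<ge>n. w i = x \<otimes> (inv x \<otimes> y)"
    "\<forall>i. \<exists>s\<in>S \<union> {\<one>}. w (Suc i) = w i \<otimes> s"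
    using word_path_exists x by blast
  have wy: "\<forall>i\<ge>n. w i = y" using w(3) x y by simp
  have wc: "w i \<in> carrier G" for i using w(1) by auto
  have step: "d (w i) (w (Suc i)) \<le> 1" for i
  proof -
    obtain s where s: "s \<in> S \<union> {\<one>}" "w (Suc i) = w i \<otimes> s" using w(4) by blast
    then have "d (w i) (w (Suc i)) = real (len s)"
      using d_mult_right wc gens_closed by auto
    then show ?thesis using s len_gen by auto
  qed
  have up: "d (w i) (w (i + j)) \<le> real j" for i j
  proof (induction j)
    case (Suc j)
    have "d (w i) (w (i + Suc j)) \<le> d (w i) (w (i + j)) + d (w (i + j)) (w (Suc (i + j)))"
      using d_triangle wc by simp
    then show ?case using Suc step[of "i + j"] by simp
  qed (simp add: wc)
  have dn: "d x y = real n" by (simp add: n_def wdist_def)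
  \<comment> \<open>No piece of the path can be shorter than its number of steps, because the three
    pieces together have to cover the distance \<open>n\<close>.\<close>
  have eq: "d (w i) (w j) = real j - real i" if "i \<le> j" "j \<le> n" for i j
  proof -
    have "real n = d (w 0) (w n)" using dn w(2) wy by simp
    also have "\<dots> \<le> d (w 0) (w i) + d (w i) (w j) + d (w j) (w n)"
      using d_triangle[of "w 0" "w i" "w n"] d_triangle[of "w i" "w j" "w n"] wc by force
    also have "\<dots> \<le> real i + d (w i) (w j) + (real n - real j)"
      using up[of 0 i] up[of j "n - j"] that by simp
    finally show ?thesis using up[of i "j - i"] that by simp
  qed
  have "d (w i) (w j) = \<bar>real i - real j\<bar>" if "i \<le> n" "j \<le> n" for i j
    using eq[of i j] eq[of j i] that d_commute[of "w i" "w j"] wc by (cases "i \<le> j") auto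
  then have "word_geodesic x y n w"
    unfolding word_geodesic_def using w wy by blast
  then show ?thesis using that dn by metis
qed

end

section \<open>Distances and geodesics in the Cayley graph\<close>

lemma cayley_path_trans:
  "\<lbrakk>cayley_path G S q r l'; cayley_path G S p q l\<rbrakk> \<Longrightarrow> cayley_path G S p r (l + l')"
proof (induction rule: cayley_path.induct)
  case (step a b l1 c r u)
  then have "cayley_path G S p r ((l + l1) + \<bar>b u - r u\<bar>)"
    by (blast intro: cayley_path.step)
  then show ?case by (simp add: add.assoc)
qed simp

lemma cayley_path_points:
  "cayley_path G S p q l \<Longrightarrow> p \<in> cayley_points G S \<and> q \<in> cayley_points G S \<and> 0 \<le> l"
  by (induction rule: cayley_path.induct) (auto simp: cayley_points_def)

lemma cell_path:
  assumes "c \<in> cayley_cells G S" "p \<in> cell_points c" "q \<in> cell_points c" "u \<in> c"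
  shows "cayley_path G S p q \<bar>p u - q u\<bar>"
proof -
  have "p \<in> cayley_points G S" using assms by (auto simp: cayley_points_def)
  then have "cayley_path G S p q (0 + \<bar>p u - q u\<bar>)"
    using assms by (blast intro: cayley_path.intros)
  then show ?thesis by simp
qed

lemma cayley_path_sym: "cayley_path G S p q l \<Longrightarrow> cayley_path G S q p l"
proof (induction rule: cayley_path.induct)
  case (step p q l c r u)
  have "cayley_path G S r q \<bar>r u - q u\<bar>"
    using step by (intro cell_path)
  then show ?case using step.IH cayley_path_trans by (metis abs_minus_commute add.commute)
qed (rule cayley_path.refl)

context marked_group
begin

abbreviation X where "X \<equiv> cayley_points G S"
abbreviation vtx where "vtx \<equiv> cayley_vertex"
abbreviation D where "D \<equiv> cayley_dist G S"

lemma cell_finite: "c \<in> cayley_cells G S \<Longrightarrow> finite c \<and> c \<noteq> {} \<and> c \<subseteq> carrier G"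
  using gens_closed by (auto simp: cayley_cells_def)

lemma vertex_cell: "u \<in> c \<Longrightarrow> c \<in> cayley_cells G S \<Longrightarrow> vtx u \<in> cell_points c"
  using cell_finite[of c] by (auto simp: cell_points_def cayley_vertex_def)

lemma vertex_point: "g \<in> carrier G \<Longrightarrow> vtx g \<in> X"
  unfolding cayley_points_def
  by (rule UN_I[of "{g}"]) (auto intro: vertex_cell simp: cayley_cells_def)

lemma D_upper:
  "cayley_path G S p q l \<Longrightarrow> D p q \<le> l"
  unfolding cayley_dist_def using cayley_path_points
  by (fastforce intro!: cInf_lower bdd_belowI[of _ 0] dest: cayley_path_points)

lemma edge_cell: "\<lbrakk>g \<in> carrier G; s \<in> S \<union> {\<one>}\<rbrakk> \<Longrightarrow> {g, g \<otimes> s} \<in> cayley_cells G S"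
  by (auto simp: cayley_cells_def)

lemma vertex_path:
  "\<lbrakk>g \<in> carrier G; x \<in> ball n\<rbrakk> \<Longrightarrow> \<exists>l\<le>real n. cayley_path G S (vtx g) (vtx (g \<otimes> x)) l"
proof (induction n arbitrary: x)
  case 0
  then show ?case using cayley_path.refl vertex_point by fastforce
next
  case (Suc n)
  consider "x \<in> ball n" | y s where "x = y \<otimes> s" "y \<in> ball n" "s \<in> S"
    using Suc.prems(2) by auto
  then show ?case
  proof cases
    case 1
    then obtain l where "l \<le> real n" "cayley_path G S (vtx g) (vtx (g \<otimes> x)) l"
      using Suc by blast
    then show ?thesis by (intro exI[of _ l]) simp
  next
    case 2
    then obtain l where l: "l \<le> real n" "cayley_path G S (vtx g) (vtx (g \<otimes> y)) l"
      using Suc by blast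
    have gy: "g \<otimes> y \<in> carrier G" using Suc.prems(1) 2 ball_closed by blast
    have eq: "g \<otimes> x = (g \<otimes> y) \<otimes> s"
      using 2 Suc.prems(1) ball_closed gens_closed by (simp add: m_assoc subsetD)
    have cell: "{g \<otimes> y, g \<otimes> x} \<in> cayley_cells G S"
      using edge_cell[OF gy] 2 eq by simp
    have "cayley_path G S (vtx (g \<otimes> y)) (vtx (g \<otimes> x))
        \<bar>vtx (g \<otimes> y) (g \<otimes> y) - vtx (g \<otimes> x) (g \<otimes> y)\<bar>"
      using cell by (intro cell_path vertex_cell) auto
    then have "cayley_path G S (vtx g) (vtx (g \<otimes> x))
        (l + \<bar>vtx (g \<otimes> y) (g \<otimes> y) - vtx (g \<otimes> x) (g \<otimes> y)\<bar>)"
      using l cayley_path_trans by metis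
    moreover have "\<bar>vtx (g \<otimes> y) (g \<otimes> y) - vtx (g \<otimes> x) (g \<otimes> y)\<bar> \<le> 1"
      by (auto simp: cayley_vertex_def)
    ultimately show ?thesis using l(1) by (smt (verit) of_nat_Suc)
  qed
qed

lemma point_connected:
  assumes "p \<in> X"
  shows "\<exists>g\<in>carrier G. \<exists>l. cayley_path G S p (vtx g) l"
proof -
  obtain c where c: "c \<in> cayley_cells G S" "p \<in> cell_points c"
    using assms by (auto simp: cayley_points_def)
  then obtain u where "u \<in> c" using cell_finite by blast
  then show ?thesis using c cell_finite cell_path vertex_cell by (metis subsetD)
qed

lemma path_exists:
  assumes "p \<in> X" "q \<in> X" shows "\<exists>l. cayley_path G S p q l"
proof -
  obtain g l h l' where *: "g \<in> carrier G" "cayley_path G S p (vtx g) l"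
    "h \<in> carrier G" "cayley_path G S q (vtx h) l'"
    using assms point_connected by metis
  have "inv g \<otimes> h \<in> carrier G" using * by simp
  then obtain n where "inv g \<otimes> h \<in> ball n" by (rule ball_exhaust)
  then obtain l'' where l'': "cayley_path G S (vtx g) (vtx h) l''"
    using vertex_path[OF *(1), of "inv g \<otimes> h" n] * by auto
  show ?thesis
    using cayley_path_trans[OF cayley_path_sym[OF *(4)] cayley_path_trans[OF l'' *(2)]] by blast
qed

lemma D_approx:
  assumes "p \<in> X" "q \<in> X" "D p q < e"
  shows "\<exists>l<e. cayley_path G S p q l"
  using assms path_exists[OF assms(1,2)] cInf_lessD[of "{l. cayley_path G S p q l}" e]
  by (auto simp: cayley_dist_def)

lemma D_lower:
  assumes "p \<in> X" "q \<in> X" "\<And>l. cayley_path G S p q l \<Longrightarrow> e \<le> l"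
  shows "e \<le> D p q"
  using D_approx[OF assms(1,2)] assms(3) by (meson not_less order.strict_trans1)

lemma D_triangle:
  assumes "p \<in> X" "q \<in> X" "r \<in> X" shows "D p r \<le> D p q + D q r"
proof (rule field_le_epsilon)
  fix e :: real assume "e > 0"
  then obtain l l' where "l < D p q + e / 2" "cayley_path G S p q l"
      "l' < D q r + e / 2" "cayley_path G S q r l'"
    using D_approx[OF assms(1,2), of "D p q + e / 2"] D_approx[OF assms(2,3), of "D q r + e / 2"]
    by auto
  then show "D p r \<le> D p q + D q r + e"
    using D_upper cayley_path_trans by (smt (verit) field_sum_of_halves)
qed

lemma D_commute: "p \<in> X \<Longrightarrow> q \<in> X \<Longrightarrow> D p q = D q p"
  by (metis D_upper D_lower cayley_path_sym antisym)

lemma D_nonneg: "0 \<le> D p q"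
proof (cases "p \<in> X \<and> q \<in> X")
  case True
  then show ?thesis using D_lower cayley_path_points by meson
qed (auto simp: cayley_dist_def)

text \<open>The affine extension of \<open>d b\<close> to the Cayley graph is 1-Lipschitz on every cell, which bounds the
  length of paths from below.\<close>
definition mean_dist :: "'a \<Rightarrow> ('a \<Rightarrow> real) \<Rightarrow> real" where
  "mean_dist b p = (\<Sum>x | p x \<noteq> 0. p x * d b x)"

lemma mean_dist_cell:
  assumes "c \<in> cayley_cells G S" "p \<in> cell_points c"
  shows "mean_dist b p = (\<Sum>x\<in>c. p x * d b x)"
  unfolding mean_dist_def using assms cell_finite
  by (intro sum.mono_neutral_left) (auto simp: cell_points_def)

lemma d_step: "\<lbrakk>b \<in> carrier G; g \<in> carrier G; s \<in> S\<rbrakk> \<Longrightarrow> \<bar>d b (g \<otimes> s) - d b g\<bar> \<le> 1"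
proof -
  assume b: "b \<in> carrier G" and g: "g \<in> carrier G" and s: "s \<in> S"
  have sc: "s \<in> carrier G" using s gens_closed by blast
  have "d g (g \<otimes> s) \<le> 1"
    using d_mult_right[OF g sc] len_gen[OF s] by simp
  then show ?thesis
    using d_triangle[of b g "g \<otimes> s"] d_triangle[of b "g \<otimes> s" g] d_commute[of g "g \<otimes> s"] b g sc
    by auto
qed

lemma mean_dist_lipschitz:
  assumes "b \<in> carrier G" "c \<in> cayley_cells G S" "p \<in> cell_points c" "q \<in> cell_points c" "u \<in> c"
  shows "\<bar>mean_dist b p - mean_dist b q\<bar> \<le> \<bar>p u - q u\<bar>"
proof -
  obtain g s where g: "g \<in> carrier G" "c = {g} \<or> (c = {g, g \<otimes> s} \<and> s \<in> S)"
    using assms(2) by (auto simp: cayley_cells_def)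
  \<comment> \<open>A generator with \<open>g \<otimes> s = g\<close> gives a cell with a single
    vertex; a genuine edge has two coordinates.\<close>
  consider "c = {g}" | "c = {g, g \<otimes> s}" "s \<in> S" "g \<otimes> s \<noteq> g"
    using g by fastforce
  then show ?thesis
  proof cases
    case 1
    then show ?thesis
      using assms mean_dist_cell[OF assms(2,3)] mean_dist_cell[OF assms(2,4)]
      by (auto simp: cell_points_def)
  next
    case 2
    let ?v = "g \<otimes> s"
    have p: "p ?v = 1 - p g" and q: "q ?v = 1 - q g"
      using assms(3,4) 2 by (auto simp: cell_points_def)
    have mp: "mean_dist b p = p g * d b g + p ?v * d b ?v"
      and mq: "mean_dist b q = q g * d b g + q ?v * d b ?v"
      using 2 mean_dist_cell[OF assms(2,3)] mean_dist_cell[OF assms(2,4)] by auto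
    \<comment> \<open>The coordinates on the edge add up to 1, so the extension is affine in the
      coordinate at \<open>g\<close>. Its slope is the difference of the distances from
      \<open>b\<close> to two adjacent vertices, at most 1 in absolute value.\<close>
    have "mean_dist b p - mean_dist b q = (p g - q g) * (d b g - d b ?v)"
      unfolding mp mq p q by algebra
    then have "\<bar>mean_dist b p - mean_dist b q\<bar> = \<bar>p g - q g\<bar> * \<bar>d b g - d b ?v\<bar>"
      by (simp add: abs_mult)
    also have "\<dots> \<le> \<bar>p g - q g\<bar> * 1"
      using d_step[OF assms(1) g(1) 2(2)] by (intro mult_left_mono) auto
    also have "\<dots> = \<bar>p u - q u\<bar>"
      using assms(5) 2 p q by auto
    finally show ?thesis .
  qed
qed

lemma mean_dist_path:
  "\<lbrakk>cayley_path G S p q l; b \<in> carrier G\<rbrakk> \<Longrightarrow> mean_dist b q - mean_dist b p \<le> l"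
proof (induction rule: cayley_path.induct)
  case (step p q l c r u)
  then show ?case using mean_dist_lipschitz[OF _ step.hyps(2-5), of b] by force
qed simp

lemma mean_dist_vertex: "mean_dist b (vtx g) = d b g"
proof -
  have "{x. vtx g x \<noteq> 0} = {g}" by (auto simp: cayley_vertex_def)
  then show ?thesis by (simp add: mean_dist_def cayley_vertex_def)
qed

text \<open>A word for \<open>inv g \<otimes> h\<close> is traced by an edge path, which bounds the
  left side from above. Along an arbitrary path \<open>mean_dist g\<close> grows no faster than the
  length, and at vertices it equals \<open>d g\<close>, which bounds it from below.\<close>

lemma D_vertex:
  assumes g: "g \<in> carrier G" and h: "h \<in> carrier G"
  shows "D (vtx g) (vtx h) = d g h"
proof (rule antisym)
  have c: "inv g \<otimes> h \<in> carrier G" using g h by simp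
  then have "inv g \<otimes> h \<in> ball (len (inv g \<otimes> h))" using len_le_iff by blast
  then obtain l where "l \<le> d g h" "cayley_path G S (vtx g) (vtx h) l"
    using vertex_path[OF g, of "inv g \<otimes> h"] g h inv_mult_cancel(2)[OF g h] unfolding wdist_def by metis
  then show "D (vtx g) (vtx h) \<le> d g h"
    using D_upper by fastforce
  show "d g h \<le> D (vtx g) (vtx h)"
    using mean_dist_path[OF _ g] g h by (intro D_lower) (force simp: vertex_point mean_dist_vertex)+
qed

lemma act_vertex:
  assumes "g \<in> carrier G" "h \<in> carrier G"
  shows "cayley_act G S g (vtx h) = vtx (g \<otimes> h)"
proof -
  have "(inv g \<otimes> x = h) = (x = g \<otimes> h)" if "x \<in> carrier G" for x
    using assms that by force
  then show ?thesis
    using assms vertex_point by (auto simp: cayley_act_def cayley_vertex_def fun_eq_iff)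
qed

section \<open>Word geodesics as geodesic segments of the Cayley graph, and projections rounded to
  vertices\<close>

definition edge_point :: "'a \<Rightarrow> 'a \<Rightarrow> real \<Rightarrow> 'a \<Rightarrow> real" where
  "edge_point u v a = (\<lambda>x. (1 - a) * vtx u x + a * vtx v x)"

lemma edge_point_cell:
  assumes "{u, v} \<in> cayley_cells G S" "0 \<le> a" "a \<le> 1"
  shows "edge_point u v a \<in> cell_points {u, v}"
  using assms(2,3) by (cases "u = v") (auto simp: cell_points_def edge_point_def cayley_vertex_def)

lemma D_edge:
  assumes "{u, v} \<in> cayley_cells G S" "0 \<le> a" "a \<le> 1" "0 \<le> b" "b \<le> 1"
  shows "D (edge_point u v a) (edge_point u v b) \<le> \<bar>a - b\<bar>"
proof -
  have "D (edge_point u v a) (edge_point u v b) \<le> \<bar>edge_point u v a u - edge_point u v b u\<bar>"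
    using assms by (intro D_upper cell_path[of "{u, v}"] edge_point_cell) auto
  also have "\<dots> \<le> \<bar>a - b\<bar>"
    by (auto simp: edge_point_def cayley_vertex_def)
  finally show ?thesis .
qed

lemma edge_point_ends [simp]: "edge_point u v 0 = vtx u" "edge_point u v 1 = vtx v"
  by (auto simp: edge_point_def)

definition realize :: "(nat \<Rightarrow> 'a) \<Rightarrow> real \<Rightarrow> 'a \<Rightarrow> real" where
  "realize w t = edge_point (w (nat \<lfloor>t\<rfloor>)) (w (Suc (nat \<lfloor>t\<rfloor>))) (frac t)"

context
  fixes x y n w assumes w: "word_geodesic x y n w"
begin

lemma geodesic_closed: "w i \<in> carrier G"
  using w by (auto simp: word_geodesic_def)

lemma geodesic_dist: "\<lbrakk>i \<le> n; j \<le> n\<rbrakk> \<Longrightarrow> d (w i) (w j) = \<bar>real i - real j\<bar>"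
  using w by (auto simp: word_geodesic_def)

lemma geodesic_ends: "w 0 = x" "w n = y"
  using w by (auto simp: word_geodesic_def)

lemma geodesic_cell: "{w i, w (Suc i)} \<in> cayley_cells G S"
proof -
  obtain s where "s \<in> S \<union> {\<one>}" "w (Suc i) = w i \<otimes> s"
    using w unfolding word_geodesic_def by blast
  then show ?thesis using edge_cell geodesic_closed by metis
qed

lemma realize_point: "realize w t \<in> X"
  unfolding cayley_points_def realize_def
  by (rule UN_I[OF geodesic_cell]) (auto intro!: edge_point_cell geodesic_cell simp: frac_lt_1 less_imp_le)

lemma realize_nat [simp]: "realize w (real i) = vtx (w i)"
  by (simp add: realize_def frac_def)

lemma realize_floor: "0 \<le> t \<Longrightarrow> D (realize w t) (vtx (w (nat \<lfloor>t\<rfloor>))) \<le> frac t"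
  using D_edge[OF geodesic_cell, of "frac t" 0 "nat \<lfloor>t\<rfloor>"]
  by (simp add: realize_def frac_lt_1 less_imp_le)

lemma realize_ceil:
  "0 \<le> t \<Longrightarrow> D (realize w t) (vtx (w (Suc (nat \<lfloor>t\<rfloor>)))) \<le> 1 - frac t"
  using D_edge[OF geodesic_cell, of "frac t" 1 "nat \<lfloor>t\<rfloor>"]
  by (simp add: realize_def frac_lt_1 less_imp_le)

lemma realize_upper:
  assumes "0 \<le> s" "s \<le> t" "t \<le> real n"
  shows "D (realize w s) (realize w t) \<le> t - s"
proof (cases "\<lfloor>s\<rfloor> = \<lfloor>t\<rfloor>")
  case True
  then show ?thesis
    using D_edge[OF geodesic_cell, of "frac s" "frac t" "nat \<lfloor>s\<rfloor>"] assms
    by (simp add: realize_def frac_lt_1 less_imp_le) (simp add: frac_def)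
next
  case False
  define k where "k = nat \<lfloor>s\<rfloor>"
  define l where "l = nat \<lfloor>t\<rfloor>"
  have kl: "k < l" "real_of_int \<lfloor>s\<rfloor> = k" "real_of_int \<lfloor>t\<rfloor> = l" "l \<le> n"
  proof -
    have "0 \<le> \<lfloor>s\<rfloor>" "\<lfloor>s\<rfloor> < \<lfloor>t\<rfloor>" "\<lfloor>t\<rfloor> \<le> int n"
      using False assms floor_mono[of s t] floor_mono[OF assms(3)] by auto
    moreover from this have "1 \<le> t" by linarith
    ultimately show "k < l" "real_of_int \<lfloor>s\<rfloor> = k" "real_of_int \<lfloor>t\<rfloor> = l" "l \<le> n"
      unfolding k_def l_def by (simp_all add: nat_le_iff)
  qed
  have "D (realize w s) (realize w t) \<le> D (realize w s) (vtx (w (Suc k)))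
      + (D (vtx (w (Suc k))) (vtx (w l)) + D (vtx (w l)) (realize w t))"
    using D_triangle[of "realize w s" "vtx (w (Suc k))" "realize w t"]
      D_triangle[of "vtx (w (Suc k))" "vtx (w l)" "realize w t"]
      realize_point vertex_point geodesic_closed by force
  also have "D (vtx (w (Suc k))) (vtx (w l)) = real l - real k - 1"
    using kl by (simp add: D_vertex geodesic_closed geodesic_dist)
  also have "D (vtx (w l)) (realize w t) \<le> frac t"
    using realize_floor[of t] assms D_commute realize_point vertex_point geodesic_closed by (simp add: l_def)
  also have "D (realize w s) (vtx (w (Suc k))) \<le> 1 - frac s"
    using realize_ceil[of s] assms by (simp add: k_def)
  finally show ?thesis using kl by (simp add: frac_def)
qed

text \<open>The stretches before \<open>s\<close>, between \<open>s\<close> and \<open>t\<close>,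
  and after \<open>t\<close> are at most as long as their parameter intervals by
  \<open>realize_upper\<close>, and together they have to cover the distance \<open>n\<close>; so
  none of them is shorter.\<close>

lemma realize_dist:
  assumes "0 \<le> s" "s \<le> t" "t \<le> real n"
  shows "D (realize w s) (realize w t) = t - s"
proof (rule antisym[OF realize_upper[OF assms]])
  have "real n = D (realize w (real 0)) (realize w (real n))"
    unfolding realize_nat by (simp add: D_vertex geodesic_closed geodesic_dist)
  also have "\<dots> \<le> D (realize w (real 0)) (realize w s)
      + (D (realize w s) (realize w t) + D (realize w t) (realize w (real n)))"
    using D_triangle[OF realize_point realize_point realize_point, of "real 0" "real n" s]
      D_triangle[OF realize_point realize_point realize_point, of s "real n" t] by linarith
  also have "D (realize w (real 0)) (realize w s) \<le> s - real 0"
    using assms by (intro realize_upper) auto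
  also have "D (realize w t) (realize w (real n)) \<le> real n - t"
    using assms by (intro realize_upper) auto
  finally show "t - s \<le> D (realize w s) (realize w t)" by simp
qed

lemma realize_geodesic_segment:
  "geodesic_segment X D (vtx x) (vtx y) (realize w ` {0..real n})"
proof -
  have "D (realize w s) (realize w t) = \<bar>s - t\<bar>" if "s \<in> {0..real n}" "t \<in> {0..real n}" for s t
    using realize_dist[of s t] realize_dist[of t s] that D_commute[OF realize_point realize_point]
    by (cases "s \<le> t") auto
  moreover have "realize w 0 = vtx x" "realize w (real n) = vtx y"
    using realize_nat[of 0] geodesic_ends by auto
  ultimately show ?thesis
    unfolding geodesic_segment_def using realize_point
    by (intro exI[of _ "real n"] exI[of _ "realize w"]) auto
qed

end

text \<open>Three roundings of at most 1 each account for \<open>C + 3\<close>: from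
  \<open>\<pi>\<close> to the preceding vertex of \<open>w\<close>, from the infimum in
  \<open>dist_to_set\<close> to a point of the segment that nearly attains it, and from this point
  to the preceding vertex of \<open>v\<close>.\<close>

lemma vertex_projection:
  assumes w: "word_geodesic x y n w"
    and \<pi>: "strongly_contracting_projection X D C (realize w ` {0..real n}) \<pi>"
  obtains \<rho> where
    "\<And>a. a \<in> carrier G \<Longrightarrow> \<rho> a \<in> w ` {..n}"
    "\<And>a. a \<in> w ` {..n} \<Longrightarrow> d a (\<rho> a) \<le> C + 3"
    "\<And>a b m v. \<lbrakk>a \<in> carrier G; b \<in> carrier G; d (\<rho> a) (\<rho> b) > C + 3; word_geodesic a b m v\<rbrakk> \<Longrightarrow>
        \<exists>i\<le>m. \<exists>j\<le>m. d (v i) (\<rho> a) \<le> C + 3 \<and> d (v j) (\<rho> b) \<le> C + 3"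
proof -
  have "\<exists>t\<in>{0..real n}. \<pi> (vtx a) = realize w t" if "a \<in> carrier G" for a
    using \<pi> that vertex_point unfolding strongly_contracting_projection_def by blast
  then obtain \<tau> where \<tau>: "\<And>a. a \<in> carrier G \<Longrightarrow>
      \<tau> a \<in> {0..real n} \<and> \<pi> (vtx a) = realize w (\<tau> a)"
    by metis
  define \<rho> where "\<rho> a = w (nat \<lfloor>\<tau> a\<rfloor>)" for a
  have \<rho>w: "\<rho> a \<in> w ` {..n}" if "a \<in> carrier G" for a
  proof -
    have "nat \<lfloor>\<tau> a\<rfloor> \<le> n" using \<tau>[OF that] by (simp add: nat_le_iff) linarith
    then show ?thesis by (simp add: \<rho>_def)
  qed
  have \<rho>c: "\<rho> a \<in> carrier G" for a
    by (simp add: \<rho>_def geodesic_closed[OF w])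
  have near: "D (\<pi> (vtx a)) (vtx (\<rho> a)) \<le> 1" if "a \<in> carrier G" for a
    using realize_floor[OF w, of "\<tau> a"] \<tau>[OF that] frac_lt_1[of "\<tau> a"] by (simp add: \<rho>_def)
  have \<pi>X: "\<pi> (vtx a) \<in> X" if "a \<in> carrier G" for a
    using \<tau>[OF that] realize_point[OF w] by simp
  have w_in: "vtx a \<in> realize w ` {0..real n}" if "a \<in> w ` {..n}" for a
  proof -
    obtain i where "i \<le> n" "a = w i" using \<open>a \<in> w ` {..n}\<close> by auto
    then show ?thesis
      using realize_nat[OF w, of i] by (intro image_eqI[of _ _ "real i"]) auto
  qed
  have 1: "d a (\<rho> a) \<le> C + 3" if "a \<in> w ` {..n}" for a
  proof -
    have a: "a \<in> carrier G" using that geodesic_closed[OF w] by auto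
    have "D (vtx a) (\<pi> (vtx a)) \<le> C"
      using \<pi> w_in[OF that] by (auto simp: strongly_contracting_projection_def)
    then have "D (vtx a) (vtx (\<rho> a)) \<le> C + 1"
      using near[OF a] D_triangle[of "vtx a" "\<pi> (vtx a)" "vtx (\<rho> a)"]
        \<pi>X[OF a] vertex_point a \<rho>c by fastforce
    then show ?thesis using a \<rho>c by (simp add: D_vertex)
  qed
  have 2: "\<exists>i\<le>m. d (v i) (\<rho> a) \<le> C + 3"
    if v: "word_geodesic b c m v" and a: "a \<in> carrier G"
      and dist: "dist_to_set D (\<pi> (vtx a)) (realize v ` {0..real m}) \<le> C" for a b c m v
  proof -
    have "realize v ` {0..real m} \<noteq> {}" by simp
    moreover have "bdd_below (D (\<pi> (vtx a)) ` (realize v ` {0..real m}))"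
      using D_nonneg by (intro bdd_belowI[of _ 0]) auto
    ultimately obtain t where t: "t \<in> {0..real m}" "D (\<pi> (vtx a)) (realize v t) < C + 1"
      using dist cINF_less_iff[of "realize v ` {0..real m}" "D (\<pi> (vtx a))" "C + 1"]
      unfolding dist_to_set_def by auto
    define i where "i = nat \<lfloor>t\<rfloor>"
    have "i \<le> m" using t by (simp add: i_def nat_le_iff) linarith
    have "D (realize v t) (vtx (v i)) \<le> 1"
      using realize_floor[OF v, of t] t frac_lt_1[of t] by (simp add: i_def)
    then have "D (\<pi> (vtx a)) (vtx (v i)) \<le> C + 2"
      using t(2) D_triangle[OF \<pi>X[OF a] realize_point[OF v] vertex_point[OF geodesic_closed[OF v, of i]], of t]
      by linarith
    then have "D (vtx (v i)) (vtx (\<rho> a)) \<le> C + 3"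
      using near[OF a] D_triangle[of "vtx (v i)" "\<pi> (vtx a)" "vtx (\<rho> a)"]
        D_commute[of "vtx (v i)" "\<pi> (vtx a)"]
        \<pi>X[OF a] vertex_point geodesic_closed[OF v] \<rho>c by fastforce
    then have "d (v i) (\<rho> a) \<le> C + 3" using D_vertex geodesic_closed[OF v] \<rho>c by simp
    then show ?thesis using \<open>i \<le> m\<close> by blast
  qed
  have 3: "\<exists>i\<le>m. \<exists>j\<le>m. d (v i) (\<rho> a) \<le> C + 3 \<and> d (v j) (\<rho> b) \<le> C + 3"
    if a: "a \<in> carrier G" and b: "b \<in> carrier G" and far: "d (\<rho> a) (\<rho> b) > C + 3"
      and v: "word_geodesic a b m v" for a b m v
  proof -
    have "D (vtx (\<rho> a)) (vtx (\<rho> b)) \<le> D (vtx (\<rho> a)) (\<pi> (vtx a))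
      + (D (\<pi> (vtx a)) (\<pi> (vtx b)) + D (\<pi> (vtx b)) (vtx (\<rho> b)))"
      using D_triangle[of "vtx (\<rho> a)" "\<pi> (vtx a)" "vtx (\<rho> b)"]
        D_triangle[of "\<pi> (vtx a)" "\<pi> (vtx b)" "vtx (\<rho> b)"]
        \<pi>X a b vertex_point \<rho>c by fastforce
    then have "D (\<pi> (vtx a)) (\<pi> (vtx b)) > C"
      using far near[OF a] near[OF b] D_commute[OF \<pi>X[OF a] vertex_point[OF \<rho>c]] D_vertex[OF \<rho>c \<rho>c]
      by simp
    then have "dist_to_set D (\<pi> (vtx a)) (realize v ` {0..real m}) \<le> C
        \<and> dist_to_set D (\<pi> (vtx b)) (realize v ` {0..real m}) \<le> C"
      using \<pi> a b vertex_point realize_geodesic_segment[OF v]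
      unfolding strongly_contracting_projection_def by blast
    then show ?thesis using 2[OF v a] 2[OF v b] by blast
  qed
  show ?thesis using that \<rho>w 1 3 by blast
qed

end

section \<open>Contracting axes\<close>

context marked_group
begin

text \<open>A metric form of strong contraction: instead of requiring geodesics to pass close to the
  projections of their endpoints, the broken path through the projections is almost geodesic.\<close>
definition contracting_map :: "real \<Rightarrow> 'a set \<Rightarrow> ('a \<Rightarrow> 'a) \<Rightarrow> bool" where
  "contracting_map C V \<rho> \<longleftrightarrow> V \<subseteq> carrier G \<and> (\<forall>x\<in>carrier G. \<rho> x \<in> V) \<and> (\<forall>a\<in>V. d a (\<rho> a) \<le> C) \<and>
     (\<forall>x\<in>carrier G. \<forall>p\<in>V. d x (\<rho> x) \<le> d x p + C) \<and>
     (\<forall>x\<in>carrier G. \<forall>y\<in>carrier G.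
        d (\<rho> x) (\<rho> y) > C \<longrightarrow> d x (\<rho> x) + d (\<rho> x) (\<rho> y) + d (\<rho> y) y \<le> d x y + C)"

text \<open>A geodesic that passes within \<open>C\<close> of both projections, in the right order,
  exceeds the broken path through them by no less than \<open>- 4 * C\<close>. The remaining part of
  \<open>8 * C\<close> is room for excluding the wrong order.\<close>

lemma contracting_mapI:
  assumes V: "V \<subseteq> carrier G" and C: "C \<ge> 0"
    and \<rho>: "\<And>a. a \<in> carrier G \<Longrightarrow> \<rho> a \<in> V" "\<And>a. a \<in> V \<Longrightarrow> d a (\<rho> a) \<le> C"
    and far: "\<And>a b m v. \<lbrakk>a \<in> carrier G; b \<in> carrier G; d (\<rho> a) (\<rho> b) > C; word_geodesic a b m v\<rbrakk> \<Longrightarrow>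
        \<exists>i\<le>m. \<exists>j\<le>m. d (v i) (\<rho> a) \<le> C \<and> d (v j) (\<rho> b) \<le> C"
  shows "contracting_map (8 * C) V \<rho>"
proof -
  have \<rho>c: "\<rho> a \<in> carrier G" if "a \<in> carrier G" for a using \<rho>(1)[OF that] V by blast
  \<comment> \<open>Either the geodesic from \<open>x\<close> to \<open>p\<close> passes within
    \<open>C\<close> of \<open>\<rho> x\<close>, or \<open>\<rho> x\<close> is within
    \<open>C\<close> of \<open>\<rho> p\<close>, which is within \<open>C\<close> of
    \<open>p\<close> itself.\<close>
  have near: "d x (\<rho> x) \<le> d x p + 2 * C" if x: "x \<in> carrier G" and p: "p \<in> V" for x p
  proof (cases "d (\<rho> x) (\<rho> p) > C")
    case True
    have pc: "p \<in> carrier G" using p V by blast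
    obtain m v where v: "word_geodesic x p m v" "real m = d x p"
      using word_geodesic_exists[OF x pc] by blast
    then obtain i where i: "i \<le> m" "d (v i) (\<rho> x) \<le> C"
      using far[OF x pc True] by blast
    have "d x (v i) \<le> m"
      using geodesic_dist[OF v(1), of 0 i] geodesic_ends[OF v(1)] i by auto
    then show ?thesis
      using i v(2) C d_triangle[of x "v i" "\<rho> x"] x \<rho>c geodesic_closed[OF v(1)] by fastforce
  next
    case False
    have pc: "p \<in> carrier G" using p V by blast
    then show ?thesis
      using False \<rho>(2)[OF p] x \<rho>c d_triangle[of x p "\<rho> x"] d_triangle[of p "\<rho> p" "\<rho> x"]
        d_commute[of "\<rho> p" "\<rho> x"] by fastforce
  qed
  have "d x (\<rho> x) + d (\<rho> x) (\<rho> y) + d (\<rho> y) y \<le> d x y + 8 * C"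
    if x: "x \<in> carrier G" and y: "y \<in> carrier G" and xy: "d (\<rho> x) (\<rho> y) > 8 * C" for x y
  proof -
    obtain m v where v: "word_geodesic x y m v" "real m = d x y"
      using word_geodesic_exists[OF x y] by blast
    obtain i j where ij: "i \<le> m" "j \<le> m" "d (v i) (\<rho> x) \<le> C" "d (v j) (\<rho> y) \<le> C"
      using far[OF x y _ v(1)] xy C by auto
    have vc: "v k \<in> carrier G" for k using geodesic_closed[OF v(1)] .
    note D = geodesic_dist[OF v(1)] geodesic_ends[OF v(1)]
    have di: "d x (v i) = i" "d (v j) y = real m - j" "d x (v j) = j"
      using D(1)[of 0 i] D(1)[of j m] D(1)[of 0 j] D(2,3) ij by auto
    have eqs: "d (v j) (\<rho> y) = d (\<rho> y) (v j)" "d (v i) (v j) = \<bar>real i - real j\<bar>"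
      using d_commute vc \<rho>c y D(1) ij by auto
    have t: "d x (\<rho> x) \<le> d x (v i) + d (v i) (\<rho> x)" "d (\<rho> y) y \<le> d (\<rho> y) (v j) + d (v j) y"
      "d (\<rho> x) (\<rho> y) \<le> d (\<rho> x) (v i) + (d (v i) (v j) + d (v j) (\<rho> y))"
      "d (\<rho> x) (v i) = d (v i) (\<rho> x)" "d x (v i) \<le> d x (\<rho> x) + d (\<rho> x) (v i)"
      "d x (\<rho> y) \<le> d x (v j) + d (v j) (\<rho> y)"
      using d_triangle[of x "v i" "\<rho> x"] d_triangle[of "\<rho> y" "v j" y] d_commute
        d_triangle[of "\<rho> x" "v i" "\<rho> y"] d_triangle[of "v i" "v j" "\<rho> y"]
        d_triangle[of x "\<rho> x" "v i"] d_triangle[of x "v j" "\<rho> y"]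
        x y vc \<rho>c by force+
    \<comment> \<open>If the geodesic met the neighbourhood of \<open>\<rho> y\<close> first, this
      inequality would give \<open>i - j \<le> 4 * C\<close>, so the projections would be at most
      \<open>6 * C\<close> apart.\<close>
    have "d x (\<rho> x) \<le> d x (\<rho> y) + 2 * C" using near x \<rho>(1)[OF y] by blast
    then have "real i \<le> j"
      using t di eqs ij xy by linarith
    then show ?thesis using t di eqs ij v(2) C by linarith
  qed
  moreover have "d a (\<rho> a) \<le> 8 * C" if "a \<in> V" for a using \<rho>(2)[OF that] C by linarith
  moreover have "d x (\<rho> x) \<le> d x p + 8 * C" if "x \<in> carrier G" "p \<in> V" for x p
    using near[OF that] C by linarith
  ultimately show ?thesis
    using V \<rho>(1) unfolding contracting_map_def by auto
qed

lemma contracting_map_near: "\<lbrakk>contracting_map C V \<rho>; a \<in> V\<rbrakk> \<Longrightarrow> d a (\<rho> a) \<le> C"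
  unfolding contracting_map_def by blast

lemma contracting_map_lipschitz:
  "\<lbrakk>contracting_map C V \<rho>; x \<in> carrier G; y \<in> carrier G\<rbrakk> \<Longrightarrow> d (\<rho> x) (\<rho> y) \<le> d x y + C"
proof (cases "d (\<rho> x) (\<rho> y) > C")
  case True
  assume "contracting_map C V \<rho>" "x \<in> carrier G" "y \<in> carrier G"
  then have "d x (\<rho> x) + d (\<rho> x) (\<rho> y) + d (\<rho> y) y \<le> d x y + C"
    using True unfolding contracting_map_def by blast
  then show ?thesis using d_nonneg[of x "\<rho> x"] d_nonneg[of "\<rho> y" y] by linarith
next
  case False
  then show ?thesis using d_nonneg[of x y] by linarith
qed

text \<open>A larger jump of the projection would force the way from \<open>x\<close> to
  \<open>y\<close> to pass by \<open>\<rho> x\<close>, which is too far from \<open>x\<close>. So a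
  path that stays far from \<open>V\<close> moves its projection by at most \<open>C\<close> on
  every long stretch.\<close>

lemma contracting_map_close:
  assumes "contracting_map C V \<rho>" "x \<in> carrier G" "y \<in> carrier G" "d x y + C < d x (\<rho> x)"
  shows "d (\<rho> x) (\<rho> y) \<le> C"
proof (rule ccontr)
  assume "\<not> d (\<rho> x) (\<rho> y) \<le> C"
  then have "d x (\<rho> x) + d (\<rho> x) (\<rho> y) + d (\<rho> y) y \<le> d x y + C"
    using assms unfolding contracting_map_def by auto
  then show False using assms(4) d_nonneg[of "\<rho> x" "\<rho> y"] d_nonneg[of "\<rho> y" y] by linarith
qed

text \<open>A stride of \<open>s\<close> indices costs \<open>C\<close> in total instead of a
  Lipschitz constant per index. The resulting speed \<open>C / s\<close> can be made as small as
  desired.\<close>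

lemma coarse_steps:
  fixes f :: "int \<Rightarrow> 'a"
  assumes f: "\<And>i. f i \<in> carrier G" and s: "s > 0" and C: "C \<ge> 0"
    and step: "\<And>i j. \<lbrakk>a \<le> i; i \<le> j; j \<le> b; j - i \<le> s\<rbrakk> \<Longrightarrow> d (f i) (f j) \<le> C"
    and ab: "a \<le> b"
  shows "d (f a) (f b) \<le> C * (real_of_int (b - a) / real_of_int s + 1)"
proof -
  have "a + int k * s \<le> b \<Longrightarrow> d (f a) (f (a + int k * s)) \<le> C * real k" for k
  proof (induction k)
    case (Suc k)
    have "a + int k * s \<le> b" using Suc.prems s by (simp add: algebra_simps)
    moreover have "d (f (a + int k * s)) (f (a + int (Suc k) * s)) \<le> C"
      using Suc.prems s by (intro step) (auto simp: algebra_simps)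
    ultimately show ?case
      using Suc.IH d_triangle[of "f a" "f (a + int k * s)" "f (a + int (Suc k) * s)"] f
      by (auto simp: algebra_simps)
  qed (simp add: f)
  then have walk: "d (f a) (f (a + int k * s)) \<le> C * real k" if "a + int k * s \<le> b" for k
    using that by blast
  define k where "k = nat ((b - a) div s)"
  have k: "int k = (b - a) div s" using ab s by (simp add: k_def pos_imp_zdiv_nonneg_iff)
  have m: "(b - a) div s * s = b - a - (b - a) mod s" by (simp add: minus_mod_eq_div_mult)
  have mb: "0 \<le> (b - a) mod s" "(b - a) mod s < s" using s by auto
  have 1: "d (f a) (f (a + int k * s)) \<le> C * real k"
    using mb by (intro walk) (simp add: k m)
  have 2: "d (f (a + int k * s)) (f b) \<le> C"
  proof (rule step)
    have "0 \<le> int k * s" using s by simp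
    then show "a \<le> a + int k * s" by simp
  qed (use mb m in \<open>auto simp: k\<close>)
  have "int k * s \<le> b - a" using k m mb by simp
  then have "real k * s \<le> real_of_int (b - a)" by (metis of_int_le_iff of_int_mult of_int_of_nat_eq)
  then have "real k \<le> real_of_int (b - a) / real_of_int s"
    using s by (simp add: field_simps)
  then have "C * real k \<le> C * (real_of_int (b - a) / real_of_int s)"
    using C by (intro mult_left_mono)
  then show ?thesis
    using 1 2 d_triangle[of "f a" "f (a + int k * s)" "f b"] f by (auto simp: algebra_simps)
qed

section \<open>From contracting segments to a contracting orbit of a cyclic group\<close>

definition nearest :: "'a set \<Rightarrow> 'a \<Rightarrow> 'a \<Rightarrow> bool" where
  "nearest A x p \<longleftrightarrow> p \<in> A \<and> (\<forall>q\<in>A. d x p \<le> d x q)"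

lemma nearest_exists:
  assumes "A \<noteq> {}" shows "\<exists>p. nearest A x p"
proof -
  obtain a where "a \<in> A" using assms by blast
  then obtain p where "p \<in> A" "\<forall>q. q \<in> A \<longrightarrow> len (inv x \<otimes> p) \<le> len (inv x \<otimes> q)"
    using ex_has_least_nat[of "\<lambda>p. p \<in> A" a "\<lambda>p. len (inv x \<otimes> p)"] by blast
  then show ?thesis by (auto simp: nearest_def wdist_def)
qed

definition powers :: "'a \<Rightarrow> 'a set" where
  "powers h = range (\<lambda>i::int. h [^] i)"

lemma generate_powers: "h \<in> carrier G \<Longrightarrow> generate G {h} = powers h"
  by (auto simp: generate_pow powers_def)

context
  fixes h K e C
  assumes h: "h \<in> carrier G" and K: "K \<ge> 1" and e: "e \<ge> 0" and C: "C \<ge> 0"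
    and lower: "\<And>i j :: int. \<bar>real_of_int (i - j)\<bar> / K - e \<le> d (h [^] i) (h [^] j)"
    and upper: "\<And>i j :: int. d (h [^] i) (h [^] j) \<le> K * \<bar>real_of_int (i - j)\<bar> + e"
    and contr: "\<And>i j n w. word_geodesic (h [^] (i::int)) (h [^] (j::int)) n w \<Longrightarrow>
                  \<exists>\<rho>. contracting_map C (w ` {..n}) \<rho>"
begin

text \<open>While the quasi-geodesic \<open>i \<mapsto> h\<^sup>i\<close> stays far from a contracting geodesic, its projection moves too
  slowly to keep up with the distance it covers, so such excursions are short.\<close>
lemma quasi_geodesic_near:
  obtains D where "D \<ge> 0" "\<And>i j n w \<rho> l. \<lbrakk>word_geodesic (h [^] (i::int)) (h [^] j) n w;
      contracting_map C (w ` {..n}) \<rho>; i \<le> l; l \<le> j\<rbrakk> \<Longrightarrow> d (h [^] l) (\<rho> (h [^] l)) \<le> D"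
proof -
  \<comment> \<open>By the choice of \<open>s\<close>, \<open>C / s \<le> 1 / (2 * K)\<close>: away
    from the geodesic the projection moves at most half as fast as the powers of \<open>h\<close>
    themselves. A point farther than \<open>R\<close> away satisfies the hypothesis of
    \<open>contracting_map_close\<close> for \<open>s\<close> steps. \<open>Q\<close> collects what
    does not grow with the excursion, \<open>2 * K * Q\<close> bounds its number of steps, and
    \<open>Z + e\<close> bounds the displacement.\<close>
  define s where "s = \<lceil>2 * K * C\<rceil> + 1"
  define R where "R = K * s + e + C"
  define Q where "Q = 2 * R + 2 * (K + e + C) + C + e"
  define Z where "Z = K * (2 * K * Q)"
  define D where "D = 2 * (Z + e) + R + C"
  have "0 \<le> 2 * K * C" using K C by simp
  then have s: "s > 0" "real_of_int s \<ge> 2 * K * C"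
    unfolding s_def by linarith+
  have R: "R \<ge> C" "R \<ge> 0" using K s e C by (simp_all add: R_def)
  have Q: "Q \<ge> 0" using R K e C by (simp add: Q_def)
  have KQ: "Z \<ge> 0" using K Q by (simp add: Z_def)
  have D: "D \<ge> R" "D \<ge> 0" using KQ e R C by (auto simp: D_def)
  have "d (h [^] l) (\<rho> (h [^] l)) \<le> D"
    if w: "word_geodesic (h [^] i) (h [^] j) n w" and \<rho>: "contracting_map C (w ` {..n}) \<rho>"
      and il: "i \<le> l" and lj: "l \<le> j" for i j l :: int and n w \<rho>
  proof (cases "d (h [^] l) (\<rho> (h [^] l)) \<le> R")
    case True
    then show ?thesis using D by linarith
  next
    case False
    let ?f = "\<lambda>i::int. h [^] i"
    let ?g = "\<lambda>i::int. \<rho> (h [^] i)"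
    let ?near = "\<lambda>c. d (?f c) (?g c) \<le> R"
    have fc: "?f c \<in> carrier G" for c using h by simp
    have gc: "?g c \<in> carrier G" for c
      using \<rho> fc[of c] geodesic_closed[OF w] unfolding contracting_map_def by (metis subsetD)
    have ends: "?f i \<in> w ` {..n}" "?f j \<in> w ` {..n}"
      using geodesic_ends[OF w] by (force intro: image_eqI)+
    then have ne: "?near i" "?near j"
      using contracting_map_near[OF \<rho>] R by force+
    \<comment> \<open>The excursion around \<open>l\<close> is the set of indices strictly between
      \<open>a\<close> and \<open>b\<close>.\<close>
    define a where "a = Max {c \<in> {i..l}. ?near c}"
    define b where "b = Min {c \<in> {l..j}. ?near c}"
    have fin: "finite {c \<in> {i..l}. ?near c}" "finite {c \<in> {l..j}. ?near c}"
      by (rule finite_subset[of _ "{i..l}"], auto) (rule finite_subset[of _ "{l..j}"], auto)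
    have "a \<in> {c \<in> {i..l}. ?near c}" unfolding a_def using fin ne il by (intro Max_in) auto
    then have a: "i \<le> a" "a \<le> l" "?near a" by auto
    have "b \<in> {c \<in> {l..j}. ?near c}" unfolding b_def using fin ne lj by (intro Min_in) auto
    then have b: "l \<le> b" "b \<le> j" "?near b" by auto
    have al: "a < l" and lb: "l < b" using a b False by (auto simp: order.order_iff_strict)
    have far: "\<not> ?near c" if "a < c" "c < b" for c
    proof
      assume nc: "?near c"
      show False
      proof (cases "c \<le> l")
        case True
        then have "c \<le> a" unfolding a_def using fin nc a that by (intro Max_ge) auto
        then show False using that by simp
      next
        case False
        then have "b \<le> c" unfolding b_def using fin nc b that by (intro Min_le) auto
        then show False using that by simp
      qed
    qed
    have lip: "d (?g c) (?g c') \<le> K * \<bar>real_of_int (c - c')\<bar> + e + C" for c c'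
      using contracting_map_lipschitz[OF \<rho> fc fc, of c c'] upper[of c c'] by linarith
    have "d (?g (a + 1)) (?g (b - 1)) \<le> C * (real_of_int ((b - 1) - (a + 1)) / real_of_int s + 1)"
    proof (rule coarse_steps[OF gc s(1) C])
      fix c c' assume c: "a + 1 \<le> c" "c \<le> c'" "c' \<le> b - 1" "c' - c \<le> s"
      have "d (?f c) (?f c') \<le> K * s + e"
      proof -
        have "real_of_int (c' - c) \<le> s" using c(4) by linarith
        then have "K * \<bar>real_of_int (c - c')\<bar> \<le> K * s"
          using c(2) K by (intro mult_left_mono) auto
        then show ?thesis using upper[of c c'] by linarith
      qed
      then show "d (?g c) (?g c') \<le> C"
        using far[of c] c by (intro contracting_map_close[OF \<rho> fc fc]) (auto simp: R_def)
    qed (use al lb in simp)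
    also have "\<dots> \<le> C + (b - a) / (2 * K)"
    proof -
      have "C * (real_of_int ((b - 1) - (a + 1)) / real_of_int s) \<le> C * (real_of_int (b - a) / real_of_int s)"
        using C s by (intro mult_left_mono divide_right_mono) auto
      also have "\<dots> = (C / s) * (b - a)" by simp
      also have "\<dots> \<le> (1 / (2 * K)) * (b - a)"
        using al lb s K by (intro mult_right_mono) (auto simp: field_simps)
      finally show ?thesis by (simp add: algebra_simps)
    qed
    finally have mid: "d (?g (a + 1)) (?g (b - 1)) \<le> C + (b - a) / (2 * K)" .
    have "d (?f a) (?f b) \<le> d (?f a) (?g a) + d (?g a) (?g (a + 1)) + d (?g (a + 1)) (?g (b - 1))
        + d (?g (b - 1)) (?g b) + d (?g b) (?f b)"
      using d_triangle[OF fc gc fc, of a b a] d_triangle[OF gc gc fc, of a b "a + 1"]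
        d_triangle[OF gc gc fc, of "a + 1" b "b - 1"] d_triangle[OF gc gc fc, of "b - 1" b b] by linarith
    moreover have "d (?g b) (?f b) \<le> R" using b(3) d_commute[OF gc fc] by simp
    ultimately have "d (?f a) (?f b) \<le> 2 * R + 2 * (K + e + C) + C + (b - a) / (2 * K)"
      using mid a(3) lip[of a "a + 1"] lip[of "b - 1" b] by simp
    moreover have "real_of_int (b - a) / K - e \<le> d (?f a) (?f b)"
      using lower[of a b] al lb by simp
    \<comment> \<open>The lower bound on the distance from \<open>h [^] a\<close> to
      \<open>h [^] b\<close> contains this term twice, the upper bound only once, so one copy
      survives and bounds the length of the excursion.\<close>
    moreover have "real_of_int (b - a) / K = 2 * ((b - a) / (2 * K))" using K by (simp add: field_simps)
    ultimately have "(b - a) / (2 * K) \<le> Q"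
      unfolding Q_def by linarith
    then have ba: "real_of_int (b - a) \<le> 2 * K * Q"
      using K by (simp add: field_simps)
    have la: "d (?f l) (?f a) \<le> Z + e"
    proof -
      have "K * \<bar>real_of_int (l - a)\<bar> \<le> Z"
        unfolding Z_def using ba al lb K by (intro mult_left_mono) auto
      then show ?thesis using upper[of l a] by linarith
    qed
    have "d (?f l) (?g l) \<le> d (?f l) (?f a) + d (?f a) (?g a) + d (?g a) (?g l)"
      using d_triangle[OF fc fc gc, of l l a] d_triangle[OF fc gc gc, of a l a] by linarith
    moreover have "d (?g a) (?g l) \<le> d (?f l) (?f a) + C"
      using contracting_map_lipschitz[OF \<rho> fc fc, of a l] d_commute[OF fc fc, of a l] by simp
    ultimately show ?thesis using la a(3) unfolding D_def by argo
  qed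
  then show ?thesis using that D by blast
qed

text \<open>A discrete intermediate value argument: the projections of \<open>h [^] i\<close>, ...,
  \<open>h [^] j\<close> start near one end of the geodesic, finish near the other and advance by at
  most \<open>K + e + C\<close>, so they leave no larger gap. Each of them is close to the power it
  comes from by \<open>quasi_geodesic_near\<close>.\<close>

lemma geodesic_near_powers:
  obtains D where "D \<ge> 0" "\<And>i j n w x. \<lbrakk>word_geodesic (h [^] (i::int)) (h [^] (j::int)) n w; i \<le> j; x \<in> w ` {..n}\<rbrakk>
      \<Longrightarrow> \<exists>l::int. d x (h [^] l) \<le> D"
proof -
  obtain D where D: "D \<ge> 0" "\<And>i j n w \<rho> l. \<lbrakk>word_geodesic (h [^] (i::int)) (h [^] j) n w;
      contracting_map C (w ` {..n}) \<rho>; i \<le> l; l \<le> j\<rbrakk> \<Longrightarrow> d (h [^] l) (\<rho> (h [^] l)) \<le> D"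
    using quasi_geodesic_near by blast
  have "\<exists>l::int. d (w t) (h [^] l) \<le> (K + e + C) + D"
    if w: "word_geodesic (h [^] i) (h [^] j) n w" and ij: "i \<le> j" and t: "t \<le> n" for i j :: int and n w t
  proof -
    obtain \<rho> where \<rho>: "contracting_map C (w ` {..n}) \<rho>" using contr[OF w] by blast
    have fc: "h [^] (c::int) \<in> carrier G" for c using h by simp
    have "\<forall>c::int. \<exists>k\<le>n. \<rho> (h [^] c) = w k"
      using \<rho> fc unfolding contracting_map_def by fast
    then obtain \<tau> where \<tau>: "\<And>c::int. \<tau> c \<le> n" "\<And>c. \<rho> (h [^] c) = w (\<tau> c)" by metis
    have ends: "h [^] i \<in> w ` {..n}" "h [^] j \<in> w ` {..n}"
      using geodesic_ends[OF w] by (force intro: image_eqI)+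
    then have "d (w 0) (w (\<tau> i)) \<le> C" "d (w n) (w (\<tau> j)) \<le> C"
      using contracting_map_near[OF \<rho>] geodesic_ends[OF w] \<tau>(2) by metis+
    then have e0: "real (\<tau> i) \<le> C" and e1: "real n - C \<le> \<tau> j"
      using geodesic_dist[OF w] \<tau>(1) by (auto simp: abs_le_iff)
    have step: "\<bar>real (\<tau> c) - real (\<tau> (c + 1))\<bar> \<le> K + e + C" for c
      using contracting_map_lipschitz[OF \<rho> fc fc, of c "c + 1"] upper[of c "c + 1"]
        geodesic_dist[OF w \<tau>(1) \<tau>(1), of c "c + 1"] \<tau>(2) by simp
    have "\<exists>c\<in>{i..j}. \<bar>real (\<tau> c) - real t\<bar> \<le> K + e + C"
    proof (cases "\<tau> i \<le> t")
      case False
      then show ?thesis using e0 K e ij by (intro bexI[of _ i]) auto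
    next
      case True
      define c where "c = Max {c \<in> {i..j}. \<tau> c \<le> t}"
      have fin: "finite {c \<in> {i..j}. \<tau> c \<le> t}" by (rule finite_subset[of _ "{i..j}"]) auto
      have "c \<in> {c \<in> {i..j}. \<tau> c \<le> t}" unfolding c_def using fin True ij by (intro Max_in) auto
      then have c: "i \<le> c" "c \<le> j" "\<tau> c \<le> t" by auto
      have "\<bar>real (\<tau> c) - real t\<bar> \<le> K + e + C"
      proof (cases "c = j")
        case True
        then show ?thesis using e1 t c K e by auto
      next
        case False
        have "\<not> \<tau> (c + 1) \<le> t"
        proof
          assume "\<tau> (c + 1) \<le> t"
          then have "c + 1 \<le> c"
            using fin c False unfolding c_def[symmetric] by (subst (2) c_def, intro Max_ge) auto
          then show False by simp
        qed
        then show ?thesis using step[of c] c by linarith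
      qed
      then show ?thesis using c(1,2) by (intro bexI[of _ c]) auto
    qed
    then obtain c where c: "c \<in> {i..j}" "\<bar>real (\<tau> c) - real t\<bar> \<le> K + e + C" by blast
    have "d (w t) (w (\<tau> c)) \<le> K + e + C" using c(2) geodesic_dist[OF w t \<tau>(1)[of c]] by simp
    moreover have "d (w (\<tau> c)) (h [^] c) \<le> D"
      using D(2)[OF w \<rho>, where l = c] c(1) \<tau>(2) d_commute[OF geodesic_closed[OF w] fc] by (simp add: d_commute)
    ultimately show ?thesis
      using d_triangle[OF geodesic_closed[OF w] geodesic_closed[OF w] fc, of t c "\<tau> c"]
      by (intro exI[of _ c]) linarith
  qed
  then have "\<exists>l::int. d x (h [^] l) \<le> (K + e + C) + D"
    if "word_geodesic (h [^] i) (h [^] j) n w" "i \<le> j" "x \<in> w ` {..n}" for i j :: int and n w x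
    using that by blast
  moreover have "(K + e + C) + D \<ge> 0" using K e C D by simp
  ultimately show ?thesis using that by blast
qed

text \<open>The geodesic between the two nearest points is contracting, with a projection
  \<open>\<rho>\<close>. If \<open>\<rho> x\<close> were far from the nearest point
  \<open>p\<close>, the way from \<open>x\<close> to \<open>p\<close> would pass by
  \<open>\<rho> x\<close>; but \<open>\<rho> x\<close> is within \<open>D\<close> of some power of
  \<open>h\<close>, which would then be nearer to \<open>x\<close> than \<open>p\<close>. So
  \<open>p\<close> may be exchanged for \<open>\<rho> x\<close>, and \<open>q\<close> for
  \<open>\<rho> y\<close>.\<close>

lemma powers_contracting:
  obtains C' where "C' \<ge> 0" "\<And>x y p q. \<lbrakk>x \<in> carrier G; y \<in> carrier G; nearest (powers h) x p;
      nearest (powers h) y q; d p q > C'\<rbrakk> \<Longrightarrow> d x p + d p q + d q y \<le> d x y + C'"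
proof -
  obtain D where D: "D \<ge> 0" "\<And>i j n w x. \<lbrakk>word_geodesic (h [^] (i::int)) (h [^] (j::int)) n w; i \<le> j; x \<in> w ` {..n}\<rbrakk>
      \<Longrightarrow> \<exists>l::int. d x (h [^] l) \<le> D"
    using geodesic_near_powers by blast
  \<comment> \<open>Both nearest points occur twice in the sum, and each exchange costs
    \<open>D + 2 * C\<close>.\<close>
  define C' where "C' = C + 4 * (D + 2 * C)"
  have pc: "p \<in> carrier G" if "nearest (powers h) x p" for x p
    using that h by (auto simp: nearest_def powers_def)
  have "d x p + d p q + d q y \<le> d x y + C'"
    if x: "x \<in> carrier G" and y: "y \<in> carrier G" and p: "nearest (powers h) x p"
      and q: "nearest (powers h) y q" and far: "d p q > C'" for x y p q
  proof -
    obtain a b :: int where ab: "p = h [^] a" "q = h [^] b"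
      using p q by (auto simp: nearest_def powers_def)
    define i where "i = min a b"
    define j where "j = max a b"
    have ij: "i \<le> j" by (simp add: i_def j_def)
    have hc: "h [^] i \<in> carrier G" "h [^] j \<in> carrier G" using h by auto
    obtain n w where w: "word_geodesic (h [^] i) (h [^] j) n w"
      using word_geodesic_exists[OF hc] by blast
    let ?V = "w ` {..n}"
    have ends: "h [^] i \<in> ?V" "h [^] j \<in> ?V"
      using geodesic_ends[OF w] by (force intro: image_eqI)+
    have pV: "p \<in> ?V" and qV: "q \<in> ?V"
      using ends ab by (auto simp: i_def j_def min_def max_def split: if_splits)
    obtain \<rho> where \<rho>: "contracting_map C ?V \<rho>" using contr[OF w] by blast
    have \<rho>V: "\<rho> z \<in> ?V" if "z \<in> carrier G" for z
      using \<rho> that unfolding contracting_map_def by blast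
    have \<rho>c: "\<rho> z \<in> carrier G" if "z \<in> carrier G" for z
      using \<rho>V[OF that] geodesic_closed[OF w] by auto
    have close: "d r (\<rho> z) \<le> D + 2 * C"
      if z: "z \<in> carrier G" and r: "nearest (powers h) z r" and rV: "r \<in> ?V" for z r
    proof -
      have rc: "r \<in> carrier G" using pc[OF r] .
      have r\<rho>: "d r (\<rho> r) \<le> C" using \<rho> rV unfolding contracting_map_def by blast
      have "d (\<rho> z) (\<rho> r) \<le> D + C"
      proof (cases "d (\<rho> z) (\<rho> r) > C")
        case True
        then have 1: "d z (\<rho> z) + d (\<rho> z) (\<rho> r) + d (\<rho> r) r \<le> d z r + C"
          using \<rho> z rc unfolding contracting_map_def by blast
        obtain l :: int where l: "d (\<rho> z) (h [^] l) \<le> D"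
          using D(2)[OF w ij \<rho>V[OF z]] by blast
        have "d z r \<le> d z (h [^] l)" using r by (auto simp: nearest_def powers_def)
        also have "\<dots> \<le> d z (\<rho> z) + D"
          using d_triangle[OF z \<rho>c[OF z], of "h [^] l"] l h by auto
        finally show ?thesis using 1 d_nonneg[of "\<rho> r" r] by linarith
      qed (use D C in linarith)
      then show ?thesis
        using r\<rho> d_triangle[OF rc \<rho>c[OF rc] \<rho>c[OF z]] d_commute[OF \<rho>c[OF rc] \<rho>c[OF z]] by linarith
    qed
    note px = close[OF x p pV] and qy = close[OF y q qV]
    note cc = x y pc[OF p] pc[OF q] \<rho>c[OF x] \<rho>c[OF y]
    have tri: "d p q \<le> d p (\<rho> x) + (d (\<rho> x) (\<rho> y) + d q (\<rho> y))"
      "d x p \<le> d x (\<rho> x) + d p (\<rho> x)" "d q y \<le> d q (\<rho> y) + d (\<rho> y) y"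
      using d_triangle[of p "\<rho> x" q] d_triangle[of "\<rho> x" "\<rho> y" q] d_triangle[of x "\<rho> x" p]
        d_triangle[of q "\<rho> y" y] d_commute[of "\<rho> y" q] d_commute[of "\<rho> x" p] cc by auto
    then have "d (\<rho> x) (\<rho> y) > C" using px qy far D(1) C unfolding C'_def by argo
    then have "d x (\<rho> x) + d (\<rho> x) (\<rho> y) + d (\<rho> y) y \<le> d x y + C"
      using \<rho> x y unfolding contracting_map_def by blast
    then show ?thesis using tri px qy unfolding C'_def by argo
  qed
  moreover have "C' \<ge> 0" using C D by (simp add: C'_def)
  ultimately show ?thesis using that by blast
qed

end

end

text \<open>Of the quasi-geodesic condition only \<open>proper\<close> is retained. Nearest points
  are not unique, and the contraction inequality is required for every choice of them.\<close>

locale contracting_axis = marked_group +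
  fixes h and C :: real
  assumes h_closed: "h \<in> carrier G"
    and C_nonneg: "C \<ge> 0"
    and contraction: "\<lbrakk>x \<in> carrier G; y \<in> carrier G; nearest (powers h) x p; nearest (powers h) y q; d p q > C\<rbrakk>
        \<Longrightarrow> d x p + d p q + d q y \<le> d x y + C"
    and proper: "finite {i::int. real (len (h [^] i)) \<le> R}"

theorem (in marked_group) contracting_axis_exists:
  assumes "cayley_has_strongly_contracting_element G S"
  obtains h C where "contracting_axis G S h C"
proof -
  let ?x = "vtx \<one>"
  obtain h C where h: "h \<in> carrier G" and C: "C > 0"
    and q: "quasi_geodesic_line D (\<lambda>i::int. cayley_act G S (h [^] i) ?x)"
    and P: "\<And>a b P. \<lbrakk>a \<in> generate G {h}; b \<in> generate G {h};
        geodesic_segment X D (cayley_act G S a ?x) (cayley_act G S b ?x) P\<rbrakk> \<Longrightarrow>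
        \<exists>\<pi>. strongly_contracting_projection X D C P \<pi>"
    using assms
    unfolding cayley_has_strongly_contracting_element_def strongly_contracting_def strongly_contracting_with_def
    by blast
  have act: "cayley_act G S (h [^] (i::int)) ?x = vtx (h [^] i)" for i
    using act_vertex[of "h [^] i" \<one>] h by simp
  obtain K e where K: "K \<ge> 1" "e \<ge> 0"
    and low: "\<And>i j. \<bar>real_of_int (i - j)\<bar> / K - e \<le> d (h [^] i) (h [^] j)"
    and up: "\<And>i j. d (h [^] i) (h [^] j) \<le> K * \<bar>real_of_int (i - j)\<bar> + e"
    using q h unfolding quasi_geodesic_line_def act by (auto simp: D_vertex)
  \<comment> \<open>Rounding to vertices turns \<open>C\<close> into \<open>C + 3\<close>, and
    \<open>contracting_mapI\<close> contributes the factor 8.\<close>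
  have contr: "\<exists>\<rho>. contracting_map (8 * (C + 3)) (w ` {..n}) \<rho>"
    if w: "word_geodesic (h [^] (i::int)) (h [^] (j::int)) n w" for i j n w
  proof -
    have "h [^] i \<in> generate G {h}" "h [^] j \<in> generate G {h}"
      using h by (auto simp: generate_pow)
    then obtain \<pi> where "strongly_contracting_projection X D C (realize w ` {0..real n}) \<pi>"
      using P[of "h [^] i" "h [^] j" "realize w ` {0..real n}"] realize_geodesic_segment[OF w]
      unfolding act by auto
    then obtain \<rho> where \<rho>: "\<And>a. a \<in> carrier G \<Longrightarrow> \<rho> a \<in> w ` {..n}"
      "\<And>a. a \<in> w ` {..n} \<Longrightarrow> d a (\<rho> a) \<le> C + 3"
      "\<And>a b m v. \<lbrakk>a \<in> carrier G; b \<in> carrier G; d (\<rho> a) (\<rho> b) > C + 3; word_geodesic a b m v\<rbrakk> \<Longrightarrow>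
        \<exists>i\<le>m. \<exists>j\<le>m. d (v i) (\<rho> a) \<le> C + 3 \<and> d (v j) (\<rho> b) \<le> C + 3"
      using vertex_projection[OF w] by blast
    have "contracting_map (8 * (C + 3)) (w ` {..n}) \<rho>"
      using geodesic_closed[OF w] C by (intro contracting_mapI \<rho>) auto
    then show ?thesis by blast
  qed
  obtain C' where C': "C' \<ge> 0" "\<And>x y p q. \<lbrakk>x \<in> carrier G; y \<in> carrier G; nearest (powers h) x p;
      nearest (powers h) y q; d p q > C'\<rbrakk> \<Longrightarrow> d x p + d p q + d q y \<le> d x y + C'"
    by (rule powers_contracting[OF h K(1,2) _ low up, of "8 * (C + 3)"])
      (use C in simp, rule contr, assumption, blast)
  have "finite {i::int. real (len (h [^] i)) \<le> R}" for R
  proof (rule finite_subset)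
    show "{i::int. real (len (h [^] i)) \<le> R} \<subseteq> {-\<lceil>K * (R + e)\<rceil>..\<lceil>K * (R + e)\<rceil>}"
    proof clarify
      fix i :: int assume i: "real (len (h [^] i)) \<le> R"
      have "\<bar>real_of_int i\<bar> / K - e \<le> R"
        using low[of 0 i] i h by (simp add: d_one)
      then have "\<bar>real_of_int i\<bar> \<le> K * (R + e)"
        using K by (simp add: field_simps)
      then show "i \<in> {-\<lceil>K * (R + e)\<rceil>..\<lceil>K * (R + e)\<rceil>}"
        by (simp add: abs_le_iff) linarith
    qed
  qed simp
  then have "contracting_axis G S h C'"
    using h C' by unfold_locales auto
  then show ?thesis using that by blast
qed

section \<open>The axis as a subgroup, and its commensurator\<close>

context contracting_axis
begin

abbreviation L where "L \<equiv> powers h"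
abbreviation hp :: "int \<Rightarrow> 'a" where "hp i \<equiv> h [^] i"

lemma hp_closed [simp]: "hp i \<in> carrier G"
  using h_closed by simp

lemma hp_add: "hp i \<otimes> hp j = hp (i + j)"
  using h_closed int_pow_mult by metis

lemma hp_inv: "inv (hp i) = hp (- i)"
  using h_closed int_pow_neg by metis

lemma L_closed: "t \<in> L \<Longrightarrow> t \<in> carrier G"
  by (auto simp: powers_def)

lemma hp_L [simp]: "hp i \<in> L"
  by (simp add: powers_def)

lemma one_L [simp]: "\<one> \<in> L"
  using hp_L[of 0] by simp

lemma L_mult: "\<lbrakk>s \<in> L; t \<in> L\<rbrakk> \<Longrightarrow> s \<otimes> t \<in> L"
  by (auto simp: powers_def hp_add)

lemma L_inv: "t \<in> L \<Longrightarrow> inv t \<in> L"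
  by (auto simp: powers_def hp_inv)

lemma L_subgroup: "subgroup L G"
  by (rule subgroupI) (auto intro: L_mult L_inv L_closed one_L)

lemma hp_large:
  assumes "q \<noteq> 0" obtains n :: nat where "real (len (hp (q * int n))) > R"
proof (rule ccontr)
  assume "\<not> thesis"
  then have "\<not> R < real (len (hp (q * int n)))" for n using that by blast
  then have "range (\<lambda>n. q * int n) \<subseteq> {i. real (len (hp i)) \<le> R}"
    by (auto simp: not_less)
  then have "finite (range (\<lambda>n. q * int n))" using proper finite_subset by blast
  moreover have "inj (\<lambda>n. q * int n)" using assms by (auto intro: injI)
  ultimately show False using finite_imageD by fastforce
qed

lemma hp_eq_iff: "hp i = hp j \<longleftrightarrow> i = j"
proof
  assume eq: "hp i = hp j"
  show "i = j"
  proof (rule ccontr)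
    assume "i \<noteq> j"
    then obtain n :: nat where n: "real (len (hp ((i - j) * int n))) > 0"
      using hp_large[of "i - j" 0] by auto
    have "hp (i - j) = \<one>"
      using eq hp_add[of i "- j"] hp_inv[of j] r_inv[OF hp_closed, of j] by simp
    then have "hp ((i - j) * int n) = \<one>"
      using h_closed by (metis int_pow_one int_pow_pow)
    then show False using n by simp
  qed
qed simp

lemma nearest_closed: "nearest L x p \<Longrightarrow> p \<in> carrier G"
  using L_closed by (auto simp: nearest_def)

lemma nearest_ex: "\<exists>p. nearest L x p"
  by (rule nearest_exists) (use one_L in blast)

lemma nearest_translate:
  assumes x: "x \<in> carrier G" and t: "t \<in> L" and p: "nearest L x p"
  shows "nearest L (t \<otimes> x) (t \<otimes> p)"
proof -
  have tc: "t \<in> carrier G" using t L_closed by blast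
  have pL: "p \<in> L" using p by (simp add: nearest_def)
  have "d (t \<otimes> x) (t \<otimes> p) \<le> d (t \<otimes> x) q" if q: "q \<in> L" for q
  proof -
    have "d x p \<le> d x (inv t \<otimes> q)"
      using p q t L_mult L_inv by (auto simp: nearest_def)
    also have "\<dots> = d (t \<otimes> x) q"
      using d_translate[of t x "inv t \<otimes> q"] tc x q L_closed by simp
    finally show ?thesis using tc x pL L_closed by simp
  qed
  then show ?thesis using pL t L_mult by (auto simp: nearest_def)
qed

lemma nearest_self: "\<lbrakk>t \<in> L; nearest L t p\<rbrakk> \<Longrightarrow> p = t"
  using d_eq_0_iff[of t p] d_self[of t] d_nonneg[of t p] L_closed[of t] L_closed[of p]
  unfolding nearest_def by (metis antisym)

lemma nearest_lipschitz:
  "\<lbrakk>x \<in> carrier G; y \<in> carrier G; nearest L x p; nearest L y q\<rbrakk> \<Longrightarrow> d p q \<le> d x y + C"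
  using contraction[of x y p q] d_nonneg[of x y] d_nonneg[of x p] d_nonneg[of q y] by linarith

text \<open>Contraction for the pairs \<open>u\<close>, \<open>w\<close> and \<open>w\<close>,
  \<open>v\<close> shows that the way from \<open>u\<close> through \<open>w\<close> to
  \<open>v\<close> passes \<open>p\<close> twice, so the detour to \<open>w\<close> is paid from the
  excess \<open>C\<close>. If \<open>p\<close> is within \<open>C\<close> of \<open>u\<close> or of
  \<open>v\<close>, the triangle inequality replaces contraction.\<close>

lemma almost_between:
  assumes u: "u \<in> L" and v: "v \<in> L" and w: "w \<in> carrier G"
    and le: "d u w + d w v \<le> d u v + C" and p: "nearest L w p"
  shows "d w p \<le> 3 * C"
proof -
  have uc: "u \<in> carrier G" and vc: "v \<in> carrier G" and pc: "p \<in> carrier G"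
    using u v L_closed nearest_closed[OF p] by auto
  have nu: "nearest L u u" and nv: "nearest L v v"
    using nearest_ex nearest_self u v by metis+
  have 1: "d u p > C \<Longrightarrow> d u p + d p w \<le> d u w + C"
    using contraction[OF uc w nu p] uc by simp
  have 2: "d p v > C \<Longrightarrow> d w p + d p v \<le> d w v + C"
    using contraction[OF w vc p nv] vc by simp
  have "d u v \<le> d u p + d p v" "d w p = d p w" "d w p \<le> d u w + d u p" "d w p \<le> d w v + d p v"
    using d_triangle[of u p v] d_triangle[of w u p] d_triangle[of w v p] d_commute uc vc pc w by auto
  then show ?thesis using 1 2 le C_nonneg by linarith
qed

text \<open>The commensurator of the axis. It is a finite union of cosets of \<open>L\<close> because every
  translate of \<open>L\<close> by one of its elements comes within \<open>3 C\<close> of \<open>L\<close>.\<close>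
definition comm_set :: "'a set" where
  "comm_set = {g \<in> carrier G. \<exists>p q. q \<noteq> 0 \<and> hp q \<otimes> g = g \<otimes> hp p}"

lemma comm_set_ne:
  assumes "g \<in> carrier G" "hp q \<otimes> g = g \<otimes> hp p" "q \<noteq> 0" shows "p \<noteq> 0"
proof
  assume "p = 0"
  then have "hp q \<otimes> g \<otimes> inv g = g \<otimes> inv g" using assms by simp
  then have "hp q = hp 0" using assms(1) by (simp add: m_assoc)
  then show False using hp_eq_iff assms(3) by blast
qed

lemma comm_set_inv: assumes "g \<in> comm_set" shows "inv g \<in> comm_set"
proof -
  obtain p q where pq: "q \<noteq> 0" "hp q \<otimes> g = g \<otimes> hp p" and g: "g \<in> carrier G"
    using assms by (auto simp: comm_set_def)
  have "hp p \<otimes> inv g = inv g \<otimes> (g \<otimes> hp p) \<otimes> inv g" using g by simp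
  also have "\<dots> = inv g \<otimes> (hp q \<otimes> g) \<otimes> inv g" using pq by simp
  also have "\<dots> = inv g \<otimes> hp q" using g by (simp add: m_assoc)
  finally show ?thesis
    using comm_set_ne[OF g pq(2,1)] g by (auto simp: comm_set_def)
qed

lemma comm_set_mult:
  assumes "g \<in> comm_set" shows "hp i \<otimes> g \<otimes> hp j \<in> comm_set"
proof -
  obtain p q where pq: "q \<noteq> 0" "hp q \<otimes> g = g \<otimes> hp p" and g: "g \<in> carrier G"
    using assms by (auto simp: comm_set_def)
  have "hp q \<otimes> (hp i \<otimes> g \<otimes> hp j) = hp i \<otimes> (hp q \<otimes> g) \<otimes> hp j"
    using g by (simp add: m_assoc[symmetric] hp_add add.commute)
  also have "\<dots> = (hp i \<otimes> g \<otimes> hp j) \<otimes> hp p"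
    using g pq by (simp add: m_assoc hp_add add.commute)
  finally show ?thesis using pq(1) g by (auto simp: comm_set_def)
qed

lemma comm_power:
  assumes g: "g \<in> carrier G" and eq: "hp q \<otimes> g = g \<otimes> hp p"
  shows "hp (q * int n) \<otimes> g = g \<otimes> hp (p * int n)"
proof (induction n)
  case 0
  then show ?case using g by simp
next
  case (Suc n)
  have "hp (q * int (Suc n)) \<otimes> g = hp (q * int n) \<otimes> (hp q \<otimes> g)"
    using g by (simp add: m_assoc[symmetric] hp_add algebra_simps)
  also have "\<dots> = (hp (q * int n) \<otimes> g) \<otimes> hp p" using g eq by (simp add: m_assoc)
  also have "\<dots> = g \<otimes> hp (p * int (Suc n))"
    using g Suc by (simp add: m_assoc hp_add algebra_simps)
  finally show ?case .
qed

lemma comm_power_int: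
  assumes g: "g \<in> carrier G" and eq: "hp q \<otimes> g = g \<otimes> hp p"
  shows "hp (q * i) \<otimes> g = g \<otimes> hp (p * i)"
proof (cases "i \<ge> 0")
  case True
  then show ?thesis using comm_power[OF g eq, of "nat i"] by simp
next
  case False
  then have *: "hp (- (q * i)) \<otimes> g = g \<otimes> hp (- (p * i))"
    using comm_power[OF g eq, of "nat (- i)"] by simp
  have "hp (q * i) \<otimes> g = hp (q * i) \<otimes> (g \<otimes> hp (- (p * i))) \<otimes> hp (p * i)"
    using g by (simp add: m_assoc hp_add)
  also have "\<dots> = g \<otimes> hp (p * i)"
    unfolding *[symmetric] using g by (simp add: m_assoc[symmetric] hp_add)
  finally show ?thesis .
qed

text \<open>For large \<open>n\<close> the points \<open>g\<close> and
  \<open>g \<otimes> hp (p * int n) = hp (q * int n) \<otimes> g\<close> of \<open>g L\<close> have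
  distant projections to \<open>L\<close>, so the way between them passes by \<open>p0\<close>.
  Translated by \<open>inv g\<close>, the point \<open>p0\<close> lies almost between two points of
  \<open>L\<close>, and \<open>almost_between\<close> applies: \<open>p0\<close> is within
  \<open>3 * C\<close> of \<open>g L\<close>.\<close>

lemma comm_set_near:
  assumes "g \<in> comm_set"
  obtains i j where "real (len (hp i \<otimes> g \<otimes> hp j)) \<le> 3 * C"
proof -
  obtain p q where pq: "q \<noteq> 0" "hp q \<otimes> g = g \<otimes> hp p" and g: "g \<in> carrier G"
    using assms by (auto simp: comm_set_def)
  obtain p0 where p0: "nearest L g p0" using nearest_ex by blast
  have p0c: "p0 \<in> carrier G" using nearest_closed[OF p0] .
  obtain i where i: "p0 = hp i" using p0 by (auto simp: nearest_def powers_def)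
  obtain n :: nat where n: "real (len (hp (q * int n))) > C" using hp_large[OF pq(1)] by blast
  let ?a = "hp (q * int n)"
  let ?b = "hp (p * int n)"
  have ab: "?a \<otimes> g = g \<otimes> ?b" using comm_power[OF g pq(2)] .
  have near: "nearest L (g \<otimes> ?b) (?a \<otimes> p0)"
    using nearest_translate[OF g _ p0, of ?a] ab by simp
  have "d p0 (?a \<otimes> p0) = real (len ?a)"
    unfolding i wdist_def by (simp add: hp_add hp_inv)
  then have "d g p0 + d p0 (?a \<otimes> p0) + d (?a \<otimes> p0) (g \<otimes> ?b) \<le> d g (g \<otimes> ?b) + C"
    using n g by (intro contraction[OF g _ p0 near]) auto
  then have "d g p0 + d p0 (g \<otimes> ?b) \<le> d g (g \<otimes> ?b) + C"
    using d_triangle[of p0 "?a \<otimes> p0" "g \<otimes> ?b"] g p0c by simp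
  moreover have "d \<one> (inv g \<otimes> p0) = d g p0"
    "d (inv g \<otimes> p0) ?b = d p0 (g \<otimes> ?b)" "d \<one> ?b = d g (g \<otimes> ?b)"
    using g p0c d_translate[of g "\<one>" "inv g \<otimes> p0"] d_translate[of g "inv g \<otimes> p0" ?b]
      d_translate[of g "\<one>" ?b] by simp_all
  ultimately have le: "d \<one> (inv g \<otimes> p0) + d (inv g \<otimes> p0) ?b \<le> d \<one> ?b + C" by simp
  obtain p' where p': "nearest L (inv g \<otimes> p0) p'" using nearest_ex by blast
  obtain j where j: "p' = hp j" using p' by (auto simp: nearest_def powers_def)
  have "d (inv g \<otimes> p0) p' \<le> 3 * C"
    using almost_between[OF _ _ _ le p'] g p0c by simp
  moreover have "d (inv g \<otimes> p0) p' = real (len (hp (- i) \<otimes> g \<otimes> hp j))"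
    using g unfolding wdist_def i j by (simp add: inv_mult_group hp_inv)
  ultimately show ?thesis using that by metis
qed

text \<open>By \<open>comm_set_near\<close> every element is
  \<open>hp (- i) \<otimes> b \<otimes> hp (- j)\<close> with \<open>b\<close> in a finite set.
  Powers of \<open>hp (P b)\<close> on the right of \<open>b\<close> pass to its left, where the
  coset absorbs them, so only the residue of \<open>- j\<close> modulo \<open>P b\<close>
  matters.\<close>

lemma comm_set_cosets: "finite ((\<lambda>g. L #> g) ` comm_set)"
proof -
  define F where "F = comm_set \<inter> ball (nat \<lfloor>3 * C\<rfloor>)"
  have "\<forall>g\<in>comm_set. \<exists>p. \<exists>q. p \<noteq> 0 \<and> hp q \<otimes> g = g \<otimes> hp p"
    using comm_set_ne unfolding comm_set_def by blast
  then obtain P where P: "\<And>g. g \<in> comm_set \<Longrightarrow> P g \<noteq> 0 \<and> (\<exists>q. hp q \<otimes> g = g \<otimes> hp (P g))"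
    by metis
  have sub: "(\<lambda>g. L #> g) ` comm_set \<subseteq> (\<Union>b\<in>F. (\<lambda>r. L #> (b \<otimes> hp r)) ` {0..\<bar>P b\<bar>})"
  proof clarify
    fix g assume g: "g \<in> comm_set"
    then have gc: "g \<in> carrier G" by (simp add: comm_set_def)
    obtain i j where ij: "real (len (hp i \<otimes> g \<otimes> hp j)) \<le> 3 * C" using comm_set_near[OF g] by blast
    define b where "b = hp i \<otimes> g \<otimes> hp j"
    have bE: "b \<in> comm_set" unfolding b_def using comm_set_mult[OF g] .
    then have bc: "b \<in> carrier G" by (simp add: comm_set_def)
    have "len b \<le> nat \<lfloor>3 * C\<rfloor>" using ij unfolding b_def by (simp add: le_nat_floor)
    then have bF: "b \<in> F" using bE bc len_le_iff by (simp add: F_def)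
    obtain q where q: "hp q \<otimes> b = b \<otimes> hp (P b)" and Pb: "P b \<noteq> 0" using P[OF bE] by blast
    define r where "r = (- j) mod \<bar>P b\<bar>"
    have r: "0 \<le> r" "r \<le> \<bar>P b\<bar>" using Pb by (simp_all add: r_def less_imp_le)
    have "\<bar>P b\<bar> dvd - j - r" unfolding r_def by (simp add: minus_mod_eq_mult_div)
    then have "P b dvd - j - r" by simp
    then obtain t where t: "- j - r = P b * t" by (elim dvdE)
    have "g = hp (- i) \<otimes> b \<otimes> hp (- j)"
      unfolding b_def using gc by (simp add: m_assoc hp_add) (simp add: m_assoc[symmetric] hp_add)
    also have "\<dots> = hp (- i) \<otimes> (b \<otimes> hp (P b * t)) \<otimes> hp r"
      using bc t by (simp add: m_assoc hp_add algebra_simps)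
    also have "\<dots> = hp (- i + q * t) \<otimes> (b \<otimes> hp r)"
      unfolding comm_power_int[OF bc q, symmetric] hp_add[symmetric] using bc by (simp add: m_assoc)
    finally have "L #> g = L #> hp (- i + q * t) #> (b \<otimes> hp r)"
      using bc L_subgroup by (simp add: coset_mult_assoc subgroup.subset)
    also have "L #> hp (- i + q * t) = L"
      using L_subgroup by (simp add: coset_join2)
    finally show "L #> g \<in> (\<Union>b\<in>F. (\<lambda>r. L #> (b \<otimes> hp r)) ` {0..\<bar>P b\<bar>})"
      using bF r by (intro UN_I[of b] image_eqI[of _ _ r]) auto
  qed
  have "finite F" using finite_ball by (simp add: F_def)
  then show ?thesis by (intro finite_subset[OF sub]) auto
qed

lemma infinite_same_coset:
  fixes f :: "nat \<Rightarrow> 'a"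
  assumes "\<And>n. f n \<in> comm_set"
  obtains i j where "i < j" "L #> f i = L #> f j"
proof -
  have "finite (range (\<lambda>n. L #> f n))"
    using comm_set_cosets assms by (rule_tac finite_subset[of _ "(\<lambda>g. L #> g) ` comm_set"]) auto
  then have "\<not> inj (\<lambda>n. L #> f n)" using finite_imageD by blast
  then obtain i j where "i \<noteq> j" "L #> f i = L #> f j" by (auto simp: inj_def)
  then show ?thesis using that by (metis linorder_neqE_nat)
qed

lemma same_coset_diff:
  assumes "x \<in> carrier G" "y \<in> carrier G" "L #> x = L #> y" obtains i where "y = hp i \<otimes> x"
proof -
  have "y \<in> L #> x" using assms L_subgroup rcos_self by blast
  then show ?thesis using that by (auto simp: r_coset_def powers_def)
qed

text \<open>If \<open>N\<close> lay in the commensurator, two of its elements would share a coset of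
  \<open>L\<close>, so \<open>N\<close> would contain a power \<open>hp p\<close> with
  \<open>p \<noteq> 0\<close>. For every \<open>g\<close> the conjugates of the powers of
  \<open>hp p\<close> by \<open>g\<close> lie in \<open>N\<close>, and two of them sharing a coset
  put \<open>g\<close> into the commensurator. Then \<open>L\<close> has finite index in the whole
  group.\<close>

lemma not_subset_comm_set:
  assumes ne: "\<not> elementary_group G" and N: "N \<lhd> G" and inf: "infinite N"
  obtains m where "m \<in> N" "m \<notin> comm_set"
proof (rule ccontr)
  assume "\<not> thesis"
  then have sub: "N \<subseteq> comm_set" using that by blast
  interpret N: normal N G by (rule N)
  obtain f :: "nat \<Rightarrow> 'a" where f: "inj f" "range f \<subseteq> N"
    using infinite_countable_subset[OF inf] by blast
  then have fN: "f n \<in> N" for n by blast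
  obtain i j where ij: "i < j" "L #> f i = L #> f j"
    using infinite_same_coset[of f] fN sub by blast
  obtain p where p: "f j = hp p \<otimes> f i"
    using same_coset_diff ij(2) fN N.subset by blast
  have "p \<noteq> 0"
  proof
    assume "p = 0"
    then have "f j = f i" using p fN N.subset by auto
    then show False using f(1) ij(1) by (auto simp: inj_def)
  qed
  have "hp p = f j \<otimes> inv (f i)"
    using p fN[of i] N.subset by (simp add: m_assoc subsetD)
  then have hpN: "hp p \<in> N" using fN by simp
  have "carrier G \<subseteq> comm_set"
  proof
    fix g assume g: "g \<in> carrier G"
    have conj: "g \<otimes> hp (p * int n) \<otimes> inv g \<in> N" for n
    proof -
      have "hp (p * int n) \<in> N"
      proof (induction n)
        case (Suc n)
        then have "hp (p * int n) \<otimes> hp p \<in> N" using hpN by simp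
        then show ?case by (simp add: hp_add algebra_simps)
      qed simp
      then show ?thesis using N.inv_op_closed2[OF g] by blast
    qed
    obtain a b where ab: "a < b" "L #> (g \<otimes> hp (p * int a) \<otimes> inv g) = L #> (g \<otimes> hp (p * int b) \<otimes> inv g)"
      using infinite_same_coset[of "\<lambda>n. g \<otimes> hp (p * int n) \<otimes> inv g"] conj sub by blast
    then obtain q where q: "g \<otimes> hp (p * int b) \<otimes> inv g = hp q \<otimes> (g \<otimes> hp (p * int a) \<otimes> inv g)"
      using same_coset_diff[OF _ _ ab(2)] g by auto
    have "g \<otimes> hp (p * int b) = (g \<otimes> hp (p * int b) \<otimes> inv g) \<otimes> g" using g by (simp add: m_assoc)
    also have "\<dots> = hp q \<otimes> g \<otimes> hp (p * int a)" unfolding q using g by (simp add: m_assoc)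
    finally have "g \<otimes> hp (p * int b) \<otimes> hp (- (p * int a)) = hp q \<otimes> g \<otimes> hp (p * int a) \<otimes> hp (- (p * int a))"
      by simp
    then have eq: "g \<otimes> hp (p * int b - p * int a) = hp q \<otimes> g"
      using g by (simp add: m_assoc hp_add)
    have "q \<noteq> 0"
    proof
      assume "q = 0"
      then have "g \<otimes> hp (p * int b - p * int a) = g \<otimes> hp 0" using eq g by simp
      then have "hp (p * int b - p * int a) = hp 0" using g by simp
      then have "p * int b - p * int a = 0" using hp_eq_iff by blast
      then show False using \<open>p \<noteq> 0\<close> ab(1) by (simp add: right_diff_distrib[symmetric])
    qed
    then show "g \<in> comm_set" using eq g unfolding comm_set_def by (metis (mono_tags, lifting) mem_Collect_eq)
  qed
  then have "rcosets L \<subseteq> (\<lambda>g. L #> g) ` comm_set" by (auto simp: RCOSETS_def)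
  then have "finite (rcosets L)" using comm_set_cosets finite_subset by blast
  moreover have "infinite L"
    unfolding powers_def using hp_eq_iff by (metis finite_imageD infinite_UNIV_int injI)
  ultimately show False
    using ne h_closed generate_powers[OF h_closed] unfolding elementary_group_def by metis
qed

end

section \<open>Inserting blocks along transverse axes\<close>

context contracting_axis
begin

lemma hp_add_left: "x \<in> carrier G \<Longrightarrow> hp i \<otimes> (hp j \<otimes> x) = hp (i + j) \<otimes> x"
  by (simp add: m_assoc[symmetric] hp_add)

text \<open>If \<open>m \<otimes> t\<close> projects to some \<open>hp i\<close> far from the
  projection of \<open>m\<close>, the way along \<open>m L\<close> passes by \<open>hp i\<close>, so
  \<open>hp (- i) \<otimes> m \<otimes> hp j\<close> has length at most \<open>3 * C\<close> for
  some \<open>j\<close>. Only finitely many \<open>i\<close> allow this: a coincidence of two such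
  elements would put \<open>m\<close> into \<open>comm_set\<close>.\<close>

lemma transverse_bound:
  assumes m: "m \<in> carrier G" and nc: "m \<notin> comm_set"
  obtains B where "\<And>t p. \<lbrakk>t \<in> L; nearest L (m \<otimes> t) p\<rbrakk> \<Longrightarrow> d \<one> p \<le> B"
proof -
  define I where "I = {i. \<exists>j. real (len (hp (- i) \<otimes> m \<otimes> hp j)) \<le> 3 * C}"
  have "finite I"
  proof (rule ccontr)
    assume inf: "infinite I"
    have "\<forall>i\<in>I. \<exists>j. real (len (hp (- i) \<otimes> m \<otimes> hp j)) \<le> 3 * C" by (simp add: I_def)
    then obtain J where J: "\<And>i. i \<in> I \<Longrightarrow> real (len (hp (- i) \<otimes> m \<otimes> hp (J i))) \<le> 3 * C" by metis
    have "(\<lambda>i. hp (- i) \<otimes> m \<otimes> hp (J i)) ` I \<subseteq> ball (nat \<lfloor>3 * C\<rfloor>)"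
    proof clarify
      fix i assume "i \<in> I"
      then have "len (hp (- i) \<otimes> m \<otimes> hp (J i)) \<le> nat \<lfloor>3 * C\<rfloor>" using J by (simp add: le_nat_floor)
      then show "hp (- i) \<otimes> m \<otimes> hp (J i) \<in> ball (nat \<lfloor>3 * C\<rfloor>)" using m by (simp add: len_le_iff)
    qed
    then have "finite ((\<lambda>i. hp (- i) \<otimes> m \<otimes> hp (J i)) ` I)" using finite_ball finite_subset by blast
    then obtain i i' where i: "i \<noteq> i'" "hp (- i) \<otimes> m \<otimes> hp (J i) = hp (- i') \<otimes> m \<otimes> hp (J i')"
      using inf finite_imageD unfolding inj_on_def by blast
    have "hp (i' - i) \<otimes> m = hp i' \<otimes> (hp (- i) \<otimes> m \<otimes> hp (J i)) \<otimes> hp (- J i)"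
      using m by (simp add: m_assoc hp_add hp_add_left)
    also have "\<dots> = m \<otimes> hp (J i' - J i)"
      unfolding i(2) using m by (simp add: m_assoc hp_add hp_add_left)
    finally have "hp (i' - i) \<otimes> m = m \<otimes> hp (J i' - J i)" .
    moreover have "i' - i \<noteq> 0" using i(1) by simp
    ultimately show False using nc m unfolding comm_set_def by blast
  qed
  define R where "R = Max (insert 0 ((\<lambda>i. d \<one> (hp i)) ` I))"
  have R: "d \<one> (hp i) \<le> R" if "i \<in> I" for i
    unfolding R_def using \<open>finite I\<close> that by (intro Max_ge) auto
  obtain p0 where p0: "nearest L m p0" using nearest_ex by blast
  have p0c: "p0 \<in> carrier G" using nearest_closed[OF p0] .
  have "d \<one> p \<le> max R (d \<one> p0 + C)" if t: "t \<in> L" and p: "nearest L (m \<otimes> t) p" for t p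
  proof (cases "d p0 p > C")
    case False
    then show ?thesis using d_triangle[OF one_closed p0c nearest_closed[OF p]] by linarith
  next
    case True
    have tc: "t \<in> carrier G" and pc: "p \<in> carrier G" using L_closed[OF t] nearest_closed[OF p] by auto
    obtain i where i: "p = hp i" using p by (auto simp: nearest_def powers_def)
    have "d m p0 + d p0 p + d p (m \<otimes> t) \<le> d m (m \<otimes> t) + C"
      using contraction[OF m _ p0 p True] m tc by simp
    then have "d m p + d p (m \<otimes> t) \<le> d m (m \<otimes> t) + C"
      using d_triangle[OF m p0c pc] by linarith
    moreover have "d \<one> (inv m \<otimes> p) = d m p" "d (inv m \<otimes> p) t = d p (m \<otimes> t)" "d \<one> t = d m (m \<otimes> t)"
      using m pc tc d_translate[of m \<one> "inv m \<otimes> p"] d_translate[of m "inv m \<otimes> p" t] d_translate[of m \<one> t]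
      by simp_all
    ultimately have le: "d \<one> (inv m \<otimes> p) + d (inv m \<otimes> p) t \<le> d \<one> t + C" by simp
    obtain q where q: "nearest L (inv m \<otimes> p) q" using nearest_ex by blast
    obtain j where j: "q = hp j" using q by (auto simp: nearest_def powers_def)
    have "d (inv m \<otimes> p) q \<le> 3 * C"
      using almost_between[OF one_L t _ le q] m pc by simp
    moreover have "d (inv m \<otimes> p) q = real (len (hp (- i) \<otimes> m \<otimes> hp j))"
      using m unfolding wdist_def i j by (simp add: inv_mult_group hp_inv)
    ultimately have "i \<in> I" unfolding I_def by auto
    then show ?thesis using R i by fastforce
  qed
  then show ?thesis using that by blast
qed

end

text \<open>An element \<open>m\<close> whose translates \<open>m L\<close> and \<open>m\<^sup>-\<^sup>1 L\<close> of the axis have projections to \<open>L\<close> within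
  \<open>B\<close> of \<open>\<one>\<close>; then the conjugates \<open>block k\<close> of \<open>m\<close> travel along two transverse axes.\<close>
locale transverse = contracting_axis +
  fixes m and B :: real
  assumes m_closed: "m \<in> carrier G"
    and m_bound: "\<lbrakk>t \<in> L; nearest L (m \<otimes> t) p\<rbrakk> \<Longrightarrow> d \<one> p \<le> B"
    and inv_m_bound: "\<lbrakk>t \<in> L; nearest L (inv m \<otimes> t) p\<rbrakk> \<Longrightarrow> d \<one> p \<le> B"
begin

text \<open>\<open>A0\<close> comes from Behrstock's inequality, \<open>B1\<close> also absorbs a correction by \<open>m\<close>, \<open>B3\<close> is the bound
  that reproduces itself when blocks are inserted, and powers of \<open>h\<close> longer than \<open>K0\<close> dominate all of them.\<close>
definition "A0 = B + 2 * C"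
definition "M = d \<one> m"
definition "B1 = A0 + M + 2 * C"
definition "B3 = B1 + C"
definition "K0 = 10 * A0 + 10 * B1 + 10 * B3 + 10 * C + 10 * M"

section \<open>Behrstock's inequality and good representatives\<close>

lemma B_nonneg: "B \<ge> 0"
proof -
  obtain p where p: "nearest L (m \<otimes> \<one>) p" using nearest_ex by blast
  show ?thesis using m_bound[OF one_L p] d_nonneg[of \<one> p] by linarith
qed

lemma constants: "0 \<le> A0" "0 \<le> M" "A0 + M + 2 * C = B1" "B3 = B1 + C" "0 \<le> C" "0 \<le> B1" "0 \<le> B3"
  "K0 = 10 * A0 + 10 * B1 + 10 * B3 + 10 * C + 10 * M" "0 \<le> K0"
  using B_nonneg C_nonneg by (auto simp: A0_def M_def B1_def B3_def K0_def)

text \<open>All nearest points are meant; by \<open>nearest_unique\<close> they differ by at most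
  \<open>C\<close>, which is the price for passing from one of them to all.\<close>

definition near_one :: "real \<Rightarrow> 'a \<Rightarrow> bool" where
  "near_one r x \<longleftrightarrow> (\<forall>p. nearest L x p \<longrightarrow> d \<one> p \<le> r)"

lemma near_one_mono: "\<lbrakk>near_one r x; r \<le> r'\<rbrakk> \<Longrightarrow> near_one r' x"
  unfolding near_one_def by force

lemma near_one_one: "r \<ge> 0 \<Longrightarrow> near_one r \<one>"
  unfolding near_one_def using nearest_self[OF one_L] by (metis d_self one_closed)

text \<open>Here \<open>y = m \<otimes> u\<close> is a nearest point of \<open>m L\<close> to
  \<open>x\<close>. If both projections were far out, contraction of \<open>L\<close> would place
  \<open>p\<close> well before \<open>y\<close> on the way from \<open>x\<close> to
  \<open>y\<close>, making \<open>p\<close> closer to \<open>x\<close> than \<open>y\<close> is;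
  contraction of \<open>m L\<close> would say the opposite. The margin \<open>2 * C\<close> in
  \<open>A0\<close> beats the error \<open>C\<close> in either inequality.\<close>

lemma behrstock:
  assumes x: "x \<in> carrier G" and p: "nearest L x p" and u: "nearest L (inv m \<otimes> x) u"
  shows "d \<one> p \<le> A0 \<or> d \<one> u \<le> A0"
proof (rule ccontr)
  assume "\<not> (d \<one> p \<le> A0 \<or> d \<one> u \<le> A0)"
  then have far: "d \<one> p > B + 2 * C" "d \<one> u > B + 2 * C" by (auto simp: A0_def)
  have pL: "p \<in> L" and uL: "u \<in> L" using p u by (auto simp: nearest_def)
  note pc = nearest_closed[OF p] and uc = nearest_closed[OF u]
  define y where "y = m \<otimes> u"
  have yc: "y \<in> carrier G" using m_closed uc by (simp add: y_def)
  obtain p' where p': "nearest L y p'" using nearest_ex by blast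
  obtain u' where u': "nearest L (inv m \<otimes> p) u'" using nearest_ex by blast
  note p'c = nearest_closed[OF p'] and u'c = nearest_closed[OF u']
  have b: "d \<one> p' \<le> B" "d \<one> u' \<le> B"
    using m_bound[OF uL] p' inv_m_bound[OF pL u'] by (auto simp: y_def)
  have t: "d \<one> p \<le> d \<one> p' + d p p'" "d \<one> u \<le> d \<one> u' + d u u'"
    using d_triangle[OF one_closed p'c pc] d_triangle[OF one_closed u'c uc]
      d_commute[OF p'c pc] d_commute[OF u'c uc] by auto
  have "d p p' > C" "d u u' > C" using t b far C_nonneg by linarith+
  then have 1: "d x p + d p p' + d p' y \<le> d x y + C"
    and 2: "d (inv m \<otimes> x) u + d u u' + d u' (inv m \<otimes> p) \<le> d (inv m \<otimes> x) (inv m \<otimes> p) + C"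
    using contraction[OF x yc p p'] contraction[OF _ _ u u'] m_closed x pc by auto
  have 3: "d (inv m \<otimes> x) u = d x y" "d (inv m \<otimes> x) (inv m \<otimes> p) = d x p"
    using d_translate[of m "inv m \<otimes> x" u] m_closed x uc pc by (auto simp: y_def)
  show False using 1 2 3 t far b d_nonneg[of p' y] d_nonneg[of p p'] d_nonneg[of u' "inv m \<otimes> p"] by linarith
qed

lemma behrstock_inv:
  assumes x: "x \<in> carrier G" and p: "nearest L x p" and u: "nearest L (m \<otimes> x) u"
  shows "d \<one> p \<le> A0 \<or> d \<one> u \<le> A0"
  using behrstock[of "m \<otimes> x" u p] x p u m_closed by auto

lemma nearest_unique: "\<lbrakk>x \<in> carrier G; nearest L x p; nearest L x q\<rbrakk> \<Longrightarrow> d p q \<le> C"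
  using nearest_lipschitz[of x x p q] by simp

lemma near_one_cases:
  assumes x: "x \<in> carrier G" shows "near_one (A0 + C) x \<or> near_one (A0 + C) (inv m \<otimes> x)"
proof -
  have "near_one (A0 + C) y" if y: "y \<in> carrier G" "nearest L y p" "d \<one> p \<le> A0" for y p
    unfolding near_one_def
  proof clarify
    fix q assume q: "nearest L y q"
    then show "d \<one> q \<le> A0 + C"
      using nearest_unique[OF y(1,2) q] d_triangle[OF one_closed nearest_closed[OF y(2)] nearest_closed[OF q]] y(3)
      by linarith
  qed
  moreover obtain p u where "nearest L x p" "nearest L (inv m \<otimes> x) u" using nearest_ex by metis
  ultimately show ?thesis using behrstock[OF x] x m_closed by blast
qed

lemma near_one_shift:
  assumes x: "x \<in> carrier G" and g: "g \<in> carrier G" and r: "near_one r x" and s: "d \<one> g \<le> s"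
  shows "near_one (r + s + C) (x \<otimes> g)"
  unfolding near_one_def
proof clarify
  fix p assume p: "nearest L (x \<otimes> g) p"
  obtain q where q: "nearest L x q" using nearest_ex by blast
  have "d q p \<le> d x (x \<otimes> g) + C" using nearest_lipschitz[OF x _ q p] x g by simp
  moreover have "d x (x \<otimes> g) = d \<one> g" using x g by (simp add: d_mult_right d_one)
  moreover have "d \<one> q \<le> r" using r q by (simp add: near_one_def)
  ultimately show "d \<one> p \<le> r + s + C"
    using d_triangle[OF one_closed nearest_closed[OF q] nearest_closed[OF p]] s by linarith
qed

text \<open>The length condition ensures that putting \<open>b\<close> in front of
  \<open>block k \<otimes> x\<close> makes it strictly longer, since \<open>insertion_length\<close>
  loses only \<open>2 * B1 + C\<close>.\<close>

definition good :: "'a \<Rightarrow> bool" where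
  "good b \<longleftrightarrow> b \<in> carrier G \<and> near_one B1 b \<and> near_one B1 (inv b) \<and> d \<one> b > 2 * B1 + C"

lemma d_one_inv: "x \<in> carrier G \<Longrightarrow> d \<one> (inv x) = d \<one> x"
  by (simp add: d_one len_inv)

lemma d_one_mult: "\<lbrakk>x \<in> carrier G; y \<in> carrier G\<rbrakk> \<Longrightarrow> d \<one> (x \<otimes> y) \<le> d \<one> x + d \<one> y"
  using len_mult[of x y] by (simp add: d_one)

lemma d_one_mult_ge:
  assumes "x \<in> carrier G" "y \<in> carrier G"
  shows "d \<one> (x \<otimes> y) \<ge> d \<one> x - d \<one> y" "d \<one> (x \<otimes> y) \<ge> d \<one> y - d \<one> x"
proof -
  have "d \<one> ((x \<otimes> y) \<otimes> inv y) \<le> d \<one> (x \<otimes> y) + d \<one> (inv y)"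
    using assms by (intro d_one_mult) auto
  then show "d \<one> (x \<otimes> y) \<ge> d \<one> x - d \<one> y"
    using assms d_one_inv by (simp add: m_assoc)
  have "d \<one> (inv x \<otimes> (x \<otimes> y)) \<le> d \<one> (inv x) + d \<one> (x \<otimes> y)"
    using assms by (intro d_one_mult) auto
  then show "d \<one> (x \<otimes> y) \<ge> d \<one> y - d \<one> x"
    using assms d_one_inv by simp
qed

text \<open>The right correction \<open>c'\<close> brings the projection of the inverse close to
  \<open>\<one>\<close>, the left one \<open>c\<close> does so for \<open>a \<otimes> c'\<close>.
  The choice of \<open>c\<close> disturbs the inverse only by a factor of length at most
  \<open>M\<close> on the right, whence \<open>B1 = A0 + M + 2 * C\<close>. The length drops by at
  most \<open>2 * M\<close>.\<close>

lemma good_exists: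
  assumes a: "a \<in> carrier G" and far: "d \<one> a > 2 * B1 + C + 2 * M"
  obtains c c' where "c \<in> {\<one>, inv m}" "c' \<in> {\<one>, m}" "good (c \<otimes> a \<otimes> c')"
proof -
  obtain c' where c': "c' \<in> {\<one>, m}" "near_one (A0 + C) (inv (a \<otimes> c'))"
  proof (cases "near_one (A0 + C) (inv a)")
    case True
    then show ?thesis using that[of \<one>] a by simp
  next
    case False
    then have "near_one (A0 + C) (inv (a \<otimes> m))"
      using near_one_cases[of "inv a"] a m_closed by (simp add: inv_mult_group)
    then show ?thesis using that[of m] by simp
  qed
  have c'c: "c' \<in> carrier G" "d \<one> c' \<le> M" using c' m_closed constants by (auto simp: M_def)
  obtain c where c: "c \<in> {\<one>, inv m}" "near_one (A0 + C) (c \<otimes> (a \<otimes> c'))"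
  proof (cases "near_one (A0 + C) (a \<otimes> c')")
    case True
    then show ?thesis using that[of \<one>] a c'c by simp
  next
    case False
    then have "near_one (A0 + C) (inv m \<otimes> (a \<otimes> c'))"
      using near_one_cases[of "a \<otimes> c'"] a c'c by simp
    then show ?thesis using that[of "inv m"] by simp
  qed
  have cc: "c \<in> carrier G" "d \<one> c \<le> M" using c m_closed constants d_one_inv by (auto simp: M_def)
  let ?b = "c \<otimes> a \<otimes> c'"
  have b: "?b = c \<otimes> (a \<otimes> c')" using a cc c'c by (simp add: m_assoc)
  have "near_one B1 ?b" unfolding b using c(2) constants by (elim near_one_mono) linarith
  moreover have "near_one B1 (inv ?b)"
  proof -
    have "near_one (A0 + C + M + C) (inv (a \<otimes> c') \<otimes> inv c)"
      using a cc c'c d_one_inv by (intro near_one_shift c'(2)) auto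
    moreover have "inv ?b = inv (a \<otimes> c') \<otimes> inv c" unfolding b using a cc c'c by (simp add: inv_mult_group)
    ultimately show ?thesis using constants by (auto elim: near_one_mono)
  qed
  moreover have "d \<one> ?b > 2 * B1 + C"
    using d_one_mult_ge(1)[of "c \<otimes> a" c'] d_one_mult_ge(2)[of c a] a cc c'c far by auto
  ultimately have "good ?b" using a cc c'c by (simp add: good_def)
  then show ?thesis using that c(1) c'(1) by blast
qed

section \<open>Products of good elements and blocks\<close>

definition block :: "int \<Rightarrow> 'a" where
  "block k = hp k \<otimes> m \<otimes> hp (- k)"

lemma block_closed [simp]: "block k \<in> carrier G"
  using m_closed by (simp add: block_def)

lemma hp_translate: "d (hp i \<otimes> p) (hp i) = d \<one> p" if "p \<in> carrier G" for p i
  using d_translate[of "hp i" p \<one>] that d_commute[of p \<one>] by simp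

text \<open>Shifted by \<open>hp (- k)\<close>, the projection of \<open>x\<close> is farther than
  \<open>A0\<close> from \<open>\<one>\<close>. Behrstock's inequality then keeps the projection of
  \<open>n \<otimes> (hp (- k) \<otimes> x)\<close> within \<open>A0\<close> of
  \<open>\<one>\<close>, and shifting back turns \<open>\<one>\<close> into \<open>hp k\<close>. The
  general \<open>n\<close> serves both \<open>m\<close> and \<open>inv m\<close>.\<close>

lemma conjugate_nearest:
  assumes n: "n \<in> carrier G"
    and beh: "\<And>x p u. \<lbrakk>x \<in> carrier G; nearest L x p; nearest L (inv n \<otimes> x) u\<rbrakk> \<Longrightarrow> d \<one> p \<le> A0 \<or> d \<one> u \<le> A0"
    and x: "x \<in> carrier G" and r: "near_one r x" and k: "d \<one> (hp k) > A0 + r"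
    and p: "nearest L (hp k \<otimes> n \<otimes> hp (- k) \<otimes> x) p"
  shows "d p (hp k) \<le> A0"
proof -
  define y where "y = n \<otimes> (hp (- k) \<otimes> x)"
  have yc: "y \<in> carrier G" using n x by (simp add: y_def)
  obtain q where q: "nearest L x q" using nearest_ex by blast
  note qc = nearest_closed[OF q] and pc = nearest_closed[OF p]
  have "nearest L (hp (- k) \<otimes> (hp k \<otimes> n \<otimes> hp (- k) \<otimes> x)) (hp (- k) \<otimes> p)"
    using n x by (intro nearest_translate p) auto
  moreover have "hp (- k) \<otimes> (hp k \<otimes> n \<otimes> hp (- k) \<otimes> x) = y"
    unfolding y_def using n x by (simp add: m_assoc hp_inv[symmetric])
  ultimately have 1: "nearest L y (hp (- k) \<otimes> p)" by simp
  have 2: "nearest L (inv n \<otimes> y) (hp (- k) \<otimes> q)"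
    unfolding y_def using n x nearest_translate[OF x _ q, of "hp (- k)"] by simp
  have "d \<one> (hp (- k) \<otimes> q) \<ge> d \<one> (hp (- k)) - d \<one> q" by (rule d_one_mult_ge) (use qc in auto)
  moreover have "d \<one> (hp (- k)) = d \<one> (hp k)" using d_one_inv[of "hp k"] hp_inv by simp
  moreover have "d \<one> q \<le> r" using r q by (simp add: near_one_def)
  ultimately have "\<not> d \<one> (hp (- k) \<otimes> q) \<le> A0" using k by linarith
  then have "d \<one> (hp (- k) \<otimes> p) \<le> A0" using beh[OF yc 1 2] by blast
  moreover have "d \<one> (hp (- k) \<otimes> p) = d p (hp k)"
    using hp_translate[of "hp (- k) \<otimes> p" k] pc by (simp add: hp_inv[symmetric])
  ultimately show ?thesis by simp
qed

lemma block_nearest: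
  assumes "x \<in> carrier G" "near_one r x" "d \<one> (hp k) > A0 + r" "nearest L (block k \<otimes> x) p"
  shows "d p (hp k) \<le> A0"
  using conjugate_nearest[OF m_closed behrstock assms(1-3)] assms(4) by (simp add: block_def)

lemma inv_block: "inv (block k) = hp k \<otimes> inv m \<otimes> hp (- k)"
  using m_closed by (simp add: block_def inv_mult_group hp_inv m_assoc)

lemma inv_block_nearest:
  assumes "x \<in> carrier G" "near_one r x" "d \<one> (hp k) > A0 + r" "nearest L (inv (block k) \<otimes> x) p"
  shows "d p (hp k) \<le> A0"
  using conjugate_nearest[of "inv m", OF _ _ assms(1-3)] behrstock_inv assms(4) m_closed
  by (auto simp: inv_block)

lemma good_inv_nearest: "\<lbrakk>good b; nearest L (inv b) p\<rbrakk> \<Longrightarrow> d \<one> p \<le> B1"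
  by (auto simp: good_def near_one_def)

lemma d_product: "\<lbrakk>a \<in> carrier G; b \<in> carrier G\<rbrakk> \<Longrightarrow> d \<one> (a \<otimes> b) = d (inv a) b"
  by (simp add: wdist_def)

text \<open>Seen from \<open>inv b\<close>, the product is the way to
  \<open>block k \<otimes> x\<close>. The projections of these two points are near
  \<open>\<one>\<close> and near \<open>hp k\<close>, so contraction applies; going through
  \<open>\<one>\<close> instead of \<open>p\<close> costs \<open>B1\<close> on either side.\<close>

lemma insertion_length:
  assumes b: "good b" and x: "x \<in> carrier G" "near_one B3 x" and k: "d \<one> (hp k) > K0"
  shows "d \<one> (b \<otimes> block k \<otimes> x) \<ge> d \<one> b + d \<one> (block k \<otimes> x) - 2 * B1 - C"
proof -
  have bc: "b \<in> carrier G" using b by (simp add: good_def)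
  let ?w = "block k \<otimes> x"
  have wc: "?w \<in> carrier G" using x by simp
  obtain p q where p: "nearest L (inv b) p" and q: "nearest L ?w q" using nearest_ex by metis
  note pc = nearest_closed[OF p] and qc = nearest_closed[OF q]
  have p1: "d \<one> p \<le> B1" using good_inv_nearest[OF b p] .
  have q1: "d q (hp k) \<le> A0" using block_nearest[OF x _ q] k constants by linarith
  have "d \<one> (hp k) \<le> d \<one> p + d p q + d q (hp k)"
    using d_triangle[of \<one> p "hp k"] d_triangle[of p q "hp k"] pc qc by simp
  then have "d p q > C" using p1 q1 k constants by linarith
  then have "d (inv b) p + d p q + d q ?w \<le> d (inv b) ?w + C"
    using contraction[OF _ wc p q] bc by simp
  moreover have "d \<one> (inv b) \<le> d \<one> p + d (inv b) p" "d \<one> ?w \<le> d \<one> p + (d p q + d q ?w)"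
    using d_triangle[of \<one> p "inv b"] d_commute[of p "inv b"] d_triangle[of \<one> p ?w] d_triangle[of p q ?w]
      pc qc wc bc by auto
  moreover have "d (inv b) ?w = d \<one> (b \<otimes> block k \<otimes> x)"
    using d_product[OF bc wc] bc x by (simp add: m_assoc)
  ultimately show ?thesis using p1 d_one_inv[OF bc] by linarith
qed

text \<open>If the product projected far out, the way to it from \<open>b\<close> would pass near
  \<open>\<one>\<close>, so \<open>block k \<otimes> x\<close> would be almost as long as
  \<open>b\<close> and the product together. By \<open>insertion_length\<close> the product is
  itself almost as long as \<open>b\<close> and \<open>block k \<otimes> x\<close> together, which
  leaves \<open>d \<one> b \<le> 2 * B1 + C\<close>.\<close>

lemma insertion_near_one:
  assumes b: "good b" and x: "x \<in> carrier G" "near_one B3 x" and k: "d \<one> (hp k) > K0"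
  shows "near_one B3 (b \<otimes> block k \<otimes> x)"
  unfolding near_one_def
proof (intro allI impI, rule ccontr)
  fix p assume p: "nearest L (b \<otimes> block k \<otimes> x) p" and far: "\<not> d \<one> p \<le> B3"
  have bc: "b \<in> carrier G" using b by (simp add: good_def)
  let ?g = "b \<otimes> block k \<otimes> x"
  have gc: "?g \<in> carrier G" using bc x by simp
  obtain q where q: "nearest L b q" using nearest_ex by blast
  note pc = nearest_closed[OF p] and qc = nearest_closed[OF q]
  have q1: "d \<one> q \<le> B1" using b q by (auto simp: good_def near_one_def)
  then have "d q p > C" using far d_triangle[OF one_closed qc pc] constants by linarith
  then have "d b q + d q p + d p ?g \<le> d b ?g + C"
    using contraction[OF bc gc q p] by simp
  moreover have "d \<one> b \<le> d \<one> q + d b q" "d \<one> ?g \<le> d \<one> q + (d q p + d p ?g)"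
    using d_triangle[OF one_closed qc bc] d_commute[OF qc bc] d_triangle[OF one_closed qc gc]
      d_triangle[OF qc pc gc] by auto
  moreover have "d b ?g = d \<one> (block k \<otimes> x)"
    using d_translate[of b \<one> "block k \<otimes> x"] bc x by (simp add: m_assoc)
  ultimately show False
    using insertion_length[OF assms] q1 b constants unfolding good_def by linarith
qed

text \<open>If \<open>b'\<close> were far from \<open>b\<close>, it would lie beyond the block after \<open>b\<close>, and removing this block would
  shorten \<open>b'\<close> within its coset of \<open>N\<close>.\<close>
lemma insertion_separation:
  assumes N: "N \<lhd> G" "m \<in> N"
    and b: "good b" and b': "good b'" and x: "x \<in> carrier G" "near_one B3 x"
    and x': "x' \<in> carrier G" "near_one B3 x'" and k: "d \<one> (hp k) > K0"
    and eq: "b \<otimes> block k \<otimes> x = b' \<otimes> block k \<otimes> x'" and le: "d \<one> b \<le> d \<one> b'"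
    and min: "\<And>n. n \<in> N \<Longrightarrow> d \<one> b' \<le> d \<one> (n \<otimes> b') + 2 * M"
  shows "d b b' \<le> 2 * d \<one> (block k) + K0"
proof -
  interpret N: normal N G by (rule N)
  have bc: "b \<in> carrier G" and b'c: "b' \<in> carrier G" using b b' by (auto simp: good_def)
  let ?W = "block k"
  define g where "g = b \<otimes> ?W \<otimes> x"
  \<comment> \<open>Translation by \<open>f\<close> carries \<open>\<one>\<close>,
    \<open>b'\<close>, \<open>g\<close> to \<open>f\<close>, \<open>y\<close>, \<open>x\<close>. The
    block after \<open>b\<close> then runs along \<open>L\<close>: \<open>f\<close> projects near
    \<open>hp k\<close> and \<open>x\<close> near \<open>\<one>\<close>.\<close>
  define f where "f = inv (b \<otimes> ?W)"
  define y where "y = f \<otimes> b'"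
  have gc: "g \<in> carrier G" and fc: "f \<in> carrier G" using bc x by (auto simp: g_def f_def)
  have yc: "y \<in> carrier G" using fc b'c by (simp add: y_def)
  have fg: "f \<otimes> g = x" unfolding f_def g_def using bc x by (simp add: m_assoc inv_mult_group)
  have invf: "f = inv ?W \<otimes> inv b" unfolding f_def using bc by (simp add: inv_mult_group)
  obtain u v w where u: "nearest L f u" and v: "nearest L x v" and w: "nearest L y w"
    using nearest_ex by metis
  note uc = nearest_closed[OF u] and vc = nearest_closed[OF v] and wc = nearest_closed[OF w]
  have nb: "near_one B1 (inv b)" using b by (simp add: good_def)
  have u1: "d u (hp k) \<le> A0"
    using inv_block_nearest[OF _ nb, of k u] u bc k constants unfolding invf by auto
  have v1: "d \<one> v \<le> B3" using x v by (simp add: near_one_def)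
  \<comment> \<open>The second parsing places \<open>b'\<close> almost on a geodesic from
    \<open>\<one>\<close> to \<open>g\<close>.\<close>
  have cut: "d \<one> b' + d b' g \<le> d \<one> g + 2 * B1 + C"
  proof -
    have "d b' g = d \<one> (?W \<otimes> x')"
      unfolding g_def eq using d_translate[of b' \<one> "?W \<otimes> x'"] b'c x' by (simp add: m_assoc)
    then show ?thesis using insertion_length[OF b' x' k] unfolding g_def eq by linarith
  qed
  have tr: "d b' g = d y x" "d \<one> b' = d f y" "d \<one> (b \<otimes> ?W) = d \<one> f"
    using d_translate[of f b' g] d_translate[of f \<one> b'] fc b'c gc fg d_one_inv[of "b \<otimes> ?W"] bc
    by (auto simp: y_def f_def)
  have gl: "d \<one> g \<le> d \<one> (b \<otimes> ?W) + d \<one> x" unfolding g_def using d_one_mult bc x by simp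
  show ?thesis
  proof (cases "d w v > C")
    case True
    \<comment> \<open>The way from \<open>y\<close> to \<open>x\<close> passes near
      \<open>\<one>\<close>, so \<open>d y x\<close> is almost the sum of the lengths of
      \<open>y\<close> and \<open>x\<close>. With \<open>cut\<close> and \<open>le\<close>,
      \<open>y\<close> is at most as long as the block up to a constant, and
      \<open>b' = b \<otimes> (?W \<otimes> y)\<close>.\<close>
    then have "d y w + d w v + d v x \<le> d y x + C"
      using contraction[OF yc x(1) w v] by simp
    moreover have "d \<one> x \<le> d \<one> v + d v x" using d_triangle[OF one_closed vc x(1)] .
    moreover have "d \<one> (b \<otimes> ?W) \<le> d \<one> b + d \<one> ?W" using d_one_mult bc by simp
    moreover have "d \<one> y \<le> d \<one> v + (d w v + d y w)"
      using d_triangle[OF one_closed vc yc] d_triangle[OF vc wc yc] d_commute[OF vc wc] d_commute[OF wc yc]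
      by linarith
    moreover have "d b b' \<le> d \<one> ?W + d \<one> y"
    proof -
      have "b' = b \<otimes> (?W \<otimes> y)"
        unfolding y_def invf using bc b'c by (simp add: m_assoc)
      then have "d b b' = d \<one> (?W \<otimes> y)"
        using d_translate[of b \<one> "?W \<otimes> y"] bc yc by simp
      then show ?thesis using d_one_mult yc by simp
    qed
    ultimately show ?thesis using cut tr gl le v1 constants by linarith
  next
    case False
    \<comment> \<open>Now \<open>y\<close> projects near \<open>\<one>\<close>, so the way from
      \<open>f\<close> to \<open>y\<close> runs along the whole segment from \<open>hp k\<close> to
      \<open>\<one>\<close>. Thus \<open>b'\<close> is longer than \<open>b\<close> and
      \<open>y\<close> together by about the length of \<open>hp k\<close>, although
      \<open>b \<otimes> y\<close> lies in the same coset of \<open>N\<close>.\<close>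
    have w1: "d \<one> w \<le> B3 + C"
      using False v1 d_triangle[OF one_closed vc wc] d_commute[OF vc wc] by linarith
    have uw: "d \<one> (hp k) \<le> d \<one> w + d u w + d u (hp k)"
      using d_triangle[of \<one> w "hp k"] d_triangle[of w u "hp k"] d_commute[of w u] uc wc by simp
    then have "d u w > C" using w1 u1 k constants by linarith
    then have 1: "d f u + d u w + d w y \<le> d f y + C"
      using contraction[OF fc yc u w] by simp
    have 2: "d f (hp k) \<le> d f u + d u (hp k)" using d_triangle[OF fc uc hp_closed] .
    have 3: "d \<one> y \<le> d \<one> w + d w y" using d_triangle[OF one_closed wc yc] .
    have "d f (hp k) = d \<one> (b \<otimes> (hp k \<otimes> m))"
    proof -
      have "d f (hp k) = d \<one> (b \<otimes> ?W \<otimes> hp k)"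
        unfolding f_def using bc by (simp add: d_product)
      also have "b \<otimes> ?W \<otimes> hp k = b \<otimes> (hp k \<otimes> m)"
        unfolding block_def using bc m_closed by (simp add: m_assoc hp_add)
      finally show ?thesis .
    qed
    moreover have "d \<one> (b \<otimes> (hp k \<otimes> m)) \<ge> d \<one> (b \<otimes> hp k) - M"
      using d_one_mult_ge(1)[of "b \<otimes> hp k" m] bc m_closed by (simp add: m_assoc M_def)
    moreover have "d \<one> (b \<otimes> hp k) \<ge> d \<one> b - B1 - C"
    proof -
      obtain p where p: "nearest L (inv b) p" using nearest_ex by blast
      note pc = nearest_closed[OF p]
      have p1: "d \<one> p \<le> B1" using good_inv_nearest[OF b p] .
      then have "d p (hp k) > C"
        using d_triangle[of \<one> p "hp k"] pc k constants by simp
      moreover have "nearest L (hp k) (hp k)" using nearest_ex nearest_self hp_L by metis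
      ultimately have "d (inv b) p + d p (hp k) \<le> d (inv b) (hp k) + C"
        using contraction[of "inv b" "hp k" p "hp k"] bc p by simp
      moreover have "d \<one> (inv b) \<le> d \<one> p + d (inv b) p"
        using d_triangle[of \<one> p "inv b"] d_commute[of p "inv b"] pc bc by simp
      ultimately show ?thesis
        using p1 d_one_inv[OF bc] d_product[OF bc hp_closed, of k] d_nonneg[of p "hp k"] by linarith
    qed
    ultimately have 4: "d f (hp k) \<ge> d \<one> b - B1 - C - M" by linarith
    have "b \<otimes> y = (b \<otimes> inv ?W \<otimes> inv b) \<otimes> b'"
      unfolding y_def invf using bc b'c by (simp add: m_assoc)
    moreover have "b \<otimes> inv ?W \<otimes> inv b \<in> N"
      unfolding block_def by (intro N.inv_op_closed2 bc N.m_inv_closed hp_closed)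
        (use N.inv_op_closed2[OF hp_closed N(2)] hp_inv in simp)
    ultimately have "d \<one> b' \<le> d \<one> (b \<otimes> y) + 2 * M" using min by simp
    then have "d \<one> b' \<le> d \<one> b + d \<one> y + 2 * M" using d_one_mult[OF bc yc] by linarith
    then have False using 1 2 3 4 w1 u1 uw tr(2) k constants by linarith
    then show ?thesis ..
  qed
qed

end

section \<open>Growth rates\<close>

text \<open>By Fekete's lemma this infimum is the limit, for submultiplicative \<open>f\<close>.\<close>
definition growth_rate :: "(nat \<Rightarrow> nat) \<Rightarrow> real" where
  "growth_rate f = (INF n. ln (real (f (Suc n))) / real (Suc n))"

locale submultiplicative =
  fixes f :: "nat \<Rightarrow> nat"
  assumes ge_1: "1 \<le> f n"
    and mono: "m \<le> n \<Longrightarrow> f m \<le> f n"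
    and mult: "f (m + n) \<le> f m * f n"
begin

lemma real_ge_1: "1 \<le> real (f n)"
  using ge_1[of n] by simp

lemma bdd: "bdd_below (range (\<lambda>n. ln (real (f (Suc n))) / real (Suc n)))"
  using real_ge_1 by (intro bdd_belowI[of _ 0]) auto

lemma growth_rate_le: "growth_rate f * real n \<le> ln (real (f n))"
proof (cases n)
  case 0
  then show ?thesis using real_ge_1 by simp
next
  case (Suc k)
  have "growth_rate f \<le> ln (real (f (Suc k))) / real (Suc k)"
    unfolding growth_rate_def using bdd by (intro cINF_lower) auto
  then show ?thesis using Suc by (simp add: field_simps)
qed

lemma exp_growth_rate_le: "exp (growth_rate f * real n) \<le> real (f n)"
  using growth_rate_le[of n] real_ge_1[of n] by (metis exp_le_cancel_iff exp_ln less_le_trans zero_less_one)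

lemma growth_rate_nonneg: "0 \<le> growth_rate f"
  unfolding growth_rate_def using real_ge_1 by (intro cINF_greatest) auto

lemma mult_iter: "f (q * n) \<le> f n ^ q * f 0"
proof (induction q)
  case (Suc q)
  have "f (Suc q * n) \<le> f n * f (q * n)" using mult[of n "q * n"] by simp
  also have "\<dots> \<le> f n * (f n ^ q * f 0)" using Suc by simp
  finally show ?case by (simp add: mult.assoc)
qed simp

text \<open>Fekete's argument: at some index \<open>p\<close> the quotient is already below
  \<open>s\<close>, and \<open>n\<close> splits into copies of \<open>p\<close> and a remainder. The
  remainder and \<open>f 0\<close>, which may exceed 1, go into \<open>K\<close>.\<close>

lemma growth_rate_exp:
  assumes "growth_rate f < s"
  obtains K where "K > 0" "\<And>n. real (f n) \<le> K * exp (s * real n)"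
proof -
  obtain k where k: "ln (real (f (Suc k))) / real (Suc k) < s"
    using assms bdd unfolding growth_rate_def by (subst (asm) cINF_less_iff) auto
  define p where "p = Suc k"
  have p: "p > 0" "ln (real (f p)) \<le> s * real p"
    using k by (simp_all add: p_def field_simps)
  have s: "s \<ge> 0" using assms growth_rate_nonneg by linarith
  have fp: "real (f p) \<le> exp (s * real p)"
    using p(2) real_ge_1[of p] by (metis exp_le_cancel_iff exp_ln less_le_trans zero_less_one)
  define K where "K = real (f 0) * real (f p)"
  have "real (f n) \<le> K * exp (s * real n)" for n
  proof -
    have "f n \<le> f (n div p * p) * f (n mod p)" using mult[of "n div p * p" "n mod p"] by simp
    also have "\<dots> \<le> (f p ^ (n div p) * f 0) * f p"
      using mult_iter mono[of "n mod p" p] p by (intro mult_mono) (auto simp: less_imp_le)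
    finally have "real (f n) \<le> real (f p) ^ (n div p) * K"
      unfolding K_def by (metis (mono_tags) mult.assoc of_nat_le_iff of_nat_mult of_nat_power)
    also have "real (f p) ^ (n div p) \<le> exp (s * real p) ^ (n div p)"
      using fp by (intro power_mono) auto
    also have "\<dots> = exp (s * real (n div p * p))" by (simp add: exp_of_nat_mult[symmetric] mult_ac)
    also have "\<dots> \<le> exp (s * real n)"
    proof -
      have "real (n div p * p) \<le> real n" by (subst of_nat_le_iff) simp
      then show ?thesis using s by (simp add: mult_left_mono)
    qed
    finally show ?thesis using real_ge_1 by (simp add: K_def mult_ac mult_right_mono)
  qed
  moreover have "K > 0" using ge_1 by (simp add: K_def less_le_trans[OF zero_less_one])
  ultimately show ?thesis using that by blast
qed

lemma growth_rate_leI: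
  assumes K: "K > 0" "\<And>n. real (f n) \<le> K * exp (s * real n)"
  shows "growth_rate f \<le> s"
proof (rule ccontr)
  assume "\<not> growth_rate f \<le> s"
  then have e: "growth_rate f - s > 0" by simp
  have le: "(growth_rate f - s) * real n \<le> ln K" for n
  proof -
    have "ln (real (f n)) \<le> ln (K * exp (s * real n))"
      using K(2)[of n] real_ge_1[of n] by (subst ln_le_cancel_iff) auto
    also have "\<dots> = ln K + s * real n" using K(1) by (simp add: ln_mult)
    finally show ?thesis using growth_rate_le[of n] by (simp add: algebra_simps)
  qed
  obtain n :: nat where "ln K / (growth_rate f - s) < real n" using reals_Archimedean2 by blast
  then show False using le[of n] e by (simp add: field_simps)
qed

text \<open>Rounding \<open>r\<close> down costs at most \<open>growth_rate f / r\<close>, and the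
  constant of \<open>growth_rate_exp\<close> costs \<open>ln K / r\<close>; both vanish in the
  limit.\<close>

lemma Limsup_growth_rate:
  "Limsup at_top (\<lambda>r::real. ereal (1 / r * ln (real (f (nat \<lfloor>r\<rfloor>))))) = ereal (growth_rate f)"
proof (rule antisym)
  let ?F = "\<lambda>r::real. ereal (1 / r * ln (real (f (nat \<lfloor>r\<rfloor>))))"
  have "Limsup at_top ?F \<le> ereal (growth_rate f) + ereal e" if "e > 0" for e
  proof -
    obtain K where K: "K > 0" "\<And>n. real (f n) \<le> K * exp ((growth_rate f + e) * real n)"
      using growth_rate_exp[of "growth_rate f + e"] \<open>e > 0\<close> by auto
    have "eventually (\<lambda>r. ?F r \<le> ereal (ln K / r + (growth_rate f + e))) at_top"
      using eventually_gt_at_top[of 0]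
    proof eventually_elim
      case (elim r)
      have "ln (real (f (nat \<lfloor>r\<rfloor>))) \<le> ln (K * exp ((growth_rate f + e) * real (nat \<lfloor>r\<rfloor>)))"
        using K real_ge_1[of "nat \<lfloor>r\<rfloor>"] by (subst ln_le_cancel_iff) auto
      also have "\<dots> = ln K + (growth_rate f + e) * real (nat \<lfloor>r\<rfloor>)" using K(1) by (simp add: ln_mult)
      also have "\<dots> \<le> ln K + (growth_rate f + e) * r"
        using elim growth_rate_nonneg \<open>e > 0\<close> by (intro add_left_mono mult_left_mono) auto
      finally show ?case using elim by (simp add: field_simps)
    qed
    then have 1: "Limsup at_top ?F \<le> Limsup at_top (\<lambda>r. ereal (ln K / r + (growth_rate f + e)))"
      by (rule Limsup_mono)
    have "((\<lambda>r. ln K / r + (growth_rate f + e)) \<longlongrightarrow> 0 + (growth_rate f + e)) at_top"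
      by (rule tendsto_add[OF tendsto_divide_0[OF tendsto_const filterlim_at_top_imp_at_infinity[OF filterlim_ident]] tendsto_const])
    then have "Limsup at_top (\<lambda>r. ereal (ln K / r + (growth_rate f + e))) = ereal (growth_rate f + e)"
      by (intro lim_imp_Limsup) (auto simp: trivial_limit_at_top_linorder)
    then show ?thesis using 1 by simp
  qed
  then show "Limsup at_top ?F \<le> ereal (growth_rate f)"
    by (metis ereal_le_epsilon2)
  have "((\<lambda>r::real. growth_rate f - growth_rate f / r) \<longlongrightarrow> growth_rate f - 0) at_top"
    by (rule tendsto_diff[OF tendsto_const tendsto_divide_0[OF tendsto_const filterlim_at_top_imp_at_infinity[OF filterlim_ident]]])
  then have "ereal (growth_rate f) = Limsup at_top (\<lambda>r::real. ereal (growth_rate f - growth_rate f / r))"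
    by (intro lim_imp_Limsup[symmetric]) (auto simp: trivial_limit_at_top_linorder)
  also have "\<dots> \<le> Limsup at_top ?F"
  proof (rule Limsup_mono)
    show "\<forall>\<^sub>F r in at_top. ereal (growth_rate f - growth_rate f / r) \<le> ?F r"
      using eventually_gt_at_top[of 0]
    proof eventually_elim
      case (elim r)
      have "r - 1 \<le> real (nat \<lfloor>r\<rfloor>)" using elim by linarith
      then have "growth_rate f * (r - 1) \<le> growth_rate f * real (nat \<lfloor>r\<rfloor>)"
        using growth_rate_nonneg by (rule mult_left_mono)
      then have "growth_rate f * (r - 1) \<le> ln (real (f (nat \<lfloor>r\<rfloor>)))"
        using growth_rate_le order_trans by blast
      then have "growth_rate f * (r - 1) / r \<le> 1 / r * ln (real (f (nat \<lfloor>r\<rfloor>)))"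
        using elim divide_right_mono[of _ _ r] by simp
      moreover have "growth_rate f * (r - 1) / r = growth_rate f - growth_rate f / r"
        using elim by (simp add: field_simps)
      ultimately show ?case by simp
    qed
  qed
  finally show "ereal (growth_rate f) \<le> Limsup at_top ?F" .
qed

end

section \<open>Growth of quotients through balls of cosets\<close>

context marked_group
begin

definition coset_ball :: "'a set \<Rightarrow> nat \<Rightarrow> 'a set set" where
  "coset_ball N n = (\<lambda>g. N #> g) ` ball n"

lemma finite_coset_ball: "finite (coset_ball N n)"
  using finite_ball by (simp add: coset_ball_def)

lemma coset_ball_mono: "m \<le> n \<Longrightarrow> coset_ball N m \<subseteq> coset_ball N n"
  using ball_mono by (auto simp: coset_ball_def)

lemma coset_ball_submultiplicative:
  assumes "N \<lhd> G" shows "submultiplicative (\<lambda>n. card (coset_ball N n))"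
proof
  interpret N: normal N G by (rule assms)
  fix m n
  have "coset_ball N m \<noteq> {}" using one_ball by (auto simp: coset_ball_def)
  then show "1 \<le> card (coset_ball N m)"
    using finite_coset_ball by (metis One_nat_def Suc_leI card_gt_0_iff)
  show "card (coset_ball N m) \<le> card (coset_ball N n)" if "m \<le> n"
    using that coset_ball_mono finite_coset_ball by (intro card_mono)
  have "coset_ball N (m + n) \<subseteq> (\<lambda>(x, y). x <#> y) ` (coset_ball N m \<times> coset_ball N n)"
  proof
    fix y assume "y \<in> coset_ball N (m + n)"
    then obtain g where g: "y = N #> g" "g \<in> ball (m + n)" by (auto simp: coset_ball_def)
    then obtain a b where "a \<in> ball m" "b \<in> ball n" "g = a \<otimes> b" using ball_split by blast
    then show "y \<in> (\<lambda>(x, y). x <#> y) ` (coset_ball N m \<times> coset_ball N n)"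
      using g N.rcos_sum[of a b] ball_closed
      by (intro image_eqI[of _ _ "(N #> a, N #> b)"]) (auto simp: coset_ball_def)
  qed
  then have "card (coset_ball N (m + n)) \<le> card (coset_ball N m \<times> coset_ball N n)"
    using finite_coset_ball by (intro surj_card_le) auto
  then show "card (coset_ball N (m + n)) \<le> card (coset_ball N m) * card (coset_ball N n)"
    by (simp add: card_cartesian_product)
qed

text \<open>Distances between group elements are natural numbers, so an infimum of at most
  \<open>r\<close> yields a pair \<open>a\<close>, \<open>b\<close> at distance at most the floor of
  \<open>r\<close>. As \<open>a\<close> lies in \<open>N\<close>, the element
  \<open>inv a \<otimes> b\<close> still represents \<open>A\<close>.\<close>

lemma coset_dist_le_iff:
  assumes N: "N \<lhd> G" and A: "A \<in> rcosets N" and r: "r \<ge> 0"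
  shows "coset_dist D (cayley_act G S) (vtx \<one>) N A \<le> r \<longleftrightarrow> A \<in> coset_ball N (nat \<lfloor>r\<rfloor>)"
proof -
  interpret N: normal N G by (rule N)
  obtain g where g: "g \<in> carrier G" "A = N #> g" using A by (auto simp: RCOSETS_def)
  have Ac: "A \<subseteq> carrier G" using g N.subset r_coset_subset_G by blast
  have 1: "coset_dist D (cayley_act G S) (vtx \<one>) N A = (INF (a, b)\<in>N \<times> A. d a b)"
  proof -
    have "D (cayley_act G S a (vtx \<one>)) (cayley_act G S b (vtx \<one>)) = d a b"
      if "a \<in> N" "b \<in> A" for a b
    proof -
      have "a \<in> carrier G" "b \<in> carrier G" using that Ac by auto
      then show ?thesis by (simp add: act_vertex D_vertex)
    qed
    then show ?thesis
      unfolding coset_dist_def by (intro INF_cong) auto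
  qed
  have bdd: "bdd_below ((\<lambda>(a, b). d a b) ` (N \<times> A))" by (intro bdd_belowI[of _ 0]) auto
  show ?thesis
  proof
    assume "coset_dist D (cayley_act G S) (vtx \<one>) N A \<le> r"
    then have "(INF (a, b)\<in>N \<times> A. d a b) < real (nat \<lfloor>r\<rfloor>) + 1"
      using 1 r by (simp add: order.strict_trans1)
    moreover have "N \<times> A \<noteq> {}" using g rcos_self[OF g(1) N.subgroup_axioms] N.one_closed by blast
    ultimately obtain a b where ab: "a \<in> N" "b \<in> A" "d a b < real (nat \<lfloor>r\<rfloor>) + 1"
      using bdd by (subst (asm) cINF_less_iff) auto
    have bc: "b \<in> carrier G" using ab Ac by blast
    have "len (inv a \<otimes> b) \<le> nat \<lfloor>r\<rfloor>" using ab(3) unfolding wdist_def by linarith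
    then have "inv a \<otimes> b \<in> ball (nat \<lfloor>r\<rfloor>)" using ab(1) bc len_le_iff by simp
    moreover have "A = N #> (inv a \<otimes> b)"
    proof -
      have "N #> (inv a \<otimes> b) = N #> inv a #> b"
        using ab(1) bc by (simp add: coset_mult_assoc N.subset)
      also have "N #> inv a = N" using ab(1) by (simp add: coset_join2 N.subgroup_axioms)
      also have "N #> b = A" using ab(2) g repr_independence[OF _ g(1) N.subgroup_axioms] by simp
      finally show ?thesis ..
    qed
    ultimately show "A \<in> coset_ball N (nat \<lfloor>r\<rfloor>)" by (auto simp: coset_ball_def)
  next
    assume "A \<in> coset_ball N (nat \<lfloor>r\<rfloor>)"
    then obtain b where b: "A = N #> b" "b \<in> ball (nat \<lfloor>r\<rfloor>)" by (auto simp: coset_ball_def)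
    have bc: "b \<in> carrier G" using b ball_closed by blast
    then have "b \<in> A" using b rcos_self N.subgroup_axioms by blast
    then have "(INF (a, b)\<in>N \<times> A. d a b) \<le> d \<one> b"
      using bdd N.one_closed cINF_lower[OF bdd, of "(\<one>, b)"] by simp
    also have "\<dots> \<le> r" using b bc len_le_iff[OF bc, of "nat \<lfloor>r\<rfloor>"] r by (simp add: d_one le_nat_iff le_floor_iff)
    finally show "coset_dist D (cayley_act G S) (vtx \<one>) N A \<le> r" using 1 by simp
  qed
qed

lemma quotient_growth_eq:
  assumes N: "N \<lhd> G"
  shows "quotient_growth G D (cayley_act G S) (vtx \<one>) N
    = ereal (growth_rate (\<lambda>n. card (coset_ball N n)))"
proof -
  interpret submultiplicative "\<lambda>n. card (coset_ball N n)" using coset_ball_submultiplicative[OF N] .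
  have sub: "coset_ball N n \<subseteq> rcosets N" for n
    using ball_closed by (auto simp: coset_ball_def RCOSETS_def)
  have "{A \<in> rcosets N. coset_dist D (cayley_act G S) (vtx \<one>) N A \<le> r} = coset_ball N (nat \<lfloor>r\<rfloor>)"
    if "r > 0" for r
    using coset_dist_le_iff[OF N, of _ r] sub that by auto
  then have "\<forall>\<^sub>F r in at_top. ereal (1 / r * ln (real (card {A \<in> carrier (G Mod N).
        coset_dist D (cayley_act G S) (vtx \<one>) N A \<le> r})))
      = ereal (1 / r * ln (real (card (coset_ball N (nat \<lfloor>r\<rfloor>)))))"
    by (intro eventually_mono[OF eventually_gt_at_top[of 0]]) (simp add: FactGroup_def)
  then show ?thesis
    unfolding quotient_growth_def growth_exponent_def Limsup_growth_rate[symmetric] by (rule Limsup_eq)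
qed

lemma trivial_normal: "{\<one>} \<lhd> G"
  using one_is_normal .

lemma card_coset_ball_trivial: "card (coset_ball {\<one>} n) = card (ball n)"
proof -
  have "inj_on (\<lambda>g. {\<one>} #> g) (ball n)"
    using ball_closed by (auto intro!: inj_onI simp: r_coset_def)
  then show ?thesis by (simp add: coset_ball_def card_image)
qed

lemma ball_submultiplicative: "submultiplicative (\<lambda>n. card (ball n))"
  using coset_ball_submultiplicative[OF trivial_normal] by (simp add: card_coset_ball_trivial)

lemma growth_tight_iff:
  "cayley_growth_tight G S \<longleftrightarrow>
    (\<forall>N. N \<lhd> G \<and> infinite N \<longrightarrow> growth_rate (\<lambda>n. card (coset_ball N n)) < growth_rate (\<lambda>n. card (ball n)))"
  unfolding cayley_growth_tight_def growth_tight_def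
  by (auto simp: quotient_growth_eq trivial_normal card_coset_ball_trivial)

end

section \<open>Exponential sums and the counting of parsings\<close>

context marked_group
begin

text \<open>With \<open>s'\<close> strictly between the growth rate and \<open>s\<close>, grouping
  by length bounds the sum by a geometric series of ratio \<open>exp (s' - s)\<close>.\<close>

lemma poincare_bounded:
  assumes s: "growth_rate (\<lambda>n. card (ball n)) < s"
  obtains Z where "\<And>F. \<lbrakk>finite F; F \<subseteq> carrier G\<rbrakk> \<Longrightarrow> (\<Sum>g\<in>F. exp (- s * real (len g))) \<le> Z"
proof -
  interpret submultiplicative "\<lambda>n. card (ball n)" by (rule ball_submultiplicative)
  obtain s' where s': "growth_rate (\<lambda>n. card (ball n)) < s'" "s' < s" using dense[OF s] by blast
  obtain K where K: "K > 0" "\<And>n. real (card (ball n)) \<le> K * exp (s' * real n)"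
    using growth_rate_exp[OF s'(1)] by blast
  define q where "q = exp (s' - s)"
  have q: "0 < q" "q < 1" using s' by (auto simp: q_def)
  have "(\<Sum>g\<in>F. exp (- s * real (len g))) \<le> K / (1 - q)" if F: "finite F" "F \<subseteq> carrier G" for F
  proof -
    have "(\<Sum>g\<in>F. exp (- s * real (len g))) = (\<Sum>n\<in>len ` F. \<Sum>g\<in>{g \<in> F. len g = n}. exp (- s * real (len g)))"
      using F by (intro sum.image_gen)
    also have "\<dots> \<le> (\<Sum>n\<in>len ` F. K * q ^ n)"
    proof (rule sum_mono)
      fix n
      have "{g \<in> F. len g = n} \<subseteq> ball n" using F len_le_iff by auto
      then have c: "real (card {g \<in> F. len g = n}) \<le> K * exp (s' * real n)"
        using card_mono[OF finite_ball] K(2)[of n] by (meson of_nat_le_iff order_trans)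
      have "(\<Sum>g\<in>{g \<in> F. len g = n}. exp (- s * real (len g))) = real (card {g \<in> F. len g = n}) * exp (- s * real n)"
        by simp
      also have "\<dots> \<le> (K * exp (s' * real n)) * exp (- s * real n)"
        using c by (rule mult_right_mono) simp
      also have "\<dots> = K * q ^ n"
        by (simp add: q_def exp_of_nat_mult[symmetric] exp_add[symmetric] algebra_simps)
      finally show "(\<Sum>g\<in>{g \<in> F. len g = n}. exp (- s * real (len g))) \<le> K * q ^ n" .
    qed
    also have "\<dots> \<le> (\<Sum>n. K * q ^ n)"
      using F K q by (intro sum_le_suminf summable_mult summable_geometric) auto
    also have "\<dots> = K / (1 - q)"
      using q by (simp add: suminf_mult summable_geometric suminf_geometric)
    finally show ?thesis .
  qed
  then show ?thesis using that by blast
qed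

primrec products :: "'a set \<Rightarrow> nat \<Rightarrow> 'a set" where
  "products F 0 = {\<one>}"
| "products F (Suc t) = (\<lambda>(u, x). u \<otimes> x) ` (F \<times> products F t)"

text \<open>The number \<open>\<beta>\<close> bounds the choices for the first factor when a product of elements of \<open>F\<close> is
  parsed from the left, so the sum over products of length \<open>t\<close> is at least the \<open>t\<close>-th power of the
  sum over \<open>F\<close> divided by \<open>\<beta>\<close>.\<close>
lemma parsing_bound:
  fixes \<beta> :: nat
  assumes F: "finite F" "F \<subseteq> carrier G"
    and P: "P \<one>" "\<And>u x. \<lbrakk>u \<in> F; x \<in> carrier G; P x\<rbrakk> \<Longrightarrow> P (u \<otimes> x)"
    and \<beta>: "\<And>g. card {u \<in> F. \<exists>x\<in>carrier G. P x \<and> u \<otimes> x = g} \<le> \<beta>"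
    and s: "growth_rate (\<lambda>n. card (ball n)) < s" "0 \<le> s"
  shows "(\<Sum>u\<in>F. exp (- s * real (len u))) \<le> \<beta>"
proof (rule ccontr)
  let ?e = "\<lambda>g. exp (- s * real (len g))"
  let ?P = "\<Sum>u\<in>F. ?e u"
  let ?Z = "\<lambda>t. \<Sum>g\<in>products F t. ?e g"
  assume "\<not> ?P \<le> real \<beta>"
  then have big: "?P > real \<beta>" by simp
  have prod: "finite (products F t)" "products F t \<subseteq> {x \<in> carrier G. P x}" for t
    using F P by (induction t) auto
  obtain Z where Z: "\<And>F. \<lbrakk>finite F; F \<subseteq> carrier G\<rbrakk> \<Longrightarrow> (\<Sum>g\<in>F. ?e g) \<le> Z"
    using poincare_bounded[OF s(1)] by blast
  have step: "?P * ?Z t \<le> real \<beta> * ?Z (Suc t)" for t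
  proof -
    let ?A = "F \<times> products F t"
    have finA: "finite ?A" using F prod by simp
    have "?P * ?Z t = (\<Sum>(u, x)\<in>?A. ?e u * ?e x)"
      by (simp add: sum_product sum.cartesian_product)
    also have "\<dots> \<le> (\<Sum>(u, x)\<in>?A. ?e (u \<otimes> x))"
    proof (rule sum_mono, clarify)
      fix u x assume "u \<in> F" "x \<in> products F t"
      then have "len (u \<otimes> x) \<le> len u + len x" using F prod by (intro len_mult) auto
      then have "s * real (len (u \<otimes> x)) \<le> s * (real (len u) + real (len x))"
        using s(2) by (intro mult_left_mono) auto
      then show "?e u * ?e x \<le> ?e (u \<otimes> x)"
        by (simp add: exp_add[symmetric] distrib_left)
    qed
    also have "\<dots> = (\<Sum>a\<in>?A. ?e ((\<lambda>(u, x). u \<otimes> x) a))" by (simp add: case_prod_beta)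
    also have "\<dots> = (\<Sum>g\<in>products F (Suc t). \<Sum>a\<in>{a \<in> ?A. (\<lambda>(u, x). u \<otimes> x) a = g}. ?e ((\<lambda>(u, x). u \<otimes> x) a))"
      unfolding products.simps using finA by (intro sum.image_gen)
    also have "\<dots> \<le> (\<Sum>g\<in>products F (Suc t). real \<beta> * ?e g)"
    proof (rule sum_mono)
      fix g
      let ?B = "{a \<in> ?A. (\<lambda>(u, x). u \<otimes> x) a = g}"
      have "(\<Sum>a\<in>?B. ?e ((\<lambda>(u, x). u \<otimes> x) a)) = real (card ?B) * ?e g" by simp
      moreover have "card ?B \<le> card {u \<in> F. \<exists>x\<in>carrier G. P x \<and> u \<otimes> x = g}"
      proof (rule card_inj_on_le)
        \<comment> \<open>By cancellation the first factor determines the second, so counting first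
          factors counts all pairs with product \<open>g\<close>.\<close>
        show "inj_on fst ?B"
        proof (rule inj_onI, clarify)
          fix a b a' b'
          assume *: "fst (a, b) = fst (a', b')" "a \<in> F" "b \<in> products F t" "a' \<in> F" "b' \<in> products F t"
            "g = a \<otimes> b" "a' \<otimes> b' = a \<otimes> b"
          then have "b \<in> carrier G" "b' \<in> carrier G" "a \<in> carrier G" using F prod by auto
          then show "a = a' \<and> b = b'" using * by simp
        qed
        show "fst ` ?B \<subseteq> {u \<in> F. \<exists>x\<in>carrier G. P x \<and> u \<otimes> x = g}"
          using prod by force
      qed (use F in simp)
      then have "real (card ?B) \<le> real \<beta>" using \<beta>[of g] by linarith
      ultimately show "(\<Sum>a\<in>?B. ?e ((\<lambda>(u, x). u \<otimes> x) a)) \<le> real \<beta> * ?e g"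
        by (simp add: mult_right_mono)
    qed
    also have "\<dots> = real \<beta> * ?Z (Suc t)" by (simp add: sum_distrib_left)
    finally show ?thesis .
  qed
  have "?P ^ t \<le> real \<beta> ^ t * ?Z t" for t
  proof (induction t)
    case (Suc t)
    have "?P ^ Suc t \<le> ?P * (real \<beta> ^ t * ?Z t)"
      using Suc by (simp add: mult_left_mono sum_nonneg)
    also have "\<dots> = real \<beta> ^ t * (?P * ?Z t)" by simp
    also have "\<dots> \<le> real \<beta> ^ t * (real \<beta> * ?Z (Suc t))" using step by (intro mult_left_mono) auto
    finally show ?case by (simp only: power_Suc mult_ac)
  qed simp
  moreover have "real \<beta> ^ t * ?Z t \<le> real \<beta> ^ t * Z" for t
    using Z prod by (intro mult_left_mono) auto
  ultimately have le: "?P ^ t \<le> real \<beta> ^ t * Z" for t using order_trans by blast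
  show False
  proof (cases "\<beta> = 0")
    case True
    then show False using le[of 1] big by simp
  next
    case False
    have "1 < ?P / \<beta>" using big False by simp
    then obtain t where "Z < (?P / \<beta>) ^ t" using real_arch_pow by blast
    then show False using le[of t] False by (simp add: power_divide field_simps)
  qed
qed

end

section \<open>Positive growth, and divergence against the parsing bound\<close>

context transverse
begin

lemma hp_block_large: obtains k where "d \<one> (hp k) > R"
  using hp_large[of 1 R] by (force simp: d_one)

lemma good_ex: obtains b where "good b"
proof -
  obtain k where "d \<one> (hp k) > 2 * B1 + C + 2 * M" using hp_block_large .
  then show ?thesis using good_exists[OF hp_closed] that by blast
qed

text \<open>Two words with sufficiently different blocks form an alphabet that parses uniquely. If
  the growth rate were 0, \<open>parsing_bound\<close> with bound 1 would hold for every positive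
  \<open>s\<close>, but for small \<open>s\<close> two summands near 1 exceed it.\<close>

lemma growth_rate_pos: "0 < growth_rate (\<lambda>n. card (ball n))"
proof (rule ccontr)
  assume "\<not> 0 < growth_rate (\<lambda>n. card (ball n))"
  then have \<gamma>: "growth_rate (\<lambda>n. card (ball n)) \<le> 0" by simp
  obtain b where b: "good b" using good_ex .
  have bc: "b \<in> carrier G" using b by (simp add: good_def)
  obtain i where i: "d \<one> (hp i) > K0" using hp_block_large .
  \<comment> \<open>This separates \<open>hp i\<close> and \<open>hp j\<close> by more than
    \<open>2 * A0\<close>, so no point projects within \<open>A0\<close> of both.\<close>
  obtain j where j: "d \<one> (hp j) > K0 + d \<one> (hp i) + 2 * A0" using hp_block_large .
  have j': "d \<one> (hp j) > K0" using j constants d_nonneg[of \<one> "hp i"] by linarith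
  have ne: "b \<otimes> block i \<otimes> x \<noteq> b \<otimes> block j \<otimes> y"
    if x: "x \<in> carrier G" "near_one B3 x" and y: "y \<in> carrier G" "near_one B3 y" for x y
  proof
    assume "b \<otimes> block i \<otimes> x = b \<otimes> block j \<otimes> y"
    then have eq: "block i \<otimes> x = block j \<otimes> y" using x y bc by (simp add: m_assoc)
    obtain p where p: "nearest L (block i \<otimes> x) p" using nearest_ex by blast
    note pc = nearest_closed[OF p]
    have "d p (hp i) \<le> A0" using block_nearest[OF x _ p] i constants by linarith
    moreover have "d p (hp j) \<le> A0" using block_nearest[OF y] p eq j' constants by auto
    ultimately show False
      using j constants d_triangle[of \<one> "hp i" "hp j"] d_triangle[of "hp i" p "hp j"] d_commute[of "hp i" p] pc
      by simp
  qed
  let ?F = "{b \<otimes> block i, b \<otimes> block j}"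
  have distinct: "b \<otimes> block i \<noteq> b \<otimes> block j"
    using ne[of \<one> \<one>] near_one_one[of B3] constants bc by auto
  have sum: "(\<Sum>u\<in>?F. exp (- s * real (len u))) \<le> real 1" if s: "0 < s" for s
  proof (rule parsing_bound[where P = "near_one B3"])
    show "near_one B3 \<one>" using constants by (intro near_one_one) auto
    show "near_one B3 (u \<otimes> x)" if "u \<in> ?F" "x \<in> carrier G" "near_one B3 x" for u x
      using insertion_near_one[OF b that(2,3)] i j' that(1) by auto
    show "card {u \<in> ?F. \<exists>x\<in>carrier G. near_one B3 x \<and> u \<otimes> x = g} \<le> 1" for g
    proof -
      have "{u \<in> ?F. \<exists>x\<in>carrier G. near_one B3 x \<and> u \<otimes> x = g} \<subseteq> {b \<otimes> block i} \<or>
        {u \<in> ?F. \<exists>x\<in>carrier G. near_one B3 x \<and> u \<otimes> x = g} \<subseteq> {b \<otimes> block j}"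
        using ne by blast
      then show ?thesis
        using card_mono[of "{b \<otimes> block i}"] card_mono[of "{b \<otimes> block j}"] by (elim disjE) force+
    qed
  qed (use s \<gamma> bc in auto)
  define l where "l = real (max (len (b \<otimes> block i)) (len (b \<otimes> block j)))"
  \<comment> \<open>With \<open>s * l < 1 / 2\<close>, the inequality
    \<open>exp x \<ge> 1 + x\<close> makes each of the two summands exceed
    \<open>1 / 2\<close>.\<close>
  define s where "s = 1 / (2 * l + 4)"
  have l: "l \<ge> 0" by (simp add: l_def)
  have s: "s > 0" "s * l < 1 / 2" using l by (auto simp: s_def field_simps)
  have "1 / 2 < exp (- s * real (len u))" if "u \<in> ?F" for u
  proof -
    have "real (len u) \<le> l" using that by (auto simp: l_def)
    then have "s * real (len u) \<le> s * l" using s by (intro mult_left_mono) auto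
    then have "1 / 2 < exp (- (s * real (len u)))"
      using s exp_ge_add_one_self[of "- (s * real (len u))"] by linarith
    then show ?thesis by simp
  qed
  from this[of "b \<otimes> block i"] this[of "b \<otimes> block j"]
  have "1 < (\<Sum>u\<in>?F. exp (- s * real (len u)))"
    using distinct by simp
  then show False using sum[OF s(1)] by simp
qed

end

text \<open>Bounded partial sums leave a tail of at most \<open>1 / 2\<close> beyond some fixed
  \<open>Y N\<close>. An element of \<open>Y n\<close> contributes at least
  \<open>exp (- \<gamma> * n)\<close>, so \<open>Y n - Y N\<close> has at most half of
  \<open>exp (\<gamma> * n)\<close> elements; the other half would have to fit into
  \<open>Y N\<close> for all \<open>n\<close>.\<close>

lemma bounded_partial_sums_growth:
  fixes Y :: "nat \<Rightarrow> 'c set" and l :: "'c \<Rightarrow> nat"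
  assumes fin: "\<And>n. finite (Y n)" and Y: "\<And>n y. y \<in> Y n \<longleftrightarrow> y \<in> X \<and> l y \<le> n" and \<gamma>: "\<gamma> > 0"
    and lower: "\<And>n. exp (\<gamma> * real n) \<le> real (card (Y n))"
    and bound: "\<And>n. (\<Sum>y\<in>Y n - Y p. exp (- \<gamma> * real (l y))) \<le> \<beta>"
  shows False
proof -
  let ?S = "\<lambda>n. \<Sum>y\<in>Y n - Y p. exp (- \<gamma> * real (l y))"
  have bdd: "bdd_above (range ?S)" using bound by (intro bdd_aboveI[of _ \<beta>]) auto
  obtain k where k: "Sup (range ?S) - 1 / 2 < ?S k"
    using less_cSup_iff[OF _ bdd, of "Sup (range ?S) - 1 / 2"] by auto
  define N where "N = max k p"
  have mono: "Y m \<subseteq> Y n" if "m \<le> n" for m n using that Y by force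
  have "exp (\<gamma> * real n) \<le> 2 * real (card (Y N))" if n: "n \<ge> N" for n
  proof -
    have sub: "Y k \<subseteq> Y N" "Y p \<subseteq> Y N" "Y N \<subseteq> Y n"
      using mono n by (auto simp: N_def)
    have "?S k + (\<Sum>y\<in>Y n - Y N. exp (- \<gamma> * real (l y))) = (\<Sum>y\<in>(Y k - Y p) \<union> (Y n - Y N). exp (- \<gamma> * real (l y)))"
      using fin sub by (intro sum.union_disjoint[symmetric]) auto
    also have "\<dots> \<le> ?S n" using fin sub by (intro sum_mono2) auto
    also have "\<dots> \<le> Sup (range ?S)" using bdd by (intro cSup_upper) auto
    finally have small: "(\<Sum>y\<in>Y n - Y N. exp (- \<gamma> * real (l y))) \<le> 1 / 2" using k by linarith
    have "real (card (Y n - Y N)) * exp (- \<gamma> * real n) = (\<Sum>y\<in>Y n - Y N. exp (- \<gamma> * real n))" by simp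
    also have "\<dots> \<le> (\<Sum>y\<in>Y n - Y N. exp (- \<gamma> * real (l y)))"
      using Y \<gamma> by (intro sum_mono) auto
    finally have "real (card (Y n - Y N)) * exp (- \<gamma> * real n) \<le> 1 / 2" using small by linarith
    then have "real (card (Y n - Y N)) * exp (- \<gamma> * real n) * exp (\<gamma> * real n) \<le> 1 / 2 * exp (\<gamma> * real n)"
      by (intro mult_right_mono) auto
    then have "real (card (Y n - Y N)) \<le> exp (\<gamma> * real n) / 2"
      by (simp add: mult.assoc exp_add[symmetric])
    moreover have "card (Y n) = card (Y n - Y N) + card (Y N)"
      using sub fin by (simp add: card_Diff_subset card_mono)
    ultimately show ?thesis using lower[of n] by simp
  qed
  note le = this
  have "\<gamma> * real n \<le> ln (2 * real (card (Y N)))" if "n \<ge> N" for n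
    using le[OF that] by (metis exp_gt_zero less_le_trans ln_exp ln_le_cancel_iff)
  moreover obtain n :: nat where n: "ln (2 * real (card (Y N))) / \<gamma> < real n" using reals_Archimedean2 by blast
  ultimately have "\<gamma> * real (max n N) \<le> ln (2 * real (card (Y N)))" by simp
  moreover have "\<gamma> * real n \<le> \<gamma> * real (max n N)" using \<gamma> by (intro mult_left_mono) auto
  moreover have "ln (2 * real (card (Y N))) < \<gamma> * real n" using n \<gamma> by (simp add: field_simps)
  ultimately show False by linarith
qed

context transverse
begin

theorem transverse_quotient_growth_less:
  assumes N: "N \<lhd> G" and mN: "m \<in> N"
  shows "growth_rate (\<lambda>n. card (coset_ball N n)) < growth_rate (\<lambda>n. card (ball n))"
proof (rule ccontr)
  define \<gamma> where "\<gamma> = growth_rate (\<lambda>n. card (coset_ball N n))"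
  assume "\<not> ?thesis"
  then have \<gamma>: "growth_rate (\<lambda>n. card (ball n)) \<le> \<gamma>" by (simp add: \<gamma>_def)
  then have \<gamma>0: "\<gamma> > 0" using growth_rate_pos by linarith
  interpret N: normal N G by (rule N)
  interpret Q: submultiplicative "\<lambda>n. card (coset_ball N n)" using coset_ball_submultiplicative[OF N] .
  obtain k where k: "d \<one> (hp k) > K0" using hp_block_large .
  let ?W = "block k"
  \<comment> \<open>\<open>\<beta>\<close> is the size of a ball with the radius of
    \<open>insertion_separation\<close>, \<open>\<kappa>\<close> bounds the length added by the two
    corrections and the block, and cosets of length above \<open>l0\<close> are within reach of
    \<open>good_exists\<close>.\<close>
  define \<beta> where "\<beta> = card (ball (nat \<lfloor>2 * d \<one> ?W + K0\<rfloor>))"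
  define \<kappa> where "\<kappa> = 2 * M + d \<one> ?W"
  define l0 where "l0 = nat \<lceil>2 * B1 + C + 2 * M\<rceil>"
  define Y where "Y = {y. \<exists>n. y \<in> coset_ball N n}"
  define l where "l y = (if y \<in> Y then LEAST n. y \<in> coset_ball N n else 0)" for y
  have l: "y \<in> coset_ball N n \<longleftrightarrow> y \<in> Y \<and> l y \<le> n" for y n
    unfolding l_def Y_def using coset_ball_mono by (auto intro: Least_le) (metis LeastI subsetD)
  have "\<exists>b. good b \<and> N #> b = y \<and> d \<one> b \<le> real (l y) + 2 * M \<and> (\<forall>n\<in>N. d \<one> b \<le> d \<one> (n \<otimes> b) + 2 * M)"
    if y: "y \<in> Y" "l y > l0" for y
  proof -
    have "y \<in> coset_ball N (l y)" using l y by blast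
    then obtain a where a: "y = N #> a" "a \<in> ball (l y)" by (auto simp: coset_ball_def)
    have ac: "a \<in> carrier G" using a ball_closed by blast
    have min: "l y \<le> len z" if "z \<in> carrier G" "N #> z = y" for z
      using that l len_le_iff[of z "len z"] by (auto simp: coset_ball_def)
    have la: "len a = l y" using min[OF ac] a len_le_iff[OF ac] by (simp add: antisym)
    have "d \<one> a > 2 * B1 + C + 2 * M"
      using y(2) la ac unfolding l0_def by (simp add: d_one) linarith
    then obtain c c' where c: "c \<in> {\<one>, inv m}" "c' \<in> {\<one>, m}" "good (c \<otimes> a \<otimes> c')"
      using good_exists[OF ac] by blast
    let ?b = "c \<otimes> a \<otimes> c'"
    have cN: "c \<in> N" "c' \<in> N" using c mN by auto
    have cc: "c \<in> carrier G" "c' \<in> carrier G" "d \<one> c \<le> M" "d \<one> c' \<le> M"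
      using cN c constants d_one_inv m_closed by (auto simp: M_def)
    have bc: "?b \<in> carrier G" using cc ac by simp
    have coset: "N #> ?b = y"
    proof -
      \<comment> \<open>The right correction is moved to the left of \<open>a\<close> by conjugation
        and thus stays in \<open>N\<close>.\<close>
      have "N #> ?b = N #> (c \<otimes> (a \<otimes> c' \<otimes> inv a) \<otimes> a)" using cc ac by (simp add: m_assoc)
      also have "\<dots> = N #> (c \<otimes> (a \<otimes> c' \<otimes> inv a)) #> a"
        using cc ac by (simp add: coset_mult_assoc N.subset)
      also have "N #> (c \<otimes> (a \<otimes> c' \<otimes> inv a)) = N"
        using cN N.inv_op_closed2[OF ac] cc ac by (intro coset_join2 N.subgroup_axioms) auto
      finally show ?thesis using a by simp
    qed
    have len_b: "d \<one> ?b \<le> real (l y) + 2 * M"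
      using d_one_mult[of "c \<otimes> a" c'] d_one_mult[of c a] cc ac la d_one[OF ac] by simp
    have "d \<one> ?b \<le> d \<one> (n \<otimes> ?b) + 2 * M" if n: "n \<in> N" for n
    proof -
      have "N #> (n \<otimes> ?b) = N #> n #> ?b" using n bc by (simp add: coset_mult_assoc N.subset)
      also have "\<dots> = y" using n coset by (simp add: coset_join2 N.subgroup_axioms)
      finally have "real (l y) \<le> d \<one> (n \<otimes> ?b)" using min[of "n \<otimes> ?b"] n bc by (simp add: d_one)
      then show ?thesis using len_b by linarith
    qed
    then show ?thesis using c(3) coset len_b by blast
  qed
  then obtain \<phi> where \<phi>: "\<And>y. \<lbrakk>y \<in> Y; l y > l0\<rbrakk> \<Longrightarrow> good (\<phi> y) \<and> N #> \<phi> y = y \<and>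
      d \<one> (\<phi> y) \<le> real (l y) + 2 * M \<and> (\<forall>n\<in>N. d \<one> (\<phi> y) \<le> d \<one> (n \<otimes> \<phi> y) + 2 * M)"
    by metis
  define A where "A n = coset_ball N n - coset_ball N l0" for n
  have A: "y \<in> Y" "l y > l0" if "y \<in> A n" for y n using that l by (auto simp: A_def not_le)
  have finA: "finite (A n)" for n using finite_coset_ball by (simp add: A_def)
  have \<phi>c: "\<phi> y \<in> carrier G" if "y \<in> A n" for y n using \<phi>[OF A[OF that]] by (simp add: good_def)
  have sum_le: "(\<Sum>y\<in>A n. exp (- s * (real (l y) + \<kappa>))) \<le> real \<beta>" if s: "\<gamma> < s" for n s
  proof -
    let ?u = "\<lambda>y. \<phi> y \<otimes> ?W"
    have "inj_on ?u (A n)"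
    proof (rule inj_onI)
      fix y z assume yz: "y \<in> A n" "z \<in> A n" "?u y = ?u z"
      then have "\<phi> y = \<phi> z" using \<phi>c by simp
      then show "y = z" using \<phi> A yz by metis
    qed
    then have "(\<Sum>u\<in>?u ` A n. exp (- s * real (len u))) = (\<Sum>y\<in>A n. exp (- s * real (len (?u y))))"
      by (simp add: sum.reindex)
    also have "\<dots> \<ge> (\<Sum>y\<in>A n. exp (- s * (real (l y) + \<kappa>)))"
    proof (rule sum_mono)
      fix y assume y: "y \<in> A n"
      have "d \<one> (?u y) \<le> real (l y) + \<kappa>"
        using d_one_mult[OF \<phi>c[OF y] block_closed[of k]] \<phi>[OF A[OF y]] unfolding \<kappa>_def by linarith
      then have "s * real (len (?u y)) \<le> s * (real (l y) + \<kappa>)"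
        using s \<gamma>0 \<phi>c[OF y] by (intro mult_left_mono) (auto simp: d_one)
      then show "exp (- s * (real (l y) + \<kappa>)) \<le> exp (- s * real (len (?u y)))" by simp
    qed
    finally have 1: "(\<Sum>y\<in>A n. exp (- s * (real (l y) + \<kappa>))) \<le> (\<Sum>u\<in>?u ` A n. exp (- s * real (len u)))" .
    have "(\<Sum>u\<in>?u ` A n. exp (- s * real (len u))) \<le> real \<beta>"
    proof (rule parsing_bound[where P = "near_one B3"])
      show "finite (?u ` A n)" using finA by simp
      show "?u ` A n \<subseteq> carrier G" using \<phi>c by auto
      show "near_one B3 \<one>" using constants by (intro near_one_one) auto
      show "near_one B3 (u \<otimes> x)" if "u \<in> ?u ` A n" "x \<in> carrier G" "near_one B3 x" for u x
        using insertion_near_one[OF _ that(2,3) k] \<phi> A that(1) by blast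
      show "growth_rate (\<lambda>n. card (ball n)) < s" "0 \<le> s" using s \<gamma> \<gamma>0 by auto
      fix g
      let ?U = "{u \<in> ?u ` A n. \<exists>x\<in>carrier G. near_one B3 x \<and> u \<otimes> x = g}"
      show "card ?U \<le> \<beta>"
      proof (cases "?U = {}")
        case True
        then show ?thesis by (simp only: card.empty)
      next
        case False
        then obtain y0 x0 where y0: "y0 \<in> A n" "x0 \<in> carrier G" "near_one B3 x0" "?u y0 \<otimes> x0 = g" by blast
        let ?b0 = "\<phi> y0"
        \<comment> \<open>One parsing of \<open>g\<close> is fixed and all others are compared with
          it; the case split puts the shorter factor first, as \<open>insertion_separation\<close>
          demands.\<close>
        have close: "d ?b0 (\<phi> y) \<le> 2 * d \<one> ?W + K0"
          if y: "y \<in> A n" and x: "x \<in> carrier G" "near_one B3 x" "?u y \<otimes> x = g" for y x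
        proof (cases "d \<one> ?b0 \<le> d \<one> (\<phi> y)")
          case True
          then show ?thesis
            using insertion_separation[OF N mN _ _ y0(2,3) x(1,2) k] y0 x \<phi>[OF A[OF y]] \<phi>[OF A[OF y0(1)]] by auto
        next
          case False
          then have "d (\<phi> y) ?b0 \<le> 2 * d \<one> ?W + K0"
            using insertion_separation[OF N mN _ _ x(1,2) y0(2,3) k] y0 x \<phi>[OF A[OF y]] \<phi>[OF A[OF y0(1)]] by auto
          then show ?thesis using d_commute[OF \<phi>c[OF y] \<phi>c[OF y0(1)]] by simp
        qed
        have b0c: "?b0 \<in> carrier G" using \<phi>c[OF y0(1)] .
        have Uc: "?U \<subseteq> carrier G" using \<phi>c by auto
        show ?thesis unfolding \<beta>_def
        proof (rule card_inj_on_le[OF _ _ finite_ball])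
          show "inj_on (\<lambda>u. inv ?b0 \<otimes> u \<otimes> inv ?W) ?U"
          proof (rule inj_onI)
            fix u v assume uv: "u \<in> ?U" "v \<in> ?U" "inv ?b0 \<otimes> u \<otimes> inv ?W = inv ?b0 \<otimes> v \<otimes> inv ?W"
            have "u \<in> carrier G" "v \<in> carrier G" using uv Uc by blast+
            then show "u = v" using uv(3) b0c by simp
          qed
          show "(\<lambda>u. inv ?b0 \<otimes> u \<otimes> inv ?W) ` ?U \<subseteq> ball (nat \<lfloor>2 * d \<one> ?W + K0\<rfloor>)"
          proof clarify
            fix y x assume y: "y \<in> A n" and x: "x \<in> carrier G" "near_one B3 x" "g = ?u y \<otimes> x"
            have yc: "\<phi> y \<in> carrier G" using \<phi>c[OF y] .
            have "real (len (inv ?b0 \<otimes> \<phi> y)) \<le> 2 * d \<one> ?W + K0"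
              using close[OF y x(1,2)] x(3) by (simp add: wdist_def)
            then have "len (inv ?b0 \<otimes> \<phi> y) \<le> nat \<lfloor>2 * d \<one> ?W + K0\<rfloor>" by (simp add: le_nat_floor)
            then have "inv ?b0 \<otimes> \<phi> y \<in> ball (nat \<lfloor>2 * d \<one> ?W + K0\<rfloor>)"
              using b0c yc len_le_iff by simp
            moreover have "inv ?b0 \<otimes> ?u y \<otimes> inv ?W = inv ?b0 \<otimes> \<phi> y" using b0c yc by (simp add: m_assoc)
            ultimately show "inv ?b0 \<otimes> ?u y \<otimes> inv ?W \<in> ball (nat \<lfloor>2 * d \<one> ?W + K0\<rfloor>)" by simp
          qed
        qed
      qed
    qed
    then show ?thesis using 1 by linarith
  qed
  \<comment> \<open>The parsing bound needs \<open>s\<close> above the growth rate of the group,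
    which is only known to be at most \<open>\<gamma>\<close>. As \<open>\<beta>\<close> does not
    depend on \<open>s\<close>, continuity of the finite sums carries the bound to
    \<open>\<gamma>\<close>.\<close>
  have limit: "(\<Sum>y\<in>A n. exp (- \<gamma> * (real (l y) + \<kappa>))) \<le> real \<beta>" for n
  proof (rule tendsto_upperbound)
    show "((\<lambda>s. \<Sum>y\<in>A n. exp (- s * (real (l y) + \<kappa>))) \<longlongrightarrow> (\<Sum>y\<in>A n. exp (- \<gamma> * (real (l y) + \<kappa>)))) (at_right \<gamma>)"
      by (intro tendsto_intros)
    show "\<forall>\<^sub>F s in at_right \<gamma>. (\<Sum>y\<in>A n. exp (- s * (real (l y) + \<kappa>))) \<le> real \<beta>"
      using sum_le eventually_at_right_less[of \<gamma>] by (auto elim: eventually_mono)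
  qed simp
  have bound: "(\<Sum>y\<in>A n. exp (- \<gamma> * real (l y))) \<le> real \<beta> * exp (\<gamma> * \<kappa>)" for n
  proof -
    have "(\<Sum>y\<in>A n. exp (- \<gamma> * real (l y))) = (\<Sum>y\<in>A n. exp (- \<gamma> * (real (l y) + \<kappa>))) * exp (\<gamma> * \<kappa>)"
      unfolding sum_distrib_right exp_add[symmetric] by (intro sum.cong) (simp_all add: algebra_simps)
    also have "\<dots> \<le> real \<beta> * exp (\<gamma> * \<kappa>)" using limit by (intro mult_right_mono) auto
    finally show ?thesis .
  qed
  show False
  proof (rule bounded_partial_sums_growth[where Y = "coset_ball N" and \<gamma> = \<gamma> and \<beta> = "real \<beta> * exp (\<gamma> * \<kappa>)"
        and l = l and X = Y and p = l0])
  qed (use finite_coset_ball l \<gamma>0 Q.exp_growth_rate_le bound in \<open>auto simp: \<gamma>_def A_def\<close>)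
qed

end

theorem (in marked_group) growth_rate_quotient_less:
  assumes ne: "\<not> elementary_group G" and c: "cayley_has_strongly_contracting_element G S"
    and N: "N \<lhd> G" and inf: "infinite N"
  shows "growth_rate (\<lambda>n. card (coset_ball N n)) < growth_rate (\<lambda>n. card (ball n))"
proof -
  obtain h C where "contracting_axis G S h C" using contracting_axis_exists[OF c] .
  then interpret contracting_axis G S h C .
  obtain m where m: "m \<in> N" "m \<notin> comm_set" using not_subset_comm_set[OF ne N inf] .
  have mc: "m \<in> carrier G" using m(1) normal_imp_subgroup[OF N] subgroup.subset by blast
  have im: "inv m \<notin> comm_set" using m(2) comm_set_inv[of "inv m"] mc by auto
  obtain B1 where B1: "\<And>t p. \<lbrakk>t \<in> L; nearest L (m \<otimes> t) p\<rbrakk> \<Longrightarrow> d \<one> p \<le> B1"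
    using transverse_bound[OF mc m(2)] by blast
  obtain B2 where B2: "\<And>t p. \<lbrakk>t \<in> L; nearest L (inv m \<otimes> t) p\<rbrakk> \<Longrightarrow> d \<one> p \<le> B2"
    using transverse_bound[OF _ im] mc by blast
  interpret transverse G S h C m "max B1 B2"
    using mc B1 B2 by unfold_locales (force simp: le_max_iff_disj)+
  show ?thesis using transverse_quotient_growth_less[OF N m(1)] .
qed

lemma (in submultiplicative) growth_rate_geI:
  assumes "\<And>n. exp (s * real n) \<le> real (f n)" shows "s \<le> growth_rate f"
  unfolding growth_rate_def
proof (rule cINF_greatest)
  fix n
  have "s * real (Suc n) \<le> ln (real (f (Suc n)))"
    using assms[of "Suc n"] real_ge_1[of "Suc n"] by (subst ln_ge_iff) auto
  then show "s \<le> ln (real (f (Suc n))) / real (Suc n)" by (simp add: field_simps)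
qed simp

section \<open>Products\<close>

lemma wball_generate:
  assumes "group G" "S \<subseteq> carrier G" shows "wball G S n \<subseteq> generate G S"
proof -
  interpret group G by (rule assms)
  show ?thesis
    by (induction n) (auto intro: generate.intros)
qed

locale marked_family =
  fixes I :: "'i set" and G :: "'i \<Rightarrow> ('a, 'b) monoid_scheme" and S :: "'i \<Rightarrow> 'a set"
  assumes finI: "finite I"
    and marked: "i \<in> I \<Longrightarrow> marked_group (G i) (S i)"
begin

abbreviation P where "P \<equiv> product_group I G"
abbreviation S1 where "S1 \<equiv> product_gens_one I G S"
abbreviation Sinf where "Sinf \<equiv> product_gens_infty I G S"

lemma grp: "i \<in> I \<Longrightarrow> group (G i)"
  using marked marked_group.axioms(1) by blast

lemma P_group: "group P"
  using grp by simp

lemma P_closed: "\<lbrakk>f \<in> carrier P; i \<in> I\<rbrakk> \<Longrightarrow> f i \<in> carrier (G i)"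
  by auto

lemma P_eqI: "\<lbrakk>f \<in> carrier P; g \<in> carrier P; \<And>i. i \<in> I \<Longrightarrow> f i = g i\<rbrakk> \<Longrightarrow> f = g"
  by (auto intro: PiE_ext)

lemma P_inv: "\<lbrakk>f \<in> carrier P; i \<in> I\<rbrakk> \<Longrightarrow> (inv\<^bsub>P\<^esub> f) i = inv\<^bsub>G i\<^esub> f i"
  using grp by simp

lemma gens_sub: "i \<in> I \<Longrightarrow> S i \<subseteq> carrier (G i)" "i \<in> I \<Longrightarrow> finite (S i)"
  "\<lbrakk>i \<in> I; s \<in> S i\<rbrakk> \<Longrightarrow> inv\<^bsub>G i\<^esub> s \<in> S i"
  using marked marked_group.gens_closed marked_group.finite_gens marked_group.gens_inv by metis+

text \<open>All coordinates advance at once; one whose word is already finished uses the letter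
  \<open>\<one>\<close>.\<close>

lemma gens_infty_ball:
  assumes "f \<in> carrier P"
  shows "f \<in> wball P Sinf n \<longleftrightarrow> (\<forall>i\<in>I. f i \<in> wball (G i) (S i) n)"
proof
  assume "f \<in> wball P Sinf n"
  then show "\<forall>i\<in>I. f i \<in> wball (G i) (S i) n"
  proof (induction n arbitrary: f)
    case (Suc n)
    consider "f \<in> wball P Sinf n" | y s where "f = y \<otimes>\<^bsub>P\<^esub> s" "y \<in> wball P Sinf n" "s \<in> Sinf"
      using Suc.prems by auto
    then show ?case
    proof cases
      case 1
      then show ?thesis using Suc.IH by auto
    next
      case 2
      show ?thesis
      proof
        fix i assume i: "i \<in> I"
        interpret Gi: marked_group "G i" "S i" using marked[OF i] .
        have y: "y i \<in> wball (G i) (S i) n" using Suc.IH 2 i by blast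
        have "s i \<in> S i \<union> {\<one>\<^bsub>G i\<^esub>}" using 2 i by (auto simp: product_gens_infty_def)
        then show "f i \<in> wball (G i) (S i) (Suc n)"
          using y Gi.ball_closed[OF y] 2 i by auto
      qed
    qed
  qed auto
next
  assume "\<forall>i\<in>I. f i \<in> wball (G i) (S i) n"
  then show "f \<in> wball P Sinf n" using assms
  proof (induction n arbitrary: f)
    case 0
    then have "f = \<one>\<^bsub>P\<^esub>"
      by (intro P_eqI[OF _ monoid.one_closed[OF group.is_monoid[OF P_group]]]) auto
    then show ?case by (simp only: wball.simps(1) singleton_iff)
  next
    case (Suc n)
    have "\<exists>y s. y \<in> wball (G i) (S i) n \<and> s \<in> S i \<union> {\<one>\<^bsub>G i\<^esub>} \<and> f i = y \<otimes>\<^bsub>G i\<^esub> s" if i: "i \<in> I" for i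
    proof -
      interpret Gi: marked_group "G i" "S i" using marked[OF i] .
      have "f i \<in> wball (G i) (S i) (Suc n)" using Suc.prems(1) i by blast
      then consider "f i \<in> wball (G i) (S i) n"
        | y s where "f i = y \<otimes>\<^bsub>G i\<^esub> s" "y \<in> wball (G i) (S i) n" "s \<in> S i" by auto
      then show ?thesis
      proof cases
        case 1
        then show ?thesis using Gi.ball_closed by (intro exI[of _ "f i"] exI[of _ "\<one>\<^bsub>G i\<^esub>"]) auto
      qed blast
    qed
    then obtain y s where ys: "\<And>i. i \<in> I \<Longrightarrow> y i \<in> wball (G i) (S i) n"
      "\<And>i. i \<in> I \<Longrightarrow> s i \<in> S i \<union> {\<one>\<^bsub>G i\<^esub>}" "\<And>i. i \<in> I \<Longrightarrow> f i = y i \<otimes>\<^bsub>G i\<^esub> s i" by metis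
    have yc: "y i \<in> carrier (G i)" if "i \<in> I" for i
      using ys(1)[OF that] marked_group.ball_closed[OF marked[OF that]] by blast
    have sc: "s i \<in> carrier (G i)" if "i \<in> I" for i
      using ys(2)[OF that] gens_sub(1)[OF that] grp[OF that] by (auto simp: group.is_monoid monoid.one_closed)
    have "restrict y I \<in> wball P Sinf n" using ys(1) yc by (intro Suc.IH) auto
    moreover have "restrict s I \<in> Sinf" using ys(2) sc by (auto simp: product_gens_infty_def)
    moreover have "f = restrict y I \<otimes>\<^bsub>P\<^esub> restrict s I"
      using Suc.prems(2) ys(3) by (intro PiE_ext[of f I "\<lambda>i. carrier (G i)"]) (auto simp: ys(3)[symmetric])
    ultimately show ?case unfolding wball.simps by blast
  qed
qed

lemma gens_infty_sub: "Sinf \<subseteq> (\<Pi>\<^sub>E i\<in>I. S i \<union> {\<one>\<^bsub>G i\<^esub>})"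
  by (auto simp: product_gens_infty_def)

lemma gens_one_sub: "S1 \<subseteq> Sinf"
  unfolding product_gens_one_def product_gens_infty_def by auto

lemma finite_gens_infty: "finite Sinf"
  using gens_infty_sub finI gens_sub by (elim finite_subset) (auto intro: finite_PiE)

definition emb :: "'i \<Rightarrow> 'a \<Rightarrow> 'i \<Rightarrow> 'a" where
  "emb i x = (\<lambda>j\<in>I. if j = i then x else \<one>\<^bsub>G j\<^esub>)"

lemma one_in: "i \<in> I \<Longrightarrow> \<one>\<^bsub>G i\<^esub> \<in> carrier (G i)"
  using grp by (simp add: group.is_monoid monoid.one_closed)

lemma emb_closed: "\<lbrakk>i \<in> I; x \<in> carrier (G i)\<rbrakk> \<Longrightarrow> emb i x \<in> carrier P"
  using one_in by (auto simp: emb_def)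

lemma emb_same [simp]: "i \<in> I \<Longrightarrow> emb i x i = x"
  by (simp add: emb_def)

lemma emb_other [simp]: "\<lbrakk>j \<in> I; j \<noteq> i\<rbrakk> \<Longrightarrow> emb i x j = \<one>\<^bsub>G j\<^esub>"
  by (simp add: emb_def)

lemma mult_at [simp]: "i \<in> I \<Longrightarrow> (x \<otimes>\<^bsub>P\<^esub> y) i = x i \<otimes>\<^bsub>G i\<^esub> y i"
  by simp

lemma P_mult_closed: "\<lbrakk>f \<in> carrier P; g \<in> carrier P\<rbrakk> \<Longrightarrow> f \<otimes>\<^bsub>P\<^esub> g \<in> carrier P"
  using monoid.m_closed[OF group.is_monoid[OF P_group]] by blast

lemma P_inv_closed: "f \<in> carrier P \<Longrightarrow> inv\<^bsub>P\<^esub> f \<in> carrier P"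
  using P_group by (rule group.inv_closed)

lemma emb_mult: "\<lbrakk>i \<in> I; x \<in> carrier (G i); y \<in> carrier (G i)\<rbrakk> \<Longrightarrow> emb i (x \<otimes>\<^bsub>G i\<^esub> y) = emb i x \<otimes>\<^bsub>P\<^esub> emb i y"
proof (rule P_eqI)
  assume i: "i \<in> I" and x: "x \<in> carrier (G i)" and y: "y \<in> carrier (G i)"
  interpret Gi: group "G i" using grp[OF i] .
  show "emb i (x \<otimes>\<^bsub>G i\<^esub> y) \<in> carrier P" "emb i x \<otimes>\<^bsub>P\<^esub> emb i y \<in> carrier P"
    using i x y emb_closed P_mult_closed by auto
  fix j assume j: "j \<in> I"
  then show "emb i (x \<otimes>\<^bsub>G i\<^esub> y) j = (emb i x \<otimes>\<^bsub>P\<^esub> emb i y) j"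
    using i one_in[OF j] grp[OF j] by (cases "j = i") (auto simp: group.is_monoid monoid.l_one emb_def)
qed

lemma emb_inv: "\<lbrakk>i \<in> I; x \<in> carrier (G i)\<rbrakk> \<Longrightarrow> emb i (inv\<^bsub>G i\<^esub> x) = inv\<^bsub>P\<^esub> (emb i x)"
proof (rule P_eqI)
  assume i: "i \<in> I" and x: "x \<in> carrier (G i)"
  interpret Gi: group "G i" using grp[OF i] .
  show "emb i (inv\<^bsub>G i\<^esub> x) \<in> carrier P" "inv\<^bsub>P\<^esub> (emb i x) \<in> carrier P"
    using i x emb_closed P_inv_closed by auto
  fix j assume j: "j \<in> I"
  then show "emb i (inv\<^bsub>G i\<^esub> x) j = (inv\<^bsub>P\<^esub> (emb i x)) j"
    using i P_inv[OF emb_closed[OF i x] j] grp[OF j]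
    by (cases "j = i") (auto simp: group.is_monoid monoid.inv_one)
qed

lemma emb_one_ball: "\<lbrakk>i \<in> I; x \<in> wball (G i) (S i) n\<rbrakk> \<Longrightarrow> emb i x \<in> wball P S1 n"
proof (induction n arbitrary: x)
  case 0
  then show ?case by (auto simp: emb_def fun_eq_iff)
next
  case (Suc n)
  interpret Gi: marked_group "G i" "S i" using marked Suc.prems(1) .
  consider "x \<in> wball (G i) (S i) n" | y s where "x = y \<otimes>\<^bsub>G i\<^esub> s" "y \<in> wball (G i) (S i) n" "s \<in> S i"
    using Suc.prems by auto
  then show ?case
  proof cases
    case 1
    then show ?thesis using Suc by auto
  next
    case 2
    have "s \<in> carrier (G i)" using 2 Gi.gens_closed by blast
    moreover from this have "emb i s \<in> S1"
      using 2 Suc.prems(1) emb_closed unfolding product_gens_one_def by (intro UN_I[of i]) auto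
    moreover have "y \<in> carrier (G i)" using 2 Gi.ball_closed by blast
    ultimately have "emb i x = emb i y \<otimes>\<^bsub>P\<^esub> emb i s" "emb i y \<in> wball P S1 n" "emb i s \<in> S1"
      using 2 Suc.IH[OF Suc.prems(1)] emb_mult[OF Suc.prems(1)] by blast+
    then show ?thesis unfolding wball.simps by blast
  qed
qed

lemma gens_one_closed: "S1 \<subseteq> carrier P"
  by (auto simp: product_gens_one_def)

lemma gens_infty_closed: "Sinf \<subseteq> carrier P"
  by (auto simp: product_gens_infty_def)

text \<open>Induction on the support: dividing by the embedded coordinate \<open>j\<close> removes
  \<open>j\<close> from it.\<close>

lemma finite_support_generate:
  "\<lbrakk>finite J; J \<subseteq> I; f \<in> carrier P; \<And>i. i \<in> I - J \<Longrightarrow> f i = \<one>\<^bsub>G i\<^esub>\<rbrakk> \<Longrightarrow> f \<in> generate P S1"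
proof (induction J arbitrary: f rule: finite_induct)
  case empty
  interpret PG: group P by (rule P_group)
  have "f = \<one>\<^bsub>P\<^esub>"
    by (rule P_eqI[OF empty.prems(2) PG.one_closed]) (use empty.prems(3) in auto)
  then show ?case by (simp only: generate.one)
next
  case (insert j J)
  interpret PG: group P by (rule P_group)
  have j: "j \<in> I" using insert.prems by blast
  interpret Gj: marked_group "G j" "S j" using marked[OF j] .
  have fj: "f j \<in> carrier (G j)" using P_closed[OF insert.prems(2) j] .
  let ?e = "emb j (f j)"
  have ec: "?e \<in> carrier P" using emb_closed[OF j fj] .
  let ?g = "f \<otimes>\<^bsub>P\<^esub> inv\<^bsub>P\<^esub> ?e"
  have gi: "?g i = \<one>\<^bsub>G i\<^esub>" if i: "i \<in> I - J" for i
  proof (cases "i = j")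
    case True
    then show ?thesis using j fj P_inv[OF ec j] mult_at by simp
  next
    case False
    then have "f i = \<one>\<^bsub>G i\<^esub>" using insert.prems(3) i by blast
    then show ?thesis
      using False i P_inv[OF ec, of i] one_in[of i] grp[of i]
      by (simp add: mult_at group.is_monoid monoid.l_one monoid.inv_one)
  qed
  have "?g \<in> generate P S1"
    using insert.prems gi P_mult_closed[OF insert.prems(2) P_inv_closed[OF ec]] by (intro insert.IH) auto
  moreover have "?e \<in> generate P S1"
  proof -
    obtain n where "f j \<in> wball (G j) (S j) n" using Gj.ball_exhaust[OF fj] .
    then show ?thesis using emb_one_ball[OF j] wball_generate[OF P_group gens_one_closed] by blast
  qed
  ultimately have "?g \<otimes>\<^bsub>P\<^esub> ?e \<in> generate P S1" by (rule generate.eng)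
  moreover have "?g \<otimes>\<^bsub>P\<^esub> ?e = f"
    using PG.m_assoc[OF insert.prems(2) P_inv_closed[OF ec] ec] PG.l_inv[OF ec] PG.r_one[OF insert.prems(2)]
    by (simp only:)
  ultimately show ?case by (simp only:)
qed

lemma marked_one: "marked_group P S1"
proof -
  interpret PG: group P by (rule P_group)
  have inv: "inv\<^bsub>P\<^esub> s \<in> S1" if s: "s \<in> S1" for s
  proof -
    obtain i where i: "i \<in> I" "s \<in> carrier P" "\<And>j. \<lbrakk>j \<in> I; j \<noteq> i\<rbrakk> \<Longrightarrow> s j = \<one>\<^bsub>G j\<^esub>" "s i \<in> S i"
      using s unfolding product_gens_one_def by blast
    have "(inv\<^bsub>P\<^esub> s) j = \<one>\<^bsub>G j\<^esub>" if j: "j \<in> I" "j \<noteq> i" for j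
      using P_inv[OF i(2) j(1)] i(3)[OF j] grp[OF j(1)] by (simp add: group.is_monoid monoid.inv_one)
    moreover have "(inv\<^bsub>P\<^esub> s) i \<in> S i" using P_inv[OF i(2,1)] gens_sub(3)[OF i(1,4)] by (simp only:)
    ultimately show ?thesis using i P_inv_closed[OF i(2)] unfolding product_gens_one_def by blast
  qed
  have "carrier P \<subseteq> generate P S1" using finite_support_generate[OF finI] by blast
  then have "generate P S1 = carrier P" using PG.generate_incl[OF gens_one_closed] by blast
  moreover have "finite S1" using gens_one_sub finite_gens_infty finite_subset by blast
  ultimately show ?thesis using inv gens_one_closed by unfold_locales
qed

lemma marked_infty: "marked_group P Sinf"
proof -
  interpret PG: group P by (rule P_group)
  interpret P1: marked_group P S1 by (rule marked_one)
  have inv: "inv\<^bsub>P\<^esub> s \<in> Sinf" if s: "s \<in> Sinf" for s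
  proof -
    have sc: "s \<in> carrier P" using s by (simp add: product_gens_infty_def)
    have "(inv\<^bsub>P\<^esub> s) i \<in> S i \<union> {\<one>\<^bsub>G i\<^esub>}" if i: "i \<in> I" for i
    proof -
      have "s i \<in> S i \<union> {\<one>\<^bsub>G i\<^esub>}" using s i by (simp add: product_gens_infty_def)
      moreover have "inv\<^bsub>G i\<^esub> \<one>\<^bsub>G i\<^esub> = \<one>\<^bsub>G i\<^esub>" using grp[OF i] by (simp add: group.is_monoid monoid.inv_one)
      ultimately show ?thesis unfolding P_inv[OF sc i] using gens_sub(3)[OF i] by auto
    qed
    then show ?thesis using P_inv_closed[OF sc] unfolding product_gens_infty_def by blast
  qed
  have "generate P S1 \<subseteq> generate P Sinf" using PG.mono_generate[OF gens_one_sub] .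
  then have "generate P Sinf = carrier P"
    using PG.generate_incl[OF gens_infty_closed] P1.gens_generate by blast
  then show ?thesis using inv gens_infty_closed finite_gens_infty by unfold_locales
qed

lemma one_ball_len:
  "f \<in> wball P S1 n \<Longrightarrow> (\<Sum>i\<in>I. wlen (G i) (S i) (f i)) \<le> n"
proof (induction n arbitrary: f)
  case 0
  then have "wlen (G i) (S i) (f i) = 0" if "i \<in> I" for i
    using that marked_group.len_one[OF marked[OF that]] by simp
  then show ?case by simp
next
  case (Suc n)
  interpret P1: marked_group P S1 by (rule marked_one)
  consider "f \<in> wball P S1 n" | y s where "f = y \<otimes>\<^bsub>P\<^esub> s" "y \<in> wball P S1 n" "s \<in> S1"
    using Suc.prems by auto
  then show ?case
  proof cases
    case 1
    then show ?thesis using Suc.IH[of f] by simp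
  next
    case 2
    obtain i where i: "i \<in> I" "s \<in> carrier P" "\<And>j. \<lbrakk>j \<in> I; j \<noteq> i\<rbrakk> \<Longrightarrow> s j = \<one>\<^bsub>G j\<^esub>" "s i \<in> S i"
      using 2(3) unfolding product_gens_one_def by blast
    have yc: "y \<in> carrier P" using P1.ball_closed[OF 2(2)] .
    have "wlen (G j) (S j) (f j) \<le> wlen (G j) (S j) (y j) + (if j = i then 1 else 0)" if j: "j \<in> I" for j
    proof -
      interpret Gj: marked_group "G j" "S j" using marked[OF j] .
      have "wlen (G j) (S j) (f j) \<le> wlen (G j) (S j) (y j) + wlen (G j) (S j) (s j)"
        unfolding 2(1) mult_at[OF j] using P_closed[OF yc j] P_closed[OF i(2) j] by (rule Gj.len_mult)
      moreover have "wlen (G j) (S j) (s j) \<le> (if j = i then 1 else 0)"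
        using i(3)[OF j] i(4) Gj.len_gen by auto
      ultimately show ?thesis by linarith
    qed
    then have "(\<Sum>j\<in>I. wlen (G j) (S j) (f j)) \<le> (\<Sum>j\<in>I. wlen (G j) (S j) (y j) + (if j = i then 1 else 0))"
      by (rule sum_mono)
    also have "\<dots> = (\<Sum>j\<in>I. wlen (G j) (S j) (y j)) + 1"
      using finI i(1) by (simp add: sum.distrib)
    finally show ?thesis using Suc.IH[OF 2(2)] by simp
  qed
qed

abbreviation rate :: "'i \<Rightarrow> real" where
  "rate i \<equiv> growth_rate (\<lambda>n. card (wball (G i) (S i) n))"

lemma rate_nonneg: "i \<in> I \<Longrightarrow> 0 \<le> rate i"
  using marked marked_group.ball_submultiplicative submultiplicative.growth_rate_nonneg by blast

text \<open>By \<open>one_ball_len\<close> the weight \<open>exp (- s * n)\<close> is at most the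
  product of the weights of the coordinates. The sum of these products over a box factors into sums
  over the \<open>G i\<close>, each of them bounded because \<open>s\<close> exceeds
  \<open>rate i\<close>.\<close>

lemma growth_rate_one_le:
  assumes s: "0 \<le> s" "\<And>i. i \<in> I \<Longrightarrow> rate i < s"
  shows "growth_rate (\<lambda>n. card (wball P S1 n)) \<le> s"
proof -
  interpret P1: marked_group P S1 by (rule marked_one)
  interpret B: submultiplicative "\<lambda>n. card (wball P S1 n)" by (rule P1.ball_submultiplicative)
  let ?e = "\<lambda>i x. exp (- s * real (wlen (G i) (S i) x))"
  have "\<exists>Z. \<forall>n. (\<Sum>x\<in>wball (G i) (S i) n. ?e i x) \<le> Z" if i: "i \<in> I" for i
  proof -
    interpret Gi: marked_group "G i" "S i" using marked[OF i] .
    obtain Z where "\<And>F. \<lbrakk>finite F; F \<subseteq> carrier (G i)\<rbrakk> \<Longrightarrow> (\<Sum>x\<in>F. ?e i x) \<le> Z"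
      using Gi.poincare_bounded[OF s(2)[OF i]] by blast
    then show ?thesis using Gi.finite_ball Gi.ball_closed by blast
  qed
  then obtain Z where Z: "\<And>i n. i \<in> I \<Longrightarrow> (\<Sum>x\<in>wball (G i) (S i) n. ?e i x) \<le> Z i" by metis
  \<comment> \<open>The summand 1 makes the constant positive, as \<open>growth_rate_leI\<close>
    requires, from \<open>0 \<le> Z i\<close> alone.\<close>
  have "real (card (wball P S1 n)) \<le> ((\<Prod>i\<in>I. Z i) + 1) * exp (s * real n)" for n
  proof -
    have sub: "wball P S1 n \<subseteq> (\<Pi>\<^sub>E i\<in>I. wball (G i) (S i) n)"
    proof
      fix f assume f: "f \<in> wball P S1 n"
      have fc: "f \<in> carrier P" using P1.ball_closed[OF f] .
      have "f i \<in> wball (G i) (S i) n" if i: "i \<in> I" for i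
      proof -
        have "wlen (G i) (S i) (f i) \<le> (\<Sum>i\<in>I. wlen (G i) (S i) (f i))"
          using finI i by (intro member_le_sum) auto
        then have "wlen (G i) (S i) (f i) \<le> n" using one_ball_len[OF f] by linarith
        then show ?thesis using marked_group.len_le_iff[OF marked[OF i] P_closed[OF fc i]] by blast
      qed
      then show "f \<in> (\<Pi>\<^sub>E i\<in>I. wball (G i) (S i) n)" using fc by auto
    qed
    have finE: "finite (wball (G i) (S i) n)" if "i \<in> I" for i
      using marked_group.finite_ball[OF marked[OF that]] .
    have "real (card (wball P S1 n)) * exp (- s * real n) = (\<Sum>f\<in>wball P S1 n. exp (- s * real n))" by simp
    also have "\<dots> \<le> (\<Sum>f\<in>wball P S1 n. \<Prod>i\<in>I. ?e i (f i))"
    proof (rule sum_mono)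
      fix f assume "f \<in> wball P S1 n"
      then have "real (\<Sum>i\<in>I. wlen (G i) (S i) (f i)) \<le> real n" using one_ball_len by (simp only: of_nat_le_iff)
      then have "s * real (\<Sum>i\<in>I. wlen (G i) (S i) (f i)) \<le> s * real n" using s(1) by (rule mult_left_mono)
      moreover have "(\<Prod>i\<in>I. ?e i (f i)) = exp (- (s * real (\<Sum>i\<in>I. wlen (G i) (S i) (f i))))"
        by (simp add: exp_sum[OF finI, symmetric] sum_distrib_left sum_negf)
      ultimately show "exp (- s * real n) \<le> (\<Prod>i\<in>I. ?e i (f i))" by simp
    qed
    also have "\<dots> \<le> (\<Sum>f\<in>(\<Pi>\<^sub>E i\<in>I. wball (G i) (S i) n). \<Prod>i\<in>I. ?e i (f i))"
      using sub finE finI by (intro sum_mono2 finite_PiE prod_nonneg) auto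
    also have "\<dots> = (\<Prod>i\<in>I. \<Sum>x\<in>wball (G i) (S i) n. ?e i x)"
      using finE finI by (intro prod_sum_PiE[symmetric])
    also have "\<dots> \<le> (\<Prod>i\<in>I. Z i)" using Z by (intro prod_mono) (auto intro: sum_nonneg)
    finally have "real (card (wball P S1 n)) * exp (- s * real n) * exp (s * real n) \<le> (\<Prod>i\<in>I. Z i) * exp (s * real n)"
      by (intro mult_right_mono) auto
    then have "real (card (wball P S1 n)) \<le> (\<Prod>i\<in>I. Z i) * exp (s * real n)"
      by (simp add: mult.assoc exp_add[symmetric])
    also have "\<dots> \<le> ((\<Prod>i\<in>I. Z i) + 1) * exp (s * real n)" by (intro mult_right_mono) auto
    finally show ?thesis .
  qed
  moreover have "(\<Prod>i\<in>I. Z i) + 1 > 0"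
  proof -
    have "0 \<le> Z i" if "i \<in> I" for i
      by (rule order_trans[OF sum_nonneg Z[OF that, of 0]]) simp
    then show ?thesis by (simp add: prod_nonneg add_nonneg_pos)
  qed
  ultimately show ?thesis by (intro B.growth_rate_leI)
qed

section \<open>Kernels of the projections, and the failure of growth tightness for
  \<open>S1\<close>\<close>

definition kernel :: "'i \<Rightarrow> ('i \<Rightarrow> 'a) set" where
  "kernel i = {f \<in> carrier P. f i = \<one>\<^bsub>G i\<^esub>}"

lemma kernel_normal:
  assumes i: "i \<in> I" shows "kernel i \<lhd> P"
proof -
  interpret PG: group P by (rule P_group)
  interpret Gi: group "G i" using grp[OF i] .
  have sub: "subgroup (kernel i) P"
  proof (rule PG.subgroupI)
    show "kernel i \<subseteq> carrier P" by (auto simp: kernel_def)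
    have "\<one>\<^bsub>P\<^esub> \<in> kernel i" using PG.one_closed i unfolding kernel_def by simp
    then show "kernel i \<noteq> {}" by blast
    show "inv\<^bsub>P\<^esub> f \<in> kernel i" if "f \<in> kernel i" for f
    proof -
      have fc: "f \<in> carrier P" "f i = \<one>\<^bsub>G i\<^esub>" using that by (auto simp: kernel_def)
      then show ?thesis using P_inv[OF fc(1) i] P_inv_closed[OF fc(1)] unfolding kernel_def by simp
    qed
    show "f \<otimes>\<^bsub>P\<^esub> g \<in> kernel i" if "f \<in> kernel i" "g \<in> kernel i" for f g
      using that P_mult_closed[of f g] mult_at[OF i, of f g] unfolding kernel_def by simp
  qed
  have "x \<otimes>\<^bsub>P\<^esub> f \<otimes>\<^bsub>P\<^esub> inv\<^bsub>P\<^esub> x \<in> kernel i" if x: "x \<in> carrier P" and f: "f \<in> kernel i" for x f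
  proof -
    have fc: "f \<in> carrier P" "f i = \<one>\<^bsub>G i\<^esub>" using f by (auto simp: kernel_def)
    have "(x \<otimes>\<^bsub>P\<^esub> f \<otimes>\<^bsub>P\<^esub> inv\<^bsub>P\<^esub> x) i = \<one>\<^bsub>G i\<^esub>"
      unfolding mult_at[OF i] P_inv[OF x i] fc(2) using P_closed[OF x i] by simp
    moreover have "x \<otimes>\<^bsub>P\<^esub> f \<otimes>\<^bsub>P\<^esub> inv\<^bsub>P\<^esub> x \<in> carrier P"
      using P_mult_closed P_inv_closed x fc(1) by blast
    ultimately show ?thesis unfolding kernel_def by blast
  qed
  then show ?thesis unfolding PG.normal_inv_iff using sub by blast
qed

lemma kernel_infinite:
  assumes "i \<in> I" "j \<in> I" "j \<noteq> i" "infinite (carrier (G j))"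
  shows "infinite (kernel i)"
proof
  assume "finite (kernel i)"
  moreover have "emb j ` carrier (G j) \<subseteq> kernel i"
    using assms emb_closed unfolding kernel_def by auto
  moreover have "inj_on (emb j) (carrier (G j))"
    using emb_same[OF assms(2)] by (metis inj_onI)
  ultimately show False using assms(4) by (metis finite_imageD finite_subset)
qed

theorem product_one_not_growth_tight:
  assumes card: "2 \<le> card I" and inf: "\<And>i. i \<in> I \<Longrightarrow> infinite (carrier (G i))"
  shows "\<not> cayley_growth_tight P S1"
proof -
  interpret P1: marked_group P S1 by (rule marked_one)
  have ne: "rate ` I \<noteq> {}" "finite (rate ` I)" using card finI by auto
  obtain i where i: "i \<in> I" "rate i = Max (rate ` I)" using Max_in[OF ne(2,1)] by auto
  then have max: "rate k \<le> rate i" if "k \<in> I" for k using that ne by simp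
  have "\<not> I \<subseteq> {i}" using card card_mono[of "{i}" I] by auto
  then obtain j where j: "j \<in> I" "j \<noteq> i" by blast
  let ?N = "kernel i"
  have N: "?N \<lhd> P" "infinite ?N" using kernel_normal[OF i(1)] kernel_infinite[OF i(1) j inf[OF j(1)]] by auto
  interpret B: submultiplicative "\<lambda>n. card (P1.coset_ball ?N n)"
    using P1.coset_ball_submultiplicative[OF N(1)] .
  interpret Gi: marked_group "G i" "S i" using marked[OF i(1)] .
  interpret Bi: submultiplicative "\<lambda>n. card (wball (G i) (S i) n)" by (rule Gi.ball_submultiplicative)
  interpret N: normal ?N P by (rule N(1))
  \<comment> \<open>The embedding of \<open>G i\<close> does not increase lengths and meets every
    coset of the kernel at most once.\<close>
  have "card (wball (G i) (S i) n) \<le> card (P1.coset_ball ?N n)" for n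
  proof (rule card_inj_on_le)
    let ?f = "\<lambda>x. ?N #>\<^bsub>P\<^esub> emb i x"
    show "inj_on ?f (wball (G i) (S i) n)"
    proof (rule inj_onI)
      fix x y assume xy: "x \<in> wball (G i) (S i) n" "y \<in> wball (G i) (S i) n" "?f x = ?f y"
      have c: "x \<in> carrier (G i)" "y \<in> carrier (G i)" using xy Gi.ball_closed by auto
      have "emb i x \<in> ?f y"
        using P1.rcos_self[OF emb_closed[OF i(1) c(1)] N.subgroup_axioms] xy(3) by simp
      then obtain f where f: "f \<in> ?N" "emb i x = f \<otimes>\<^bsub>P\<^esub> emb i y" unfolding r_coset_def by blast
      have "x = (f \<otimes>\<^bsub>P\<^esub> emb i y) i" using f(2) emb_same[OF i(1), of x] by simp
      also have "\<dots> = y" using f(1) c(2) i(1) mult_at[OF i(1), of f "emb i y"] by (simp add: kernel_def)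
      finally show "x = y" .
    qed
    show "?f ` wball (G i) (S i) n \<subseteq> P1.coset_ball ?N n"
      using emb_one_ball[OF i(1)] by (auto simp: P1.coset_ball_def)
    show "finite (P1.coset_ball ?N n)" by (rule P1.finite_coset_ball)
  qed
  then have "exp (rate i * real n) \<le> real (card (P1.coset_ball ?N n))" for n
    using Bi.exp_growth_rate_le[of n] by (meson of_nat_le_iff order_trans)
  then have low: "rate i \<le> growth_rate (\<lambda>n. card (P1.coset_ball ?N n))" by (rule B.growth_rate_geI)
  have "growth_rate (\<lambda>n. card (wball P S1 n)) \<le> rate i"
  proof (rule field_le_epsilon)
    fix e :: real assume "e > 0"
    then have "rate k < rate i + e" if "k \<in> I" for k using max[OF that] by linarith
    then show "growth_rate (\<lambda>n. card (wball P S1 n)) \<le> rate i + e"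
      using rate_nonneg[OF i(1)] \<open>e > 0\<close> by (intro growth_rate_one_le) auto
  qed
  then show ?thesis using low N P1.growth_tight_iff by (meson leD order_trans)
qed

section \<open>Normal subgroups of the product, and growth tightness for \<open>Sinf\<close>\<close>

lemma infinite_projection:
  assumes "infinite N" "N \<subseteq> carrier P"
  obtains i where "i \<in> I" "infinite ((\<lambda>f. f i) ` N)"
proof (rule ccontr)
  assume "\<not> thesis"
  then have "\<forall>i\<in>I. finite ((\<lambda>f. f i) ` N)" using that by blast
  then have "finite (\<Pi>\<^sub>E i\<in>I. (\<lambda>f. f i) ` N)" using finI by (intro finite_PiE) auto
  moreover have "N \<subseteq> (\<Pi>\<^sub>E i\<in>I. (\<lambda>f. f i) ` N)" using assms(2) by auto
  ultimately show False using assms(1) finite_subset by blast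
qed

lemma projection_normal:
  assumes N: "N \<lhd> P" and i: "i \<in> I" shows "(\<lambda>f. f i) ` N \<lhd> G i"
proof -
  interpret N: normal N P by (rule N)
  interpret Gi: group "G i" using grp[OF i] .
  have Nc: "f \<in> carrier P" if "f \<in> N" for f using that N.subset by blast
  have sub: "subgroup ((\<lambda>f. f i) ` N) (G i)"
  proof (rule Gi.subgroupI)
    show "(\<lambda>f. f i) ` N \<subseteq> carrier (G i)" using P_closed[OF Nc i] by blast
    show "(\<lambda>f. f i) ` N \<noteq> {}" using subgroup.one_closed[OF N.subgroup_axioms] by blast
    show "inv\<^bsub>G i\<^esub> x \<in> (\<lambda>f. f i) ` N" if x: "x \<in> (\<lambda>f. f i) ` N" for x
    proof -
      obtain f where f: "f \<in> N" "x = f i" using x by auto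
      have "inv\<^bsub>G i\<^esub> x = (inv\<^bsub>P\<^esub> f) i" using P_inv[OF Nc[OF f(1)] i] f(2) by (simp only:)
      then show ?thesis using N.m_inv_closed[OF f(1)] by (rule image_eqI)
    qed
    show "x \<otimes>\<^bsub>G i\<^esub> y \<in> (\<lambda>f. f i) ` N" if xy: "x \<in> (\<lambda>f. f i) ` N" "y \<in> (\<lambda>f. f i) ` N" for x y
    proof -
      obtain f g where f: "f \<in> N" "x = f i" "g \<in> N" "y = g i" using xy by auto
      have "x \<otimes>\<^bsub>G i\<^esub> y = (f \<otimes>\<^bsub>P\<^esub> g) i" using mult_at[OF i, of f g] f by (simp only:)
      then show ?thesis using subgroup.m_closed[OF N.subgroup_axioms f(1,3)] by (rule image_eqI)
    qed
  qed
  have "x \<otimes>\<^bsub>G i\<^esub> y \<otimes>\<^bsub>G i\<^esub> inv\<^bsub>G i\<^esub> x \<in> (\<lambda>f. f i) ` N" if x: "x \<in> carrier (G i)" and y: "y \<in> (\<lambda>f. f i) ` N" for x y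
  proof -
    obtain f where f: "f \<in> N" "y = f i" using y by auto
    have "emb i x \<otimes>\<^bsub>P\<^esub> f \<otimes>\<^bsub>P\<^esub> inv\<^bsub>P\<^esub> (emb i x) \<in> N"
      using N.inv_op_closed2[OF emb_closed[OF i x] f(1)] .
    moreover have "(emb i x \<otimes>\<^bsub>P\<^esub> f \<otimes>\<^bsub>P\<^esub> inv\<^bsub>P\<^esub> (emb i x)) i = x \<otimes>\<^bsub>G i\<^esub> y \<otimes>\<^bsub>G i\<^esub> inv\<^bsub>G i\<^esub> x"
      unfolding mult_at[OF i] P_inv[OF emb_closed[OF i x] i] emb_same[OF i] f(2) ..
    ultimately show ?thesis by (intro image_eqI[OF sym])
  qed
  then show ?thesis unfolding Gi.normal_inv_iff using sub by blast
qed

definition factor :: "'i \<Rightarrow> ('i \<Rightarrow> 'a) set \<Rightarrow> 'a set" where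
  "factor i N = {x \<in> carrier (G i). emb i x \<in> N}"

lemma emb_one: "i \<in> I \<Longrightarrow> emb i \<one>\<^bsub>G i\<^esub> = \<one>\<^bsub>P\<^esub>"
  by (auto simp: emb_def fun_eq_iff)

lemma factor_normal:
  assumes N: "N \<lhd> P" and i: "i \<in> I" shows "factor i N \<lhd> G i"
proof -
  interpret N: normal N P by (rule N)
  interpret Gi: group "G i" using grp[OF i] .
  have sub: "subgroup (factor i N) (G i)"
  proof (rule Gi.subgroupI)
    show "factor i N \<subseteq> carrier (G i)" by (auto simp: factor_def)
    have "\<one>\<^bsub>G i\<^esub> \<in> factor i N" using emb_one[OF i] subgroup.one_closed[OF N.subgroup_axioms] unfolding factor_def by (simp del: one_product_group)
    then show "factor i N \<noteq> {}" by blast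
    show "inv\<^bsub>G i\<^esub> x \<in> factor i N" if "x \<in> factor i N" for x
      using that emb_inv[OF i, of x] N.m_inv_closed[of "emb i x"] unfolding factor_def by simp
    show "x \<otimes>\<^bsub>G i\<^esub> y \<in> factor i N" if "x \<in> factor i N" "y \<in> factor i N" for x y
      using that emb_mult[OF i, of x y] subgroup.m_closed[OF N.subgroup_axioms, of "emb i x" "emb i y"] unfolding factor_def by simp
  qed
  have "x \<otimes>\<^bsub>G i\<^esub> y \<otimes>\<^bsub>G i\<^esub> inv\<^bsub>G i\<^esub> x \<in> factor i N" if x: "x \<in> carrier (G i)" and y: "y \<in> factor i N" for x y
  proof -
    have yc: "y \<in> carrier (G i)" "emb i y \<in> N" using y by (auto simp: factor_def)
    have "emb i (x \<otimes>\<^bsub>G i\<^esub> y \<otimes>\<^bsub>G i\<^esub> inv\<^bsub>G i\<^esub> x) = emb i x \<otimes>\<^bsub>P\<^esub> emb i y \<otimes>\<^bsub>P\<^esub> inv\<^bsub>P\<^esub> (emb i x)"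
      using x yc(1) emb_mult[OF i] emb_inv[OF i x] by (simp del: mult_product_group)
    then show ?thesis
      using N.inv_op_closed2[OF emb_closed[OF i x] yc(2)] x yc(1) unfolding factor_def by simp
  qed
  then show ?thesis unfolding Gi.normal_inv_iff using sub by blast
qed

text \<open>The commutator of \<open>f\<close> with \<open>emb i x\<close> lies in \<open>N\<close>
  by normality, and \<open>emb i x\<close> is trivial away from \<open>i\<close>, so there the
  coordinates of \<open>f\<close> and its inverse cancel.\<close>

lemma commutator_factor:
  assumes N: "N \<lhd> P" and i: "i \<in> I" and f: "f \<in> N" and x: "x \<in> carrier (G i)"
  shows "f i \<otimes>\<^bsub>G i\<^esub> x \<otimes>\<^bsub>G i\<^esub> inv\<^bsub>G i\<^esub> f i \<otimes>\<^bsub>G i\<^esub> inv\<^bsub>G i\<^esub> x \<in> factor i N"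
proof -
  interpret N: normal N P by (rule N)
  interpret Gi: group "G i" using grp[OF i] .
  interpret PG: group P by (rule P_group)
  have fc: "f \<in> carrier P" using f N.subset by blast
  have ec: "emb i x \<in> carrier P" using emb_closed[OF i x] .
  have fic: "f i \<in> carrier (G i)" using P_closed[OF fc i] .
  let ?c = "f i \<otimes>\<^bsub>G i\<^esub> x \<otimes>\<^bsub>G i\<^esub> inv\<^bsub>G i\<^esub> f i \<otimes>\<^bsub>G i\<^esub> inv\<^bsub>G i\<^esub> x"
  have c: "?c \<in> carrier (G i)" using fic x by simp
  let ?k = "f \<otimes>\<^bsub>P\<^esub> (emb i x \<otimes>\<^bsub>P\<^esub> inv\<^bsub>P\<^esub> f \<otimes>\<^bsub>P\<^esub> inv\<^bsub>P\<^esub> (emb i x))"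
  have "?k \<in> N" using N.inv_op_closed2[OF ec N.m_inv_closed[OF f]] subgroup.m_closed[OF N.subgroup_axioms f] by blast
  moreover have "emb i ?c = ?k"
  proof (rule P_eqI)
    show "emb i ?c \<in> carrier P" using emb_closed[OF i c] .
    show "?k \<in> carrier P" using fc ec P_mult_closed P_inv_closed by blast
    fix j assume j: "j \<in> I"
    interpret Gj: group "G j" using grp[OF j] .
    have fj: "f j \<in> carrier (G j)" using P_closed[OF fc j] .
    show "emb i ?c j = ?k j"
      unfolding mult_at[OF j] P_inv[OF fc j] P_inv[OF ec j]
      using i j fj x fic by (cases "j = i") (simp_all add: Gi.m_assoc)
  qed
  ultimately show ?thesis using c unfolding factor_def by simp
qed

text \<open>Take \<open>m\<close> in the projection but outside the commensurator. Its commutators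
  with the powers of \<open>h\<close> are pairwise distinct: an equality would make a nontrivial
  power of \<open>h\<close> commute with \<open>inv m\<close>, and thus put \<open>m\<close> into
  \<open>comm_set\<close>.\<close>

lemma factor_infinite:
  assumes N: "N \<lhd> P" and i: "i \<in> I" and inf: "infinite ((\<lambda>f. f i) ` N)"
    and ne: "\<not> elementary_group (G i)" and c: "cayley_has_strongly_contracting_element (G i) (S i)"
  shows "infinite (factor i N)"
proof
  assume fin: "finite (factor i N)"
  interpret Gi: marked_group "G i" "S i" using marked[OF i] .
  obtain h C where "contracting_axis (G i) (S i) h C" using Gi.contracting_axis_exists[OF c] .
  then interpret A: contracting_axis "G i" "S i" h C .
  obtain m where m: "m \<in> (\<lambda>f. f i) ` N" "m \<notin> A.comm_set"
    using A.not_subset_comm_set[OF ne projection_normal[OF N i] inf] .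
  have mc: "m \<in> carrier (G i)"
    using m(1) normal_imp_subgroup[OF projection_normal[OF N i]] subgroup.subset by blast
  let ?c = "\<lambda>k::int. m \<otimes>\<^bsub>G i\<^esub> A.hp k \<otimes>\<^bsub>G i\<^esub> inv\<^bsub>G i\<^esub> m \<otimes>\<^bsub>G i\<^esub> inv\<^bsub>G i\<^esub> (A.hp k)"
  have "range ?c \<subseteq> factor i N" using commutator_factor[OF N i] m(1) by auto
  then have "finite (range ?c)" using fin finite_subset by blast
  moreover have "inj ?c"
  proof (rule injI, rule ccontr)
    fix k l :: int assume eq: "?c k = ?c l" and kl: "k \<noteq> l"
    have "A.hp k \<otimes>\<^bsub>G i\<^esub> inv\<^bsub>G i\<^esub> m \<otimes>\<^bsub>G i\<^esub> A.hp (- k) = A.hp l \<otimes>\<^bsub>G i\<^esub> inv\<^bsub>G i\<^esub> m \<otimes>\<^bsub>G i\<^esub> A.hp (- l)"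
      using eq mc by (simp add: Gi.m_assoc A.hp_inv)
    then have "A.hp (- l) \<otimes>\<^bsub>G i\<^esub> (A.hp k \<otimes>\<^bsub>G i\<^esub> inv\<^bsub>G i\<^esub> m \<otimes>\<^bsub>G i\<^esub> A.hp (- k)) \<otimes>\<^bsub>G i\<^esub> A.hp k
        = A.hp (- l) \<otimes>\<^bsub>G i\<^esub> (A.hp l \<otimes>\<^bsub>G i\<^esub> inv\<^bsub>G i\<^esub> m \<otimes>\<^bsub>G i\<^esub> A.hp (- l)) \<otimes>\<^bsub>G i\<^esub> A.hp k" by simp
    then have "A.hp (k - l) \<otimes>\<^bsub>G i\<^esub> inv\<^bsub>G i\<^esub> m = inv\<^bsub>G i\<^esub> m \<otimes>\<^bsub>G i\<^esub> A.hp (k - l)"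
      using mc by (simp add: Gi.m_assoc A.hp_add A.hp_add_left)
    moreover have "k - l \<noteq> 0" using kl by simp
    ultimately have "inv\<^bsub>G i\<^esub> m \<in> A.comm_set"
      using Gi.inv_closed[OF mc] unfolding A.comm_set_def by blast
    then show False using A.comm_set_inv[of "inv\<^bsub>G i\<^esub> m"] m(2) mc by simp
  qed
  ultimately have "finite (UNIV :: int set)" by (rule finite_imageD)
  then show False by simp
qed

lemma rate_bound:
  assumes "i \<in> I" "e > 0"
  obtains K where "K > 0" "\<And>n. real (card (wball (G i) (S i) n)) \<le> K * exp ((rate i + e) * real n)"
proof -
  interpret Gi: marked_group "G i" "S i" using marked[OF assms(1)] .
  show ?thesis
    using that submultiplicative.growth_rate_exp[OF Gi.ball_submultiplicative, of "rate i + e"] assms(2) by auto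
qed

lemma card_ball_infty:
  "card (wball P Sinf n) = (\<Prod>i\<in>I. card (wball (G i) (S i) n))"
proof -
  interpret Pinf: marked_group P Sinf by (rule marked_infty)
  have "wball P Sinf n = (\<Pi>\<^sub>E i\<in>I. wball (G i) (S i) n)"
  proof
    show "wball P Sinf n \<subseteq> (\<Pi>\<^sub>E i\<in>I. wball (G i) (S i) n)"
    proof
      fix f assume f: "f \<in> wball P Sinf n"
      have fc: "f \<in> carrier P" using Pinf.ball_closed[OF f] .
      then have "\<forall>i\<in>I. f i \<in> wball (G i) (S i) n" using gens_infty_ball[OF fc] f by blast
      then show "f \<in> (\<Pi>\<^sub>E i\<in>I. wball (G i) (S i) n)" using fc by (simp add: PiE_iff)
    qed
    show "(\<Pi>\<^sub>E i\<in>I. wball (G i) (S i) n) \<subseteq> wball P Sinf n"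
    proof
      fix f assume f: "f \<in> (\<Pi>\<^sub>E i\<in>I. wball (G i) (S i) n)"
      have "f \<in> carrier P" using f marked_group.ball_closed[OF marked] by (auto simp: PiE_iff)
      then show "f \<in> wball P Sinf n" using f gens_infty_ball by (simp only: PiE_iff) blast
    qed
  qed
  then show ?thesis using finI by (simp add: card_PiE)
qed

lemma growth_rate_infty_ge: "(\<Sum>i\<in>I. rate i) \<le> growth_rate (\<lambda>n. card (wball P Sinf n))"
proof -
  interpret Pinf: marked_group P Sinf by (rule marked_infty)
  interpret B: submultiplicative "\<lambda>n. card (wball P Sinf n)" by (rule Pinf.ball_submultiplicative)
  show ?thesis
  proof (rule B.growth_rate_geI)
    fix n
    have "exp ((\<Sum>i\<in>I. rate i) * real n) = (\<Prod>i\<in>I. exp (rate i * real n))"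
      by (simp add: exp_sum[OF finI, symmetric] sum_distrib_right)
    also have "\<dots> \<le> (\<Prod>i\<in>I. real (card (wball (G i) (S i) n)))"
      using submultiplicative.exp_growth_rate_le marked_group.ball_submultiplicative[OF marked]
      by (intro prod_mono) auto
    finally show "exp ((\<Sum>i\<in>I. rate i) * real n) \<le> real (card (wball P Sinf n))"
      by (simp add: card_ball_infty)
  qed
qed

text \<open>A coset of \<open>N\<close> does not change when coordinate \<open>i\<close> of its
  representative is altered within its coset of \<open>factor i N\<close>. So this coordinate may be
  replaced by a fixed representative \<open>r\<close> of the same ball.\<close>

lemma card_coset_ball_infty_le:
  assumes N: "N \<lhd> P" and i: "i \<in> I"
  shows "card (marked_group.coset_ball P Sinf N n)
    \<le> card (marked_group.coset_ball (G i) (S i) (factor i N) n) * (\<Prod>j\<in>I - {i}. card (wball (G j) (S j) n))"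
proof -
  interpret Pinf: marked_group P Sinf by (rule marked_infty)
  interpret Gi: marked_group "G i" "S i" using marked[OF i] .
  interpret N: normal N P by (rule N)
  let ?M = "factor i N"
  interpret M: normal ?M "G i" by (rule factor_normal[OF N i])
  let ?Q = "Gi.coset_ball ?M n"
  let ?R = "\<Pi>\<^sub>E j\<in>I - {i}. wball (G j) (S j) n"
  have "\<forall>A\<in>?Q. \<exists>x. x \<in> wball (G i) (S i) n \<and> A = ?M #>\<^bsub>G i\<^esub> x" by (auto simp: Gi.coset_ball_def)
  then obtain r where r: "\<And>A. A \<in> ?Q \<Longrightarrow> r A \<in> wball (G i) (S i) n" "\<And>A. A \<in> ?Q \<Longrightarrow> A = ?M #>\<^bsub>G i\<^esub> r A"
    by metis
  let ?F = "\<lambda>(A, \<phi>). N #>\<^bsub>P\<^esub> (\<phi>(i := r A))"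
  have "Pinf.coset_ball N n \<subseteq> ?F ` (?Q \<times> ?R)"
  proof
    fix y assume "y \<in> Pinf.coset_ball N n"
    then obtain f where f: "y = N #>\<^bsub>P\<^esub> f" "f \<in> wball P Sinf n" by (auto simp: Pinf.coset_ball_def)
    have fc: "f \<in> carrier P" using Pinf.ball_closed[OF f(2)] .
    have fb: "f j \<in> wball (G j) (S j) n" if "j \<in> I" for j using gens_infty_ball[OF fc] f(2) that by blast
    have fic: "f i \<in> carrier (G i)" using P_closed[OF fc i] .
    let ?A = "?M #>\<^bsub>G i\<^esub> f i"
    have A: "?A \<in> ?Q" using fb[OF i] by (auto simp: Gi.coset_ball_def)
    have rc: "r ?A \<in> carrier (G i)" using Gi.ball_closed[OF r(1)[OF A]] .
    have "r ?A \<in> ?A" using Gi.rcos_self[OF rc M.subgroup_axioms] unfolding r(2)[OF A, symmetric] .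
    then obtain x where x: "x \<in> ?M" "r ?A = x \<otimes>\<^bsub>G i\<^esub> f i" unfolding r_coset_def by blast
    have xc: "x \<in> carrier (G i)" "emb i x \<in> N" using x(1) unfolding factor_def by blast+
    let ?\<phi> = "restrict f (I - {i})"
    have upd: "?\<phi>(i := r ?A) = emb i x \<otimes>\<^bsub>P\<^esub> f"
    proof (rule P_eqI)
      show "?\<phi>(i := r ?A) \<in> carrier P" using fc rc i by (auto simp: PiE_iff extensional_def)
      show "emb i x \<otimes>\<^bsub>P\<^esub> f \<in> carrier P" using P_mult_closed[OF emb_closed[OF i xc(1)] fc] .
      fix j assume j: "j \<in> I"
      show "(?\<phi>(i := r ?A)) j = (emb i x \<otimes>\<^bsub>P\<^esub> f) j"
        unfolding mult_at[OF j]
        using i j x(2) P_closed[OF fc j] grp[OF j] by (cases "j = i") (simp_all add: group.is_monoid monoid.l_one)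
    qed
    have "N #>\<^bsub>P\<^esub> (emb i x \<otimes>\<^bsub>P\<^esub> f) = N #>\<^bsub>P\<^esub> emb i x #>\<^bsub>P\<^esub> f"
      using Pinf.coset_mult_assoc[OF N.subset emb_closed[OF i xc(1)] fc] by simp
    also have "N #>\<^bsub>P\<^esub> emb i x = N"
      using Pinf.coset_join2[OF emb_closed[OF i xc(1)] N.subgroup_axioms xc(2)] .
    finally have "y = ?F (?A, ?\<phi>)" unfolding case_prod_conv upd f(1) by (rule sym)
    moreover have "?\<phi> \<in> ?R" using fb by auto
    ultimately show "y \<in> ?F ` (?Q \<times> ?R)" using A by blast
  qed
  moreover have "finite (?Q \<times> ?R)"
    using Gi.finite_coset_ball finI marked_group.finite_ball[OF marked]
    by (intro finite_cartesian_product finite_PiE) auto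
  ultimately have "card (Pinf.coset_ball N n) \<le> card (?Q \<times> ?R)" by (rule surj_card_le[rotated])
  then show ?thesis using finI by (simp add: card_cartesian_product card_PiE)
qed

lemma growth_rate_quotient_infty_le:
  assumes N: "N \<lhd> P" and i: "i \<in> I"
  shows "growth_rate (\<lambda>n. card (marked_group.coset_ball P Sinf N n))
    \<le> growth_rate (\<lambda>n. card (marked_group.coset_ball (G i) (S i) (factor i N) n)) + (\<Sum>j\<in>I - {i}. rate j)"
    (is "?l \<le> ?q + ?s")
proof (rule field_le_epsilon)
  fix e :: real assume e: "e > 0"
  interpret Pinf: marked_group P Sinf by (rule marked_infty)
  interpret Gi: marked_group "G i" "S i" using marked[OF i] .
  interpret B: submultiplicative "\<lambda>n. card (Pinf.coset_ball N n)"
    by (rule Pinf.coset_ball_submultiplicative[OF N])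
  interpret Q: submultiplicative "\<lambda>n. card (Gi.coset_ball (factor i N) n)"
    by (rule Gi.coset_ball_submultiplicative[OF factor_normal[OF N i]])
  \<comment> \<open>The error \<open>e\<close> is shared equally between the quotient of
    \<open>G i\<close> and the other factors.\<close>
  define \<epsilon> where "\<epsilon> = e / (1 + real (card (I - {i})))"
  have \<epsilon>: "\<epsilon> > 0" using e by (simp add: \<epsilon>_def add_pos_nonneg)
  have total: "\<epsilon> + real (card (I - {i})) * \<epsilon> = e"
  proof -
    have "1 + real (card (I - {i})) \<noteq> 0" by linarith
    then have "(1 + real (card (I - {i}))) * \<epsilon> = e" unfolding \<epsilon>_def by simp
    then show ?thesis by (simp add: distrib_right)
  qed
  obtain K where K: "K > 0" "\<And>n. real (card (Gi.coset_ball (factor i N) n)) \<le> K * exp ((?q + \<epsilon>) * real n)"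
    using Q.growth_rate_exp[of "?q + \<epsilon>"] \<epsilon> by auto
  have "\<exists>K>0. \<forall>n. real (card (wball (G j) (S j) n)) \<le> K * exp ((rate j + \<epsilon>) * real n)" if "j \<in> I" for j
    using rate_bound[OF that \<epsilon>] by blast
  then obtain k where k: "\<And>j. j \<in> I \<Longrightarrow> k j > 0"
    "\<And>j n. j \<in> I \<Longrightarrow> real (card (wball (G j) (S j) n)) \<le> k j * exp ((rate j + \<epsilon>) * real n)"
    by metis
  have "real (card (Pinf.coset_ball N n)) \<le> K * (\<Prod>j\<in>I - {i}. k j) * exp ((?q + ?s + e) * real n)" for n
  proof -
    have "real (card (Pinf.coset_ball N n))
        \<le> real (card (Gi.coset_ball (factor i N) n)) * (\<Prod>j\<in>I - {i}. real (card (wball (G j) (S j) n)))"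
      using card_coset_ball_infty_le[OF N i, of n] unfolding of_nat_prod[symmetric] of_nat_mult[symmetric] of_nat_le_iff .
    also have "\<dots> \<le> (K * exp ((?q + \<epsilon>) * real n)) * (\<Prod>j\<in>I - {i}. k j * exp ((rate j + \<epsilon>) * real n))"
      using K k by (intro mult_mono prod_mono prod_nonneg) (auto simp: less_imp_le)
    also have "\<dots> = K * (\<Prod>j\<in>I - {i}. k j) * (exp ((?q + \<epsilon>) * real n) * exp (\<Sum>j\<in>I - {i}. (rate j + \<epsilon>) * real n))"
      using finI by (simp add: prod.distrib exp_sum)
    also have "exp ((?q + \<epsilon>) * real n) * exp (\<Sum>j\<in>I - {i}. (rate j + \<epsilon>) * real n) = exp ((?q + ?s + e) * real n)"
      unfolding exp_add[symmetric] total[symmetric]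
      by (simp add: sum_distrib_right[symmetric] sum.distrib distrib_right add_ac)
    finally show ?thesis .
  qed
  moreover have "K * (\<Prod>j\<in>I - {i}. k j) > 0" using K(1) k(1) by (intro mult_pos_pos prod_pos) auto
  ultimately show "?l \<le> ?q + ?s + e" by (intro B.growth_rate_leI)
qed

theorem product_infty_growth_tight:
  assumes ne: "\<And>i. i \<in> I \<Longrightarrow> \<not> elementary_group (G i)"
    and c: "\<And>i. i \<in> I \<Longrightarrow> cayley_has_strongly_contracting_element (G i) (S i)"
  shows "cayley_growth_tight P Sinf"
proof -
  interpret Pinf: marked_group P Sinf by (rule marked_infty)
  show ?thesis unfolding Pinf.growth_tight_iff
  proof (intro allI impI, elim conjE)
    fix N assume N: "N \<lhd> P" and inf: "infinite N"
    have "N \<subseteq> carrier P" using normal_imp_subgroup[OF N] by (rule subgroup.subset)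
    then obtain i where i: "i \<in> I" "infinite ((\<lambda>f. f i) ` N)" using infinite_projection[OF inf] by blast
    interpret Gi: marked_group "G i" "S i" using marked[OF i(1)] .
    have "growth_rate (\<lambda>n. card (Gi.coset_ball (factor i N) n)) < rate i"
      using factor_infinite[OF N i ne[OF i(1)] c[OF i(1)]]
      by (intro Gi.growth_rate_quotient_less ne c i(1) factor_normal[OF N i(1)])
    moreover have "(\<Sum>j\<in>I. rate j) = rate i + (\<Sum>j\<in>I - {i}. rate j)"
      using finI i(1) by (rule sum.remove)
    \<comment> \<open>A strict loss in the single factor \<open>i\<close> is enough, since the other
      factors contribute the same rates to both sides.\<close>
    ultimately show "growth_rate (\<lambda>n. card (Pinf.coset_ball N n)) < growth_rate (\<lambda>n. card (wball P Sinf n))"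
      using growth_rate_quotient_infty_le[OF N i(1)] growth_rate_infty_ge by linarith
  qed
qed

end

theorem corollary1p3:
  fixes n :: nat
    and G :: "nat \<Rightarrow> ('a, 'b) monoid_scheme"
    and S :: "nat \<Rightarrow> 'a set"
  assumes "n \<ge> 2"
    and "\<And>i. i \<in> {1..n} \<Longrightarrow> group (G i)"
    and "\<And>i. i \<in> {1..n} \<Longrightarrow> \<not> elementary_group (G i)"
    and "\<And>i. i \<in> {1..n} \<Longrightarrow> finite_generating_set (G i) (S i)"
    and "\<And>i. i \<in> {1..n} \<Longrightarrow> symmetric_subset (G i) (S i)"
    and "\<And>i. i \<in> {1..n} \<Longrightarrow> cayley_has_strongly_contracting_element (G i) (S i)"
  shows "finite_generating_set (product_group {1..n} G) (product_gens_one {1..n} G S) \<and>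
         finite_generating_set (product_group {1..n} G) (product_gens_infty {1..n} G S) \<and>
         \<not> cayley_growth_tight (product_group {1..n} G) (product_gens_one {1..n} G S) \<and>
         cayley_growth_tight (product_group {1..n} G) (product_gens_infty {1..n} G S)"
proof -
  have "marked_group (G i) (S i)" if "i \<in> {1..n}" for i
    using assms(2,4,5)[OF that]
    by (auto simp: marked_group_def marked_group_axioms_def finite_generating_set_def symmetric_subset_def)
  then interpret marked_family "{1..n}" G S
    by (intro marked_family.intro) auto
  have gens: "finite_generating_set (product_group {1..n} G) T" if "marked_group (product_group {1..n} G) T" for T
    using that by (auto simp: finite_generating_set_def marked_group_def marked_group_axioms_def)
  have "infinite (carrier (G i))" if "i \<in> {1..n}" for i
    using assms(3)[OF that] by (auto simp: elementary_group_def)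
  then have "\<not> cayley_growth_tight (product_group {1..n} G) (product_gens_one {1..n} G S)"
    using assms(1) by (intro product_one_not_growth_tight) auto
  moreover have "cayley_growth_tight (product_group {1..n} G) (product_gens_infty {1..n} G S)"
    using assms(3,6) by (rule product_infty_growth_tight)
  ultimately show ?thesis using gens marked_one marked_infty by blast
qed

end
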